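(* Let $A=\bigoplus_{t\in T}A^{(t)}$ be a finite dimensional $T$-graded-simple algebra over a field $F$ of characteristic $0$ for a right zero band $T$. Suppose $A/J(A) \cong M_2(F)$. Let $\pi\colon A\to A/J(A)$ be the natural epimorphism, $I_t:=\pi(A^{(t)})$, $T_0 := \{ t\in T \mid \dim I_t=2 \}$, $T_1 := \{ t\in T \mid I_t = A/J(A) \}$, and let $\sim$ be the equivalence relation $t_1\sim t_2\iff I_{t_1}=I_{t_2}$; denote by $\bar t$ the $\sim$-class in $T_0$ of $t\in T_0$. Suppose also that $|\bar t_0| > \frac{|T_0|}{2}$ for some $\bar t_0 \in T_0/{\sim}$. Then the limit $\lim_{n\to\infty}\sqrt[n]{c_n^{T\text{-}\mathrm{gr}}(A)}$ exists and $$\lim_{n\to\infty}\sqrt[n]{c_n^{T\text{-}\mathrm{gr}}(A)} = |T_0|+2|T_1| + 2\sqrt{(|T_1|+|\bar t_0|)(|T_0|+|T_1|-|\bar t_0|)}<2|T_0|+4|T_1|=\dim A.$$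
   Context: Algebras are associative, not necessarily unital; $J(A)$ is the Jacobson radical. A right zero band is a semigroup $T$ with $st=t$ for all $s,t\in T$. $T$-graded means $A=\bigoplus_{t\in T}A^{(t)}$ (subspaces) with $A^{(s)}A^{(t)}\subseteq A^{(st)}$; $A$ is $T$-graded-simple if $A^2\ne0$ and $0$ and $A$ are the only two-sided ideals $I$ with $I=\bigoplus_t (I\cap A^{(t)})$. Graded codimensions: let $F\langle X^{T\text{-}\mathrm{gr}}\rangle$ be the free associative algebra without $1$ on variables $x_i^{(t)}$, $i\in\mathbb N$, $t\in T$. A polynomial $f(x_{i_1}^{(t_1)},\ldots,x_{i_s}^{(t_s)})$ is a graded polynomial identity of $A$ if it vanishes under all substitutions of elements of $A^{(t_j)}$ for $x_{i_j}^{(t_j)}$; $\operatorname{Id}^{T\text{-}\mathrm{gr}}(A)$ is the set of these. With $P_n^{T\text{-}\mathrm{gr}}=\langle x_{\sigma(1)}^{(t_1)}\cdots x_{\sigma(n)}^{(t_n)}\mid t_i\in T,\ \sigma\in S_n\rangle_F$, one sets $c_n^{T\text{-}\mathrm{gr}}(A)=\dim\bigl(P_n^{T\text{-}\mathrm{gr}}/(P_n^{T\text{-}\mathrm{gr}}\cap\operatorname{Id}^{T\text{-}\mathrm{gr}}(A))\bigr)$. *)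

theory Defs
  imports
    "HOL-Analysis.Analysis"
    "HOL-Combinatorics.Permutations"
    "HOL-Library.Poly_Mapping"
    "HOL-Library.Set_Algebras"
begin

section \<open>Quotients of vector spaces\<close>

text \<open>\<open>cosets U W\<close> is the image of \<open>U\<close> under the canonical map \<open>v \<mapsto> v + W\<close>;
  it is \<open>U / W\<close> when \<open>W \<subseteq> U\<close>.\<close>

definition cosets :: "'b::ab_group_add set \<Rightarrow> 'b set \<Rightarrow> 'b set set"
  where "cosets U W = (\<lambda>v. v +o W) ` U"

text \<open>The cosets \<open>b + W\<close>, for \<open>b \<in> B\<close>, are pairwise distinct and form a basis of \<open>cosets U W\<close>.
  As a coset is zero iff its representatives lie in \<open>W\<close>, independence of the family of
  cosets says that no nontrivial linear combination of \<open>B\<close> lies in \<open>W\<close>; for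
  \<open>0 \<in> W\<close> this includes that distinct elements of \<open>B\<close> have distinct cosets.\<close>

definition coset_basis :: "('f::field \<Rightarrow> 'b::ab_group_add \<Rightarrow> 'b) \<Rightarrow> 'b set \<Rightarrow> 'b set \<Rightarrow> 'b set \<Rightarrow> bool"
  where "coset_basis scl B U W \<longleftrightarrow>
    B \<subseteq> U \<and>
    (\<forall>S c. finite S \<longrightarrow> S \<subseteq> B \<longrightarrow> (\<Sum>b\<in>S. scl (c b) b) \<in> W \<longrightarrow> (\<forall>b\<in>S. c b = 0)) \<and>
    (\<forall>u\<in>U. \<exists>S c. finite S \<and> S \<subseteq> B \<and> u +o W = (\<Sum>b\<in>S. scl (c b) b) +o W)"

text \<open>The dimension of \<open>cosets U W\<close> as a subspace of the quotient by \<open>W\<close>, for subspaces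
  \<open>U\<close> and \<open>W\<close>. As with \<open>dim\<close>, the value is \<open>0\<close> if the dimension is infinite.\<close>

definition quot_dim :: "('f::field \<Rightarrow> 'b::ab_group_add \<Rightarrow> 'b) \<Rightarrow> 'b set \<Rightarrow> 'b set \<Rightarrow> nat"
  where "quot_dim scl U W = card (SOME B. coset_basis scl B U W)"

context vector_space
begin

lemma coset_eq_iff:
  assumes "subspace W"
  shows "u +o W = v +o W \<longleftrightarrow> u - v \<in> W"
proof
  assume eq: "u +o W = v +o W"
  have "u \<in> u +o W"
    using subspace_0[OF assms] by (force simp: elt_set_plus_def)
  then have "u \<in> v +o W" using eq by simp
  then show "u - v \<in> W" by (auto simp: elt_set_plus_def)
next
  assume uv: "u - v \<in> W"
  show "u +o W = v +o W"
  proof (intro set_eqI iffI)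
    fix x assume "x \<in> u +o W"
    then obtain w where w: "w \<in> W" "x = u + w" by (auto simp: elt_set_plus_def)
    then have "(u - v) + w \<in> W" using uv subspace_add[OF assms] by blast
    moreover have "x = v + ((u - v) + w)" using w by simp
    ultimately show "x \<in> v +o W" unfolding elt_set_plus_def by blast
  next
    fix x assume "x \<in> v +o W"
    then obtain w where w: "w \<in> W" "x = v + w" by (auto simp: elt_set_plus_def)
    then have "w - (u - v) \<in> W" using uv subspace_diff[OF assms] by blast
    moreover have "x = u + (w - (u - v))" using w by simp
    ultimately show "x \<in> u +o W" unfolding elt_set_plus_def by blast
  qed
qed

lemma coset_basis_exists:
  assumes U: "subspace U" and W: "subspace W"
  shows "\<exists>B. coset_basis scale B U W"
proof -
  define ind where "ind B \<longleftrightarrow> (\<forall>S c. finite S \<longrightarrow> S \<subseteq> B \<longrightarrow>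
    (\<Sum>b\<in>S. scale (c b) b) \<in> W \<longrightarrow> (\<forall>b\<in>S. c b = 0))" for B
  have indD: "c b = 0"
    if "ind B" "finite S" "S \<subseteq> B" "(\<Sum>b\<in>S. scale (c b) b) \<in> W" "b \<in> S" for B S c b
    using that unfolding ind_def by metis
  let ?\<A> = "{B. B \<subseteq> U \<and> ind B}"
  have "\<exists>M\<in>?\<A>. \<forall>X\<in>?\<A>. M \<subseteq> X \<longrightarrow> X = M"
  proof (rule subset_Zorn_nonempty)
    show "?\<A> \<noteq> {}" by (auto simp: ind_def intro!: exI[of _ "{}"])
  next
    fix \<C> assume ne: "\<C> \<noteq> {}" and ch: "subset.chain ?\<A> \<C>"
    then have sub: "\<C> \<subseteq> ?\<A>" by (simp add: subset_chain_def)
    have "ind (\<Union>\<C>)" unfolding ind_def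
    proof (intro allI impI ballI)
      fix S c b assume S: "finite S" "S \<subseteq> \<Union>\<C>" "(\<Sum>b\<in>S. scale (c b) b) \<in> W" "b \<in> S"
      obtain X where X: "X \<in> \<C>" "S \<subseteq> X"
        using finite_subset_Union_chain[OF S(1,2) ne ch] by blast
      then have "ind X" using sub by blast
      then show "c b = 0" using indD S X(2) by metis
    qed
    then show "\<Union>\<C> \<in> ?\<A>" using sub by blast
  qed
  then obtain M where "M \<in> ?\<A>" and max: "\<forall>X\<in>?\<A>. M \<subseteq> X \<longrightarrow> X = M" by (rule bexE)
  then have M: "M \<subseteq> U" "ind M" by simp_all
  have mx: "X = M" if "X \<subseteq> U" "ind X" "M \<subseteq> X" for X
    using max that by simp
  have "\<exists>S c. finite S \<and> S \<subseteq> M \<and> u +o W = (\<Sum>b\<in>S. scale (c b) b) +o W" if u: "u \<in> U" for u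
  proof (cases "u \<in> M")
    case True
    then show ?thesis by (intro exI[of _ "{u}"] exI[of _ "\<lambda>_. 1"]) simp
  next
    case False
    have "\<not> ind (insert u M)"
      using mx[of "insert u M"] M(1) u False by blast
    then obtain S c b where S: "finite S" "S \<subseteq> insert u M" "(\<Sum>b\<in>S. scale (c b) b) \<in> W"
      and b: "b \<in> S" "c b \<noteq> 0" unfolding ind_def by metis
    have uS: "u \<in> S"
    proof (rule ccontr)
      assume "u \<notin> S"
      then have "S \<subseteq> M" using S(2) by blast
      then show False using indD[OF M(2) S(1) _ S(3)] b by metis
    qed
    let ?S = "S - {u}"
    have split: "(\<Sum>b\<in>S. scale (c b) b) = scale (c u) u + (\<Sum>b\<in>?S. scale (c b) b)"
      using S(1) uS by (simp add: sum.remove)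
    have SM: "?S \<subseteq> M" "finite ?S" using S by auto
    have cu: "c u \<noteq> 0"
    proof
      assume c0: "c u = 0"
      then have "(\<Sum>b\<in>?S. scale (c b) b) \<in> W" using S(3) split by simp
      moreover have "b \<in> ?S" using b c0 by auto
      ultimately show False using indD[OF M(2) SM(2) SM(1)] b(2) by metis
    qed
    have "scale (inverse (c u)) (\<Sum>b\<in>S. scale (c b) b) \<in> W"
      using S(3) W by (rule subspace_scale[rotated])
    moreover have "scale (inverse (c u)) (\<Sum>b\<in>S. scale (c b) b)
        = u - (\<Sum>b\<in>?S. scale (- inverse (c u) * c b) b)"
      using cu by (simp only: split scale_right_distrib scale_sum_right)
        (simp add: sum_negf)
    ultimately have "u - (\<Sum>b\<in>?S. scale (- inverse (c u) * c b) b) \<in> W" by simp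
    then have "u +o W = (\<Sum>b\<in>?S. scale (- inverse (c u) * c b) b) +o W"
      using coset_eq_iff[OF W] by blast
    then show ?thesis
      using SM by (intro exI[of _ ?S] exI[of _ "\<lambda>b. - inverse (c u) * c b"] conjI)
  qed
  then have "coset_basis scale M U W" using M unfolding coset_basis_def ind_def by metis
  then show ?thesis ..
qed

lemma coset_basis_card_le:
  assumes W: "subspace W" and B: "coset_basis scale B U W" "finite B" and C: "coset_basis scale C U W"
  shows "finite C \<and> card C \<le> card B"
proof -
  have le: "finite S \<Longrightarrow> S \<subseteq> C \<Longrightarrow> card S \<le> card B" for S
  proof -
    assume S: "finite S" "S \<subseteq> C"
    have "\<forall>s\<in>S. \<exists>w\<in>W. s - w \<in> span B"
    proof
      fix s assume "s \<in> S"
      then have "s \<in> U" using S C by (auto simp: coset_basis_def)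
      then obtain R c where R: "finite R" "R \<subseteq> B" "s +o W = (\<Sum>b\<in>R. scale (c b) b) +o W"
        using B unfolding coset_basis_def by meson
      let ?x = "\<Sum>b\<in>R. scale (c b) b"
      have "?x \<in> span B" using R by (meson span_base span_scale span_sum subsetD)
      moreover have "s - ?x \<in> W" using R(3) coset_eq_iff[OF W] by blast
      moreover have "s - (s - ?x) = ?x" by simp
      ultimately show "\<exists>w\<in>W. s - w \<in> span B" by metis
    qed
    then obtain w where w: "\<And>s. s \<in> S \<Longrightarrow> w s \<in> W \<and> s - w s \<in> span B" by metis
    let ?f = "\<lambda>s. s - w s"
    have zero: "\<forall>s\<in>S. c s = 0" if "(\<Sum>s\<in>S. scale (c s) (?f s)) = 0" for c
    proof -
      have "(\<Sum>s\<in>S. scale (c s) s) = (\<Sum>s\<in>S. scale (c s) (w s))"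
        using that by (simp add: scale_right_diff_distrib sum_subtractf)
      moreover have "(\<Sum>s\<in>S. scale (c s) (w s)) \<in> W"
        using w W by (meson subspace_scale subspace_sum)
      ultimately have "(\<Sum>s\<in>S. scale (c s) s) \<in> W" by simp
      then show ?thesis using C S unfolding coset_basis_def by blast
    qed
    have inj: "inj_on ?f S"
    proof (rule inj_onI, rule ccontr)
      fix x y assume xy: "x \<in> S" "y \<in> S" "?f x = ?f y" "x \<noteq> y"
      let ?c = "\<lambda>s. if s = x then 1 else if s = y then - 1 else 0"
      have "(\<Sum>s\<in>S. scale (?c s) (?f s)) = (\<Sum>s\<in>{x,y}. scale (?c s) (?f s))"
        using S(1) xy(1,2) by (intro sum.mono_neutral_right) auto
      also have "\<dots> = 0" using xy(3,4) by simp
      finally show False using bspec[OF zero xy(1)] by fastforce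
    qed
    have "independent (?f ` S)"
      unfolding independent_explicit_finite_subsets
    proof (intro allI impI)
      fix Q u assume Q: "Q \<subseteq> ?f ` S" "finite Q" "(\<Sum>v\<in>Q. scale (u v) v) = 0"
      let ?R = "{s\<in>S. ?f s \<in> Q}"
      have QR: "Q = ?f ` ?R" using Q(1) by auto
      have injR: "inj_on ?f ?R" using inj by (rule inj_on_subset) auto
      have "(\<Sum>s\<in>?R. scale (u (?f s)) (?f s)) = (\<Sum>v\<in>?f ` ?R. scale (u v) v)"
        using injR by (simp add: sum.reindex)
      then have "(\<Sum>s\<in>?R. scale (u (?f s)) (?f s)) = 0" using Q(3) QR by simp
      moreover have "(\<Sum>s\<in>S. scale (if s \<in> ?R then u (?f s) else 0) (?f s))
          = (\<Sum>s\<in>?R. scale (u (?f s)) (?f s))"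
        using S(1) by (intro sum.mono_neutral_cong_right) auto
      ultimately have "\<forall>s\<in>S. (if s \<in> ?R then u (?f s) else 0) = 0"
        using zero[of "\<lambda>s. if s \<in> ?R then u (?f s) else 0"] by simp
      then have "\<forall>s\<in>?R. u (?f s) = 0" by auto
      then have "\<forall>v\<in>?f ` ?R. u v = 0" by blast
      then show "\<forall>v\<in>Q. u v = 0" using QR by simp
    qed
    moreover have "?f ` S \<subseteq> span B" using w by blast
    ultimately have "card (?f ` S) \<le> card B"
      using independent_span_bound[OF B(2)] by blast
    then show "card S \<le> card B" by (simp add: card_image[OF inj])
  qed
  have "finite C"
  proof (rule ccontr)
    assume "infinite C"
    then obtain S where "S \<subseteq> C" "finite S" "card S = Suc (card B)"
      using infinite_arbitrarily_large by blast
    then show False using le[of S] by simp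
  qed
  then show ?thesis using le[of C] by blast
qed

lemma quot_dim_eq_card:
  assumes "subspace W" "coset_basis scale B U W" "finite B"
  shows "quot_dim scale U W = card B"
proof -
  have C: "coset_basis scale (SOME B. coset_basis scale B U W) U W"
    using assms(2) by (rule someI)
  show ?thesis
    unfolding quot_dim_def
    using coset_basis_card_le[OF assms(1) assms(2,3) C]
      coset_basis_card_le[OF assms(1) C _ assms(2)] by linarith
qed

end

section \<open>Algebras and the Jacobson radical\<close>

text \<open>Class \<^class>\<open>ring\<close> is the class of associative, not necessarily unital rings.\<close>

locale assoc_algebra = vector_space scale
  for scale :: "'f::field \<Rightarrow> 'a::ring \<Rightarrow> 'a" +
  assumes scale_mult_left: "scale c x * y = scale c (x * y)"
    and scale_mult_right: "x * scale c y = scale c (x * y)"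
begin

definition finite_dim :: bool
  where "finite_dim \<longleftrightarrow> (\<exists>B. finite B \<and> span B = UNIV)"

definition right_ideal :: "'a set \<Rightarrow> bool"
  where "right_ideal I \<longleftrightarrow> subspace I \<and> (\<forall>x\<in>I. \<forall>a. x * a \<in> I)"

definition two_sided_ideal :: "'a set \<Rightarrow> bool"
  where "two_sided_ideal I \<longleftrightarrow> subspace I \<and> (\<forall>x\<in>I. \<forall>a. a * x \<in> I \<and> x * a \<in> I)"

definition maximal_right_ideal :: "'a set \<Rightarrow> bool"
  where "maximal_right_ideal I \<longleftrightarrow> right_ideal I \<and> I \<noteq> UNIV \<and>
    (\<forall>K. right_ideal K \<longrightarrow> I \<subseteq> K \<longrightarrow> K = I \<or> K = UNIV)"

text \<open>A right ideal is regular (modular) if it has a left unit modulo itself; this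
  is automatic if the algebra is unital.\<close>

definition regular_right_ideal :: "'a set \<Rightarrow> bool"
  where "regular_right_ideal I \<longleftrightarrow> right_ideal I \<and> (\<exists>e. \<forall>x. x - e * x \<in> I)"

text \<open>The Jacobson radical of a not necessarily unital algebra; it is the whole algebra
  if there are no regular maximal right ideals.\<close>

definition jacobson_radical :: "'a set"
  where "jacobson_radical = \<Inter>{I. maximal_right_ideal I \<and> regular_right_ideal I}"

text \<open>The quotient algebra by a two-sided ideal \<open>I\<close>, with the operations
  \<open>(a + I) + (b + I) = (a + b) + I\<close>, \<open>(a + I)(b + I) = ab + I\<close>, \<open>c (a + I) = ca + I\<close>,
  is isomorphic to the algebra of \<open>2 \<times> 2\<close> matrices.\<close>

definition quotient_iso_M2 :: "'a set \<Rightarrow> bool"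
  where "quotient_iso_M2 I \<longleftrightarrow> (\<exists>\<phi> :: 'a set \<Rightarrow> 'f^2^2.
    bij_betw \<phi> (cosets UNIV I) UNIV \<and>
    (\<forall>a b. \<phi> ((a + b) +o I) = \<phi> (a +o I) + \<phi> (b +o I)) \<and>
    (\<forall>a b. \<phi> ((a * b) +o I) = \<phi> (a +o I) ** \<phi> (b +o I)) \<and>
    (\<forall>c a. \<phi> (scale c a +o I) = (\<chi> i j. c * \<phi> (a +o I) $ i $ j)))"

end

section \<open>Graded algebras\<close>

locale graded_algebra = assoc_algebra scale
  for scale :: "'f::field \<Rightarrow> 'a::ring \<Rightarrow> 'a"
    and A :: "'t::semigroup_mult \<Rightarrow> 'a set" +
  assumes subspace_component: "subspace (A t)"
    and span_components: "span (\<Union>t. A t) = UNIV"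
    and components_direct: "A t \<inter> span (\<Union>s\<in>UNIV - {t}. A s) = {0}"
    and component_mult: "x \<in> A s \<Longrightarrow> y \<in> A t \<Longrightarrow> x * y \<in> A (s * t)"
begin

text \<open>The sum of the \<open>I \<inter> A t\<close> is direct since that of the \<open>A t\<close> is.\<close>

definition homogeneous_ideal :: "'a set \<Rightarrow> bool"
  where "homogeneous_ideal I \<longleftrightarrow> two_sided_ideal I \<and> I = span (\<Union>t. I \<inter> A t)"

definition graded_simple :: bool
  where "graded_simple \<longleftrightarrow> span {x * y | x y. True} \<noteq> {0} \<and>
    (\<forall>I. homogeneous_ideal I \<longrightarrow> I = {0} \<or> I = UNIV)"

end

section \<open>Graded polynomial identities and codimensions\<close>

text \<open>The variable \<open>x\<^sub>i\<^sup>(\<^sup>t\<^sup>)\<close> is the pair \<open>(i, t)\<close>, a monomial is a list of variables, and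
  a noncommutative polynomial is a finitely supported function on monomials. The free
  algebra without 1 consists of the polynomials in which the empty monomial does not occur.
  Its multiplication is not needed below.\<close>

type_synonym ('t, 'f) ncpoly = "(nat \<times> 't) list \<Rightarrow>\<^sub>0 'f"

definition ncpoly_scale :: "'f::field \<Rightarrow> ('t, 'f) ncpoly \<Rightarrow> ('t, 'f) ncpoly"
  where "ncpoly_scale c p = Poly_Mapping.map (\<lambda>x. c * x) p"

lemma lookup_ncpoly_scale: "Poly_Mapping.lookup (ncpoly_scale c p) w = c * Poly_Mapping.lookup p w"
  by (simp add: ncpoly_scale_def Poly_Mapping.map.rep_eq when_def)

lemma vector_space_ncpoly: "vector_space ncpoly_scale"
  by unfold_locales
    (auto intro!: poly_mapping_eqI simp: lookup_ncpoly_scale lookup_add algebra_simps)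

definition free_algebra :: "('t, 'f::field) ncpoly set"
  where "free_algebra = {p. [] \<notin> Poly_Mapping.keys p}"

text \<open>The value at the empty monomial is never used.\<close>

fun eval_monomial :: "(nat \<times> 't \<Rightarrow> 'a::ring) \<Rightarrow> (nat \<times> 't) list \<Rightarrow> 'a"
  where
    "eval_monomial \<phi> [] = 0"
  | "eval_monomial \<phi> [x] = \<phi> x"
  | "eval_monomial \<phi> (x # y # w) = \<phi> x * eval_monomial \<phi> (y # w)"

text \<open>The multilinear space \<open>P\<^sub>n\<close>, spanned by the monomials
  \<open>x\<^bsub>\<sigma>(1)\<^esub>\<^sup>(\<^sup>t\<^sup>1\<^sup>) \<cdots> x\<^bsub>\<sigma>(n)\<^esub>\<^sup>(\<^sup>t\<^sup>n\<^sup>)\<close>.\<close>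

definition multilinear_ncpolys :: "nat \<Rightarrow> ('t, 'f::field) ncpoly set"
  where "multilinear_ncpolys n = module.span ncpoly_scale
    {Poly_Mapping.single (map (\<lambda>j. (\<sigma> j, t j)) [1..<n+1]) 1 | \<sigma> t. \<sigma> permutes {1..n}}"

context graded_algebra
begin

definition eval_ncpoly :: "(nat \<times> 't \<Rightarrow> 'a) \<Rightarrow> ('t, 'f) ncpoly \<Rightarrow> 'a"
  where "eval_ncpoly \<phi> p =
    (\<Sum>w\<in>Poly_Mapping.keys p. scale (Poly_Mapping.lookup p w) (eval_monomial \<phi> w))"

definition graded_identities :: "('t, 'f) ncpoly set"
  where "graded_identities =
    {p \<in> free_algebra. \<forall>\<phi>. (\<forall>i t. \<phi> (i, t) \<in> A t) \<longrightarrow> eval_ncpoly \<phi> p = 0}"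

definition graded_codim :: "nat \<Rightarrow> nat"
  where "graded_codim n = quot_dim ncpoly_scale
    (multilinear_ncpolys n) (multilinear_ncpolys n \<inter> graded_identities)"

end

end

theory Submission
  imports Defs "HOL-Library.Function_Algebras"
begin

text \<open>Since \<open>T\<close> is a right zero band, the components \<open>A t\<close> are left ideals, and the sum of the
  intersections \<open>A t \<inter> J\<close> is a homogeneous ideal. Hence \<open>A t\<close> embeds into the matrices as a left ideal: it
  is zero, all of \<open>M\<^sub>2\<close>, or a space \<open>{u \<otimes> w | u}\<close> with a fixed covector \<open>w\<close>. Conjugating, \<open>w = e\<^sub>1\<close> for
  the class of \<open>t\<^sub>0\<close>, and \<open>w = e\<^sub>2 + p e\<^sub>1\<close> for the other elements of \<open>T\<^sub>0\<close>. Let \<open>M\<close> and \<open>N\<close> be the numbers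
  of components that contain a vector of column 1 and of column 2, respectively; then
  \<open>M = |T\<^sub>1| + m\<close> and \<open>N = |T\<^sub>1| + |T\<^sub>0| - m\<close> where \<open>m\<close> is the size of the class of \<open>t\<^sub>0\<close>.

  Upper bound. A product of matrices expands into monomials in the matrix entries. A path through
  the entries uses the row index 1 at least as often, up to 1, as the column index 1, and this
  survives the rewriting of entries in column 1 through those in column 2. Weighting rows and
  columns of index 1 by \<open>z\<close> and \<open>1/z\<close>, one counts at most a constant times
  \<open>((1 + z) (M / z + N))\<^sup>n\<close> monomials; take \<open>z = sqrt (M / N)\<close>.

  Lower bound. Two variables \<open>y\<^sub>1, y\<^sub>2\<close> of degree \<open>t\<^sub>0\<close> suffice to realize traces:
  \<open>[x y\<^sub>1, y\<^sub>2] + [y\<^sub>1, x y\<^sub>2] = tr x [y\<^sub>1, y\<^sub>2]\<close>. So for all permutations \<open>g\<close> the functions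
  \<open>\<Prod>\<^sub>j w\<^sub>j(u\<^bsub>g j\<^esub>) [y\<^sub>1, y\<^sub>2]\<close> of \<open>x\<^sub>j = u\<^sub>j \<otimes> w\<^sub>j\<close> are values of polynomials. Antisymmetrizing along two
  standard tableaux of shape \<open>(n - l, l)\<close>, one for the \<open>u\<^sub>j\<close> and one for the \<open>w\<^sub>j\<close>, gives a family that is
  triangular with respect to evaluations at basis vectors, and whose size is, up to a polynomial
  factor, \<open>(n choose l)\<^sup>2 N\<^sup>l M\<^bsup>n - l\<^esup>\<close>. Both bounds grow like \<open>(sqrt M + sqrt N)\<^bsup>2 n\<^esup>\<close>.\<close>

section \<open>Codimensions as dimensions of spaces of functions\<close>

lemma vector_space_fun:
  fixes scale :: "'f::field \<Rightarrow> 'b::ab_group_add \<Rightarrow> 'b"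
  assumes "vector_space scale"
  shows "vector_space (\<lambda>c f x. scale c (f x))"
proof -
  interpret vector_space scale by fact
  show ?thesis
    by unfold_locales (auto simp: fun_eq_iff scale_right_distrib scale_left_distrib)
qed

context vector_space
begin

text \<open>Stated for an indexed family, so that cardinalities can be read off from the index set.
  A repeated value would satisfy a relation with coefficients 1 and -1, whence injectivity.\<close>

lemma independent_family:
  assumes "\<And>S c. finite S \<Longrightarrow> S \<subseteq> I \<Longrightarrow> (\<Sum>i\<in>S. scale (c i) (g i)) = 0 \<Longrightarrow> \<forall>i\<in>S. c i = 0"
  shows "inj_on g I" "independent (g ` I)"
proof -
  show inj: "inj_on g I"
  proof (rule inj_onI, rule ccontr)
    fix x y assume xy: "x \<in> I" "y \<in> I" "g x = g y" "x \<noteq> y"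
    have "(\<Sum>i\<in>{x, y}. scale (if i = x then 1 else - 1) (g i)) = 0" using xy(3,4) by simp
    then have "\<forall>i\<in>{x, y}. (if i = x then 1 else - 1) = (0::'a)"
      using xy(1,2) by (intro assms) auto
    then show False by simp
  qed
  show "independent (g ` I)"
    unfolding independent_explicit_finite_subsets
  proof (intro allI impI)
    fix Q u assume Q: "Q \<subseteq> g ` I" "finite Q" "(\<Sum>v\<in>Q. scale (u v) v) = 0"
    then obtain R where R: "R \<subseteq> I" "finite R" "Q = g ` R" by (meson finite_subset_image)
    have "inj_on g R" using inj R(1) by (rule inj_on_subset)
    then have "(\<Sum>i\<in>R. scale (u (g i)) (g i)) = 0" using Q(3) R(3) by (simp add: sum.reindex)
    then have "\<forall>i\<in>R. u (g i) = 0" using R by (intro assms[of R "\<lambda>i. u (g i)"]) auto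
    then show "\<forall>v\<in>Q. u v = 0" using R(3) by blast
  qed
qed

text \<open>The finite set \<open>W\<close> forces a basis of \<open>V\<close> to be finite;
  otherwise \<open>dim V\<close> could be the default value 0.\<close>

lemma card_le_dim:
  assumes "B \<subseteq> V" "independent B" "V \<subseteq> span W" "finite W"
  shows "card B \<le> dim V"
proof -
  obtain C where C: "C \<subseteq> V" "independent C" "V \<subseteq> span C" "card C = dim V"
    using basis_exists by blast
  then have "finite C" using independent_span_bound[OF assms(4), of C] assms(3) by blast
  then show ?thesis using independent_span_bound[of C B] assms C by auto
qed

end

text \<open>Rank-nullity: a linear map carries a coset basis modulo its kernel bijectively onto a
  basis of the image. Infinite bases are covered too, since \<open>quot_dim\<close> and
  \<open>dim\<close> then share the value 0.\<close>

lemma (in Vector_Spaces.linear) quot_dim_kernel: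
  assumes U: "vs1.subspace U"
  shows "quot_dim s1 U (U \<inter> {u. f u = 0}) = vs2.dim (f ` U)"
proof -
  let ?W = "U \<inter> {u. f u = 0}"
  have W: "vs1.subspace ?W"
    using U by (auto simp: vs1.subspace_def add scale)
  define B where "B = (SOME B. coset_basis s1 B U ?W)"
  have B: "coset_basis s1 B U ?W"
    unfolding B_def using vs1.coset_basis_exists[OF U W] by (rule someI_ex)
  then have BU: "B \<subseteq> U" by (simp add: coset_basis_def)
  have ind: "\<forall>b\<in>S. c b = 0" if S: "finite S" "S \<subseteq> B" "(\<Sum>b\<in>S. s2 (c b) (f b)) = 0" for S c
  proof -
    have "(\<Sum>b\<in>S. s1 (c b) b) \<in> U"
      using S BU U by (meson subsetD vs1.subspace_scale vs1.subspace_sum)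
    moreover have "f (\<Sum>b\<in>S. s1 (c b) b) = 0" using S(3) by (simp add: sum scale)
    ultimately show ?thesis using B S(1,2) unfolding coset_basis_def by blast
  qed
  have "f u \<in> vs2.span (f ` B)" if "u \<in> U" for u
  proof -
    have "\<forall>u\<in>U. \<exists>S c. finite S \<and> S \<subseteq> B \<and> u +o ?W = (\<Sum>b\<in>S. s1 (c b) b) +o ?W"
      using B unfolding coset_basis_def by (elim conjE)
    from bspec[OF this that] obtain S c
      where S: "finite S" "S \<subseteq> B" "u +o ?W = (\<Sum>b\<in>S. s1 (c b) b) +o ?W" by (elim exE conjE)
    then have "u - (\<Sum>b\<in>S. s1 (c b) b) \<in> ?W" using vs1.coset_eq_iff[OF W] by blast
    then have "f u = (\<Sum>b\<in>S. s2 (c b) (f b))" by (simp add: diff sum scale)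
    also have "\<dots> \<in> vs2.span (f ` B)"
      using S(2) by (intro vs2.span_sum vs2.span_scale vs2.span_base) auto
    finally show ?thesis .
  qed
  then have "vs2.dim (f ` U) = card (f ` B)"
    using BU vs2.independent_family(2)[OF ind] by (intro vs2.dim_unique[OF _ _ _ refl]) auto
  then show ?thesis
    using vs2.independent_family(1)[OF ind] by (simp add: quot_dim_def B_def card_image)
qed

section \<open>Polynomials as functions on graded substitutions\<close>

context graded_algebra
begin

definition graded_subst :: "(nat \<times> 't \<Rightarrow> 'a) \<Rightarrow> bool"
  where "graded_subst \<phi> \<longleftrightarrow> (\<forall>i t. \<phi> (i, t) \<in> A t)"

definition fscale :: "'f \<Rightarrow> ((nat \<times> 't \<Rightarrow> 'a) \<Rightarrow> 'a) \<Rightarrow> (nat \<times> 't \<Rightarrow> 'a) \<Rightarrow> 'a"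
  where "fscale c f = (\<lambda>\<phi>. scale c (f \<phi>))"

text \<open>Cutting functions off at substitutions that do not respect the degrees has the effect
  that a polynomial without constant term is a graded identity exactly if its function is 0.\<close>

definition on_graded :: "((nat \<times> 't \<Rightarrow> 'a) \<Rightarrow> 'a) \<Rightarrow> (nat \<times> 't \<Rightarrow> 'a) \<Rightarrow> 'a"
  where "on_graded f = (\<lambda>\<phi>. if graded_subst \<phi> then f \<phi> else 0)"

definition eval_fun :: "('t, 'f) ncpoly \<Rightarrow> (nat \<times> 't \<Rightarrow> 'a) \<Rightarrow> 'a"
  where "eval_fun p = on_graded (\<lambda>\<phi>. eval_ncpoly \<phi> p)"

sublocale fs: vector_space fscale
  unfolding fscale_def by (rule vector_space_fun[OF vector_space_axioms])

sublocale ncp: vector_space "ncpoly_scale :: 'f \<Rightarrow> ('t, 'f) ncpoly \<Rightarrow> ('t, 'f) ncpoly"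
  by (rule vector_space_ncpoly)

lemma eval_ncpoly_superset:
  assumes "finite S" "Poly_Mapping.keys p \<subseteq> S"
  shows "eval_ncpoly \<phi> p = (\<Sum>w\<in>S. scale (Poly_Mapping.lookup p w) (eval_monomial \<phi> w))"
  unfolding eval_ncpoly_def using assms
  by (intro sum.mono_neutral_left) (auto simp: in_keys_iff)

lemma eval_ncpoly_add: "eval_ncpoly \<phi> (p + q) = eval_ncpoly \<phi> p + eval_ncpoly \<phi> q"
proof -
  let ?S = "Poly_Mapping.keys p \<union> Poly_Mapping.keys q"
  have "Poly_Mapping.keys (p + q) \<subseteq> ?S" by (rule keys_add)
  then show ?thesis
    using eval_ncpoly_superset[of ?S]
    by (simp add: lookup_add scale_left_distrib sum.distrib)
qed

lemma eval_ncpoly_scale: "eval_ncpoly \<phi> (ncpoly_scale c p) = scale c (eval_ncpoly \<phi> p)"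
proof -
  have "Poly_Mapping.keys (ncpoly_scale c p) \<subseteq> Poly_Mapping.keys p"
    by (auto simp: in_keys_iff lookup_ncpoly_scale)
  then show ?thesis
    using eval_ncpoly_superset[of "Poly_Mapping.keys p"]
    by (simp add: lookup_ncpoly_scale scale_sum_right)
qed

lemma eval_ncpoly_single [simp]:
  "eval_ncpoly \<phi> (Poly_Mapping.single w c) = scale c (eval_monomial \<phi> w)"
  by (simp add: eval_ncpoly_def)

lemma linear_eval_fun: "Vector_Spaces.linear ncpoly_scale fscale eval_fun"
  by unfold_locales
    (auto simp: eval_fun_def on_graded_def fscale_def fun_eq_iff eval_ncpoly_add eval_ncpoly_scale)

lemma multilinear_subset_free_algebra:
  assumes "n \<ge> 1"
  shows "multilinear_ncpolys n \<subseteq> (free_algebra :: ('t, 'f) ncpoly set)"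
proof -
  have "Poly_Mapping.lookup p [] = 0" if "p \<in> multilinear_ncpolys n" for p :: "('t, 'f) ncpoly"
    using that unfolding multilinear_ncpolys_def
  proof (induction rule: ncp.span_induct_alt)
    case (step c x y)
    then show ?case using assms by (auto simp: lookup_add lookup_ncpoly_scale lookup_single when_def)
  qed simp
  then show ?thesis by (auto simp: free_algebra_def in_keys_iff)
qed

text \<open>Rank-nullity for \<open>eval_fun\<close>. For \<open>n = 0\<close> the empty monomial
  would be in the kernel without being in the free algebra, so kernel and identities would
  differ.\<close>

lemma graded_codim_eq_dim:
  assumes "n \<ge> 1"
  shows "graded_codim n = fs.dim (eval_fun ` multilinear_ncpolys n)"
proof -
  interpret ev: Vector_Spaces.linear ncpoly_scale fscale eval_fun by (rule linear_eval_fun)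
  have "multilinear_ncpolys n \<inter> graded_identities = multilinear_ncpolys n \<inter> {p. eval_fun p = 0}"
    using multilinear_subset_free_algebra[OF assms]
    by (auto simp: graded_identities_def eval_fun_def on_graded_def graded_subst_def fun_eq_iff)
  moreover have "ncp.subspace (multilinear_ncpolys n :: ('t, 'f) ncpoly set)"
    unfolding multilinear_ncpolys_def by (rule ncp.subspace_span)
  ultimately show ?thesis
    unfolding graded_codim_def by (simp add: ev.quot_dim_kernel)
qed

lemma eval_monomial_zero: "x \<in> set v \<Longrightarrow> \<phi> x = 0 \<Longrightarrow> eval_monomial \<phi> v = 0"
  by (induction \<phi> v rule: eval_monomial.induct) auto

lemma eval_monomial_Cons: "v \<noteq> [] \<Longrightarrow> eval_monomial \<phi> (x # v) = \<phi> x * eval_monomial \<phi> v"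
  by (cases v) auto

lemma eval_fun_multilinear_subset:
  assumes "\<And>v. length v = n \<Longrightarrow> distinct (map fst v) \<Longrightarrow> fst ` set v = {1..n} \<Longrightarrow>
    on_graded (\<lambda>\<phi>. eval_monomial \<phi> v) \<in> fs.span Y"
  shows "eval_fun ` multilinear_ncpolys n \<subseteq> fs.span Y"
proof -
  interpret ev: Vector_Spaces.linear ncpoly_scale fscale eval_fun by (rule linear_eval_fun)
  have "eval_fun p \<in> fs.span Y" if "p \<in> multilinear_ncpolys n" for p
    using that unfolding multilinear_ncpolys_def
  proof (induction rule: ncp.span_induct_alt)
    case (step c x y)
    then obtain \<sigma> :: "nat \<Rightarrow> nat" and t :: "nat \<Rightarrow> 't" where \<sigma>: "\<sigma> permutes {1..n}"
      and x: "x = Poly_Mapping.single (map (\<lambda>j. (\<sigma> j, t j)) [1..<n+1]) 1" by blast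
    let ?v = "map (\<lambda>j. (\<sigma> j, t j)) [1..<n+1]"
    have "set [1..<n+1] = {1..n}" by auto
    then have "fst ` set ?v = {1..n}"
      using permutes_image[OF \<sigma>] by (simp add: image_image del: set_upt upt_Suc)
    moreover have "distinct (map fst ?v)"
      using inj_on_subset[OF permutes_inj[OF \<sigma>]] by (simp add: o_def distinct_map del: upt_Suc)
    ultimately have "on_graded (\<lambda>\<phi>. eval_monomial \<phi> ?v) \<in> fs.span Y"
      by (intro assms) simp_all
    then have "eval_fun x \<in> fs.span Y" by (simp add: x eval_fun_def del: upt_Suc)
    then show ?case using step(2) unfolding ev.add ev.scale by (intro fs.span_add fs.span_scale)
  next
    case base
    show ?case unfolding ev.zero by (rule fs.span_zero)
  qed
  then show ?thesis by blast
qed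

text \<open>In \<open>multilinear_ncpolys\<close> a degree belongs to a position of the monomial,
  here it belongs to the index of a variable; \<open>t = \<tau> \<circ> \<sigma>\<close> translates
  between the two.\<close>

lemma single_in_multilinear:
  fixes \<tau> :: "nat \<Rightarrow> 't" and c :: 'f
  assumes "distinct ws" "set ws = {1..n}"
  shows "Poly_Mapping.single (map (\<lambda>i. (i, \<tau> i)) ws) c \<in> multilinear_ncpolys n"
proof -
  have len: "length ws = n" using distinct_card[OF assms(1)] assms(2) by simp
  define \<sigma> where "\<sigma> j = (if j \<in> {1..n} then ws ! (j - 1) else j)" for j
  have "bij_betw (\<lambda>j. ws ! (j - 1)) {1..n} {1..n}"
  proof -
    have "bij_betw (\<lambda>j. j - 1) {1..n} {..<n}"
      by (rule bij_betw_byWitness[where f' = Suc]) auto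
    moreover have "bij_betw (\<lambda>i. ws ! i) {..<n} {1..n}"
      using bij_betw_nth[OF assms(1), of "{..<n}" "{1..n}"] assms(2) len by simp
    ultimately have "bij_betw ((\<lambda>i. ws ! i) \<circ> (\<lambda>j. j - 1)) {1..n} {1..n}" by (rule bij_betw_trans)
    then show ?thesis by (simp add: o_def)
  qed
  then have "bij_betw \<sigma> {1..n} {1..n}"
    by (subst bij_betw_cong[where g = "\<lambda>j. ws ! (j - 1)"]) (simp_all add: \<sigma>_def)
  then have "\<sigma> permutes {1..n}"
    by (rule bij_imp_permutes) (auto simp: \<sigma>_def)
  moreover have "map (\<lambda>i. (i, \<tau> i)) ws = map (\<lambda>j. (\<sigma> j, \<tau> (\<sigma> j))) [1..<n+1]"
    by (rule nth_equalityI) (auto simp: len \<sigma>_def simp del: upt_Suc)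
  ultimately have "Poly_Mapping.single (map (\<lambda>i. (i, \<tau> i)) ws) (1::'f) \<in>
      {Poly_Mapping.single (map (\<lambda>j. (\<sigma> j, t j)) [1..<n+1]) 1 | \<sigma> t. \<sigma> permutes {1..n}}"
    by (auto simp del: upt_Suc)
  then have "ncpoly_scale c (Poly_Mapping.single (map (\<lambda>i. (i, \<tau> i)) ws) 1) \<in> multilinear_ncpolys n"
    unfolding multilinear_ncpolys_def by (intro ncp.span_scale ncp.span_base)
  moreover have "ncpoly_scale c (Poly_Mapping.single w 1) = Poly_Mapping.single w c" for w :: "(nat \<times> 't) list"
    by (rule poly_mapping_eqI) (simp add: lookup_ncpoly_scale lookup_single when_def)
  ultimately show ?thesis by simp
qed

end

section \<open>Words in matrices of rank one\<close>

definition dot :: "'f::field^2 \<Rightarrow> 'f^2 \<Rightarrow> 'f"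
  where "dot w v = w $ 1 * v $ 1 + w $ 2 * v $ 2"

definition det2 :: "'f::field^2 \<Rightarrow> 'f^2 \<Rightarrow> 'f"
  where "det2 w v = w $ 1 * v $ 2 - w $ 2 * v $ 1"

definition outer :: "'f::field^2 \<Rightarrow> 'f^2 \<Rightarrow> 'f^2^2"
  where "outer u w = (\<chi> i j. u $ i * w $ j)"

lemma outer_nth [simp]: "outer u w $ i $ j = u $ i * w $ j"
  by (simp add: outer_def)

lemma outer_mult: "outer u w ** outer u' w' = outer (dot w u' *s u) w'"
  by (simp add: vec_eq_iff matrix_matrix_mult_def sum_2 dot_def algebra_simps)

lemma dot_simps [simp]:
  "dot w (u + v) = dot w u + dot w v" "dot w (u - v) = dot w u - dot w v"
  "dot w (c *s u) = c * dot w u" "dot w 0 = 0"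
  by (simp_all add: dot_def algebra_simps)

text \<open>The Binet-Cauchy identity. Swapping two vectors and subtracting thereby produces
  alternating factors in the vectors and in the covectors at once.\<close>

lemma dot_det2: "dot w u * dot w' u' - dot w u' * dot w' u = det2 w w' * det2 u u'"
  by (simp add: dot_def det2_def algebra_simps)

text \<open>The product of the matrices \<open>u i \<otimes> w i\<close> along a word, stripped of its last covector.\<close>

fun word_val :: "(nat \<Rightarrow> 'f::field^2) \<Rightarrow> (nat \<Rightarrow> 'f^2) \<Rightarrow> nat list \<Rightarrow> 'f^2"
  where
    "word_val u w [] = 0"
  | "word_val u w [i] = u i"
  | "word_val u w (i # j # ws) = dot (w i) (word_val u w (j # ws)) *s u i"

lemma word_val_Cons: "ws \<noteq> [] \<Longrightarrow> word_val u w (i # ws) = dot (w i) (word_val u w ws) *s u i"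
  by (cases ws) auto

definition insert_before :: "nat \<Rightarrow> nat \<Rightarrow> nat list \<Rightarrow> nat list"
  where "insert_before x j ws = concat (map (\<lambda>i. if i = j then [x, j] else [i]) ws)"

lemma insert_before_simps [simp]:
  "insert_before x j [] = []"
  "insert_before x j (i # ws) = (if i = j then x # j # insert_before x j ws else i # insert_before x j ws)"
  by (simp_all add: insert_before_def)

lemma insert_before_Nil_iff [simp]: "insert_before x j ws = [] \<longleftrightarrow> ws = []"
  by (cases ws) auto

lemma set_insert_before: "j \<in> set ws \<Longrightarrow> set (insert_before x j ws) = insert x (set ws)"
  and set_insert_before_notin: "j \<notin> set ws \<Longrightarrow> set (insert_before x j ws) = set ws"
  by (auto simp: insert_before_def)

lemma distinct_insert_before:
  "distinct ws \<Longrightarrow> x \<notin> set ws \<Longrightarrow> distinct (insert_before x j ws)"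
proof (induction ws)
  case (Cons a ws)
  then show ?case
    by (cases "j \<in> set ws") (auto simp: set_insert_before set_insert_before_notin)
qed simp

lemma last_insert_before: "ws \<noteq> [] \<Longrightarrow> last (insert_before x j ws) = last ws"
  by (induction ws) auto

text \<open>Inserting \<open>x\<close> before \<open>j\<close> multiplies the matrix of
  \<open>j\<close> from the left by that of \<open>x\<close>. The product again has rank one with
  the covector of \<open>j\<close>, so only the vector at \<open>j\<close> changes.\<close>

lemma word_val_insert_before:
  assumes "x \<notin> set ws" "x \<noteq> j"
  shows "word_val u w (insert_before x j ws) = word_val (u(j := dot (w x) (u j) *s u x)) w ws"
proof -
  define v where "v = u(j := dot (w x) (u j) *s u x)"
  have v: "v j = dot (w x) (u j) *s u x" "\<And>i. i \<noteq> j \<Longrightarrow> v i = u i" by (simp_all add: v_def)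
  have "word_val u w (insert_before x j ws) = word_val v w ws"
    using assms(1)
  proof (induction ws)
    case (Cons a ws)
    show ?case
    proof (cases "ws = []")
      case True
      then show ?thesis using assms(2) v by auto
    next
      case False
      have IH: "word_val u w (insert_before x j ws) = word_val v w ws"
        using Cons.prems by (intro Cons.IH) simp
      show ?thesis
        using False v by (cases "a = j") (simp_all add: word_val_Cons IH vector_smult_assoc mult.commute)
    qed
  qed simp
  then show ?thesis by (simp add: v_def)
qed

section \<open>Combinations of words and the realization of traces\<close>

definition comb_val :: "(nat \<Rightarrow> 'f::field^2) \<Rightarrow> (nat \<Rightarrow> 'f^2) \<Rightarrow> ('f \<times> nat list) list \<Rightarrow> 'f^2"
  where "comb_val u w cs = (\<Sum>(c, ws)\<leftarrow>cs. c *s word_val u w ws)"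

lemma comb_val_simps [simp]:
  "comb_val u w [] = 0"
  "comb_val u w ((c, ws) # cs) = c *s word_val u w ws + comb_val u w cs"
  "comb_val u w (cs @ ds) = comb_val u w cs + comb_val u w ds"
  by (simp_all add: comb_val_def)

lemma comb_val_scale: "comb_val u w (map (apfst ((*) a)) cs) = a *s comb_val u w cs"
  by (induction cs) (auto simp: vector_add_ldistrib vector_smult_assoc)

lemma comb_val_insert_before:
  assumes "\<forall>(c, ws)\<in>set cs. x \<notin> set ws" "x \<noteq> j"
  shows "comb_val u w (map (apsnd (insert_before x j)) cs)
    = comb_val (u(j := dot (w x) (u j) *s u x)) w cs"
  using assms(1) by (induction cs) (auto simp: word_val_insert_before[OF _ assms(2)])

text \<open>A list of coefficients and words stands for a multilinear polynomial whose degrees are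
  attached only later, by \<open>comb_poly\<close>. The last letter is restricted to
  \<open>Y\<close> because it supplies the covector stripped off by \<open>word_val\<close>, which
  has to be common to all words.\<close>

definition admissible :: "nat set \<Rightarrow> nat set \<Rightarrow> ('f \<times> nat list) list \<Rightarrow> bool"
  where "admissible V Y cs \<longleftrightarrow> (\<forall>(c, ws)\<in>set cs. distinct ws \<and> set ws = V \<and> last ws \<in> Y)"

lemma admissible_insert_before:
  assumes "admissible V Y cs" "x \<notin> V" "j \<in> V"
  shows "admissible (insert x V) Y (map (apsnd (insert_before x j)) cs)"
proof -
  have "distinct (insert_before x j ws) \<and> set (insert_before x j ws) = insert x V \<and>
      last (insert_before x j ws) \<in> Y" if "(c, ws) \<in> set cs" for c ws
  proof -
    have "distinct ws" "set ws = V" "last ws \<in> Y" using that assms(1) by (auto simp: admissible_def)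
    moreover from this have "ws \<noteq> []" using assms(3) by auto
    ultimately show ?thesis
      using assms(2,3) distinct_insert_before set_insert_before last_insert_before by metis
  qed
  then show ?thesis by (auto simp: admissible_def)
qed

text \<open>The commutator of \<open>y1\<close> and \<open>y2\<close>, to be used when they share the covector \<open>w y1 = w y2\<close>.\<close>

definition comm_val :: "(nat \<Rightarrow> 'f::field^2) \<Rightarrow> (nat \<Rightarrow> 'f^2) \<Rightarrow> nat \<Rightarrow> nat \<Rightarrow> 'f^2"
  where "comm_val u w y1 y2 = dot (w y1) (u y2) *s u y1 - dot (w y1) (u y1) *s u y2"

text \<open>The trace of \<open>x\<close> times a commutator is again a combination of words, because the commutator
  is an alternating function of two vectors of a plane.\<close>

lemma comm_val_trace:
  assumes "x \<noteq> y1" "x \<noteq> y2" "y1 \<noteq> y2" "w y1 = w y2"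
  shows "comm_val (u(y1 := dot (w x) (u y1) *s u x)) w y1 y2
    + comm_val (u(y2 := dot (w x) (u y2) *s u x)) w y1 y2 = dot (w x) (u x) *s comm_val u w y1 y2"
  using assms by (simp add: comm_val_def vec_eq_iff forall_2 dot_def) (simp add: algebra_simps)

text \<open>Induction on \<open>n\<close>, cutting the largest index \<open>x\<close> out of its
  cycle in \<open>g\<close>. If \<open>x\<close> is a fixed point, its trace is produced by
  inserting \<open>x\<close> before \<open>y1\<close> and before \<open>y2\<close> and adding.
  Otherwise inserting \<open>x\<close> before \<open>j = g x\<close> turns the factor for
  \<open>i \<mapsto> j\<close> into the factors for
  \<open>i \<mapsto> x \<mapsto> j\<close>.\<close>

lemma trace_comb:
  fixes g :: "nat \<Rightarrow> nat"
  assumes y: "y1 \<noteq> y2" "y1 \<notin> {1..n}" "y2 \<notin> {1..n}" and g: "g permutes {1..n}"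
  shows "\<exists>cs. admissible ({1..n} \<union> {y1, y2}) {y1, y2} cs \<and>
    (\<forall>u w :: nat \<Rightarrow> 'f::field^2. w y1 = w y2 \<longrightarrow>
      comb_val u w cs = (\<Prod>j\<in>{1..n}. dot (w j) (u (g j))) *s comm_val u w y1 y2)"
  using y g
proof (induction n arbitrary: g)
  case 0
  have "comb_val u w [(1, [y1, y2]), (-1, [y2, y1])] = comm_val u w y1 y2"
    if "w y1 = w y2" for u w :: "nat \<Rightarrow> 'f^2"
    using that by (simp add: comm_val_def)
  then show ?case using 0
    by (intro exI[of _ "[(1, [y1, y2]), (-1, [y2, y1])]"]) (auto simp: admissible_def)
next
  case (Suc n)
  let ?x = "Suc n"
  define h where "h = Transposition.transpose ?x (g ?x) \<circ> g"
  have eq: "{1..Suc n} = insert ?x {1..n}" by auto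
  have h: "h permutes {1..n}"
    unfolding h_def by (rule permutes_insert_lemma[OF Suc.prems(4)[unfolded eq]])
  have hx: "h ?x = ?x" by (simp add: h_def)
  obtain cs :: "('f \<times> nat list) list" where cs: "admissible ({1..n} \<union> {y1, y2}) {y1, y2} cs"
    "\<And>u w. w y1 = w y2 \<Longrightarrow>
      comb_val u w cs = (\<Prod>j\<in>{1..n}. dot (w j) (u (h j))) *s comm_val u w y1 y2"
    using Suc.IH[OF _ _ _ h] Suc.prems by auto
  have x: "?x \<notin> {1..n} \<union> {y1, y2}" using Suc.prems by auto
  have xc: "\<forall>(c, ws)\<in>set cs. ?x \<notin> set ws" using cs(1) x by (auto simp: admissible_def)
  have V: "insert ?x ({1..n} \<union> {y1, y2}) = {1..Suc n} \<union> {y1, y2}" by (auto simp: eq)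
  have hy: "h j \<noteq> y1" "h j \<noteq> y2" if "j \<in> {1..n}" for j
    using permutes_in_image[OF h, of j] that y Suc.prems by auto
  show ?case
  proof (cases "g ?x = ?x")
    case True
    then have hg: "h = g" by (simp add: h_def)
    let ?cs = "\<lambda>y. map (apsnd (insert_before ?x y)) cs"
    have "comb_val u w (?cs y1 @ ?cs y2)
        = (\<Prod>j\<in>{1..Suc n}. dot (w j) (u (g j))) *s comm_val u w y1 y2"
      if w: "w y1 = w y2" for u w
    proof -
      have "comb_val u w (?cs y) = (\<Prod>j\<in>{1..n}. dot (w j) (u (g j))) *s
          comm_val (u(y := dot (w ?x) (u y) *s u ?x)) w y1 y2" if "y \<in> {y1, y2}" for y
      proof -
        have "(\<Prod>j\<in>{1..n}. dot (w j) ((u(y := dot (w ?x) (u y) *s u ?x)) (h j)))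
            = (\<Prod>j\<in>{1..n}. dot (w j) (u (h j)))"
          using that hy by (intro prod.cong) auto
        then show ?thesis
          using comb_val_insert_before[OF xc, of y u w] x that cs(2)[OF w] hg by auto
      qed
      then have "comb_val u w (?cs y1 @ ?cs y2) = (\<Prod>j\<in>{1..n}. dot (w j) (u (g j))) *s
          (dot (w ?x) (u ?x) *s comm_val u w y1 y2)"
        using comm_val_trace[where x = ?x and u = u, OF _ _ Suc.prems(1) w] x
        by (simp flip: vector_add_ldistrib)
      then show ?thesis using True by (simp add: eq vector_smult_assoc mult.commute)
    qed
    moreover have "admissible ({1..Suc n} \<union> {y1, y2}) {y1, y2} (?cs y1 @ ?cs y2)"
      using admissible_insert_before[OF cs(1) x, of y1] admissible_insert_before[OF cs(1) x, of y2]
      unfolding V admissible_def by auto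
    ultimately show ?thesis by blast
  next
    case False
    define j where "j = g ?x"
    define i where "i = inv g ?x"
    have gi: "g i = ?x" using Suc.prems(4) by (simp add: i_def permutes_inverses)
    have ix: "i \<noteq> ?x" using gi False by auto
    have i: "i \<in> {1..n}"
      using permutes_in_image[OF Suc.prems(4), of i] gi ix by auto
    have jn: "j \<in> {1..n}"
      using permutes_in_image[OF Suc.prems(4), of ?x] False by (auto simp: j_def)
    have hi: "h i = j" by (simp add: h_def gi j_def)
    have hk: "h k = g k \<and> h k \<noteq> j" if "k \<in> {1..n} - {i}" for k
    proof -
      have "g k \<noteq> g i" "g k \<noteq> g ?x"
        using that injD[OF permutes_inj[OF Suc.prems(4)]] by fastforce+
      then have "g k \<noteq> ?x" "g k \<noteq> j" by (simp_all add: gi j_def)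
      then show ?thesis by (simp add: h_def j_def Transposition.transpose_def)
    qed
    let ?cs = "map (apsnd (insert_before ?x j)) cs"
    have "comb_val u w ?cs = (\<Prod>j\<in>{1..Suc n}. dot (w j) (u (g j))) *s comm_val u w y1 y2"
      if w: "w y1 = w y2" for u w
    proof -
      let ?u = "u(j := dot (w ?x) (u j) *s u ?x)"
      have "comm_val ?u w y1 y2 = comm_val u w y1 y2"
        using jn Suc.prems(2,3) by (auto simp: comm_val_def)
      moreover have "(\<Prod>k\<in>{1..n}. dot (w k) (?u (h k))) = (\<Prod>k\<in>{1..Suc n}. dot (w k) (u (g k)))"
      proof -
        have "(\<Prod>k\<in>{1..n}. dot (w k) (?u (h k)))
            = dot (w i) (?u j) * (\<Prod>k\<in>{1..n} - {i}. dot (w k) (?u (h k)))"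
          using i by (subst prod.remove[of _ i]) (auto simp: hi)
        also have "(\<Prod>k\<in>{1..n} - {i}. dot (w k) (?u (h k))) = (\<Prod>k\<in>{1..n} - {i}. dot (w k) (u (g k)))"
          using hk by (intro prod.cong) auto
        also have "dot (w i) (?u j) * (\<Prod>k\<in>{1..n} - {i}. dot (w k) (u (g k)))
            = dot (w ?x) (u j) * (dot (w i) (u (g i)) * (\<Prod>k\<in>{1..n} - {i}. dot (w k) (u (g k))))"
          by (simp add: gi)
        also have "dot (w i) (u (g i)) * (\<Prod>k\<in>{1..n} - {i}. dot (w k) (u (g k)))
            = (\<Prod>k\<in>{1..n}. dot (w k) (u (g k)))"
          using i by (subst (2) prod.remove[of _ i]) auto
        finally show ?thesis by (simp add: eq j_def)
      qed
      ultimately show ?thesis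
        using comb_val_insert_before[OF xc, of j u w] x jn cs(2)[OF w, of ?u] by auto
    qed
    moreover have "admissible ({1..Suc n} \<union> {y1, y2}) {y1, y2} ?cs"
      using admissible_insert_before[OF cs(1) x, of j] jn V by auto
    ultimately show ?thesis by blast
  qed
qed

section \<open>Antisymmetrization along two-row tableaux\<close>

text \<open>\<open>q\<close> and \<open>f\<close> are fillings of a two-row diagram, for the
  covectors and for the vectors: the positions \<open>2*i+1\<close> and \<open>2*i+2\<close> with
  \<open>i < l\<close> form a column of height two and contribute determinants, the others are
  columns of height one.\<close>

definition pairing :: "nat \<Rightarrow> nat \<Rightarrow> (nat \<Rightarrow> nat) \<Rightarrow> (nat \<Rightarrow> nat) \<Rightarrow>
    (nat \<Rightarrow> 'f::field^2) \<Rightarrow> (nat \<Rightarrow> 'f^2) \<Rightarrow> 'f"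
  where "pairing n l q f u w =
    (\<Prod>i<l. det2 (w (q (2*i+1))) (w (q (2*i+2))) * det2 (u (f (2*i+1))) (u (f (2*i+2)))) *
    (\<Prod>j\<in>{2*l+1..n}. dot (w (q j)) (u (f j)))"

text \<open>Binet-Cauchy in the column \<open>2*l+1\<close>, \<open>2*l+2\<close>: antisymmetrizing
  the vectors alone turns the two scalar products into the two determinants.\<close>

lemma pairing_Suc:
  assumes "2 * Suc l \<le> n" "q permutes {1..n}" "f permutes {1..n}"
  shows "pairing n (Suc l) q f u w
    = pairing n l q f u w - pairing n l q (f \<circ> Transposition.transpose (2*l+1) (2*l+2)) u w"
proof -
  have eq: "{2*l+1..n} = insert (2*l+1) (insert (2*l+2) {2*Suc l+1..n})"
    using assms(1) by auto
  let ?f = "f \<circ> Transposition.transpose (2*l+1) (2*l+2)"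
  have f: "?f (2*l+1) = f (2*l+2)" "?f (2*l+2) = f (2*l+1)"
    "\<And>j. j \<noteq> 2*l+1 \<Longrightarrow> j \<noteq> 2*l+2 \<Longrightarrow> ?f j = f j"
    by (simp_all add: Transposition.transpose_def)
  have 1: "(\<Prod>i<l. det2 (w (q (2*i+1))) (w (q (2*i+2))) * det2 (u (?f (2*i+1))) (u (?f (2*i+2))))
      = (\<Prod>i<l. det2 (w (q (2*i+1))) (w (q (2*i+2))) * det2 (u (f (2*i+1))) (u (f (2*i+2))))"
  proof (intro prod.cong refl)
    fix i assume "i \<in> {..<l}"
    then have "?f (2*i+1) = f (2*i+1)" "?f (2*i+2) = f (2*i+2)"
      by (intro f(3); simp; presburger)+
    then show "det2 (w (q (2*i+1))) (w (q (2*i+2))) * det2 (u (?f (2*i+1))) (u (?f (2*i+2)))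
        = det2 (w (q (2*i+1))) (w (q (2*i+2))) * det2 (u (f (2*i+1))) (u (f (2*i+2)))" by simp
  qed
  have 2: "(\<Prod>j\<in>{2*Suc l+1..n}. dot (w (q j)) (u (?f j))) = (\<Prod>j\<in>{2*Suc l+1..n}. dot (w (q j)) (u (f j)))"
    by (intro prod.cong refl) (subst f(3), auto)
  have split: "(\<Prod>j\<in>{2*l+1..n}. dot (w (q j)) (u (h j))) = dot (w (q (2*l+1))) (u (h (2*l+1))) *
      (dot (w (q (2*l+2))) (u (h (2*l+2))) * (\<Prod>j\<in>{2*Suc l+1..n}. dot (w (q j)) (u (h j))))" for h
    unfolding eq by (subst prod.insert, simp, simp, subst prod.insert) auto
  have det: "det2 (w (q (2*l+1))) (w (q (2*l+2))) * det2 (u (f (2*l+1))) (u (f (2*l+2)))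
      = dot (w (q (2*l+1))) (u (f (2*l+1))) * dot (w (q (2*l+2))) (u (f (2*l+2)))
        - dot (w (q (2*l+1))) (u (f (2*l+2))) * dot (w (q (2*l+2))) (u (f (2*l+1)))"
    by (rule dot_det2[symmetric])
  show ?thesis
    unfolding pairing_def 1 split 2 f(1,2) prod.lessThan_Suc det
    by (simp only: left_diff_distrib right_diff_distrib mult.assoc)
qed

text \<open>Without columns of height two this is \<open>trace_comb\<close> for
  \<open>f \<circ> inv q\<close>, the factors being reindexed by their covectors. Each further
  column is a difference of two such combinations.\<close>

lemma pairing_comb:
  fixes q f :: "nat \<Rightarrow> nat"
  assumes y: "y1 \<noteq> y2" "y1 \<notin> {1..n}" "y2 \<notin> {1..n}"
    and "2 * l \<le> n" "q permutes {1..n}" "f permutes {1..n}"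
  shows "\<exists>cs. admissible ({1..n} \<union> {y1, y2}) {y1, y2} cs \<and>
    (\<forall>u w :: nat \<Rightarrow> 'f::field^2. w y1 = w y2 \<longrightarrow>
      comb_val u w cs = pairing n l q f u w *s comm_val u w y1 y2)"
  using assms(4-6)
proof (induction l arbitrary: f)
  case 0
  have fq: "f \<circ> inv q permutes {1..n}"
    using 0 by (simp add: permutes_compose permutes_inv)
  have "pairing n 0 q f u w = (\<Prod>j\<in>{1..n}. dot (w j) (u ((f \<circ> inv q) j)))" for u w :: "nat \<Rightarrow> 'f^2"
    using prod.permute[OF 0(2), of "\<lambda>j. dot (w j) (u ((f \<circ> inv q) j))"]
    by (simp add: pairing_def o_def permutes_inverses[OF 0(2)])
  then show ?case using trace_comb[OF y fq] by simp
next
  case (Suc l)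
  let ?g = "f \<circ> Transposition.transpose (2*l+1) (2*l+2)"
  have "Transposition.transpose (2*l+1) (2*l+2) permutes {1..n}"
    using Suc.prems(1) by (intro permutes_swap_id) auto
  then have g: "?g permutes {1..n}"
    using Suc.prems(3) by (rule permutes_compose)
  have le: "2 * l \<le> n" using Suc.prems(1) by simp
  obtain cs :: "('f \<times> nat list) list" where cs: "admissible ({1..n} \<union> {y1, y2}) {y1, y2} cs"
    "\<And>u w. w y1 = w y2 \<Longrightarrow> comb_val u w cs = pairing n l q f u w *s comm_val u w y1 y2"
    using Suc.IH[OF le Suc.prems(2,3)] by blast
  obtain ds :: "('f \<times> nat list) list" where ds: "admissible ({1..n} \<union> {y1, y2}) {y1, y2} ds"
    "\<And>u w. w y1 = w y2 \<Longrightarrow> comb_val u w ds = pairing n l q ?g u w *s comm_val u w y1 y2"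
    using Suc.IH[OF le Suc.prems(2) g] by blast
  have "admissible ({1..n} \<union> {y1, y2}) {y1, y2} (cs @ map (apfst ((*) (-1))) ds)"
    using cs(1) ds(1) by (fastforce simp: admissible_def)
  moreover have "comb_val u w (cs @ map (apfst ((*) (-1))) ds)
      = pairing n (Suc l) q f u w *s comm_val u w y1 y2" if "w y1 = w y2" for u w
    unfolding comb_val_simps comb_val_scale cs(2)[OF that] ds(2)[OF that]
      pairing_Suc[OF Suc.prems]
    by (simp add: vec_eq_iff algebra_simps)
  ultimately show ?case by blast
qed

text \<open>The second rows of the standard two-row tableaux with \<open>n\<close> boxes, \<open>l\<close> of them in the
  second row.\<close>

definition ballot :: "nat \<Rightarrow> nat \<Rightarrow> nat set set"
  where "ballot n l = {(\<lambda>i. q (2*i+2)) ` {..<l} | q.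
    2 * l \<le> n \<and> q permutes {1..n} \<and> (\<forall>i<l. q (2*i+1) < q (2*i+2))}"

lemma ballotE:
  assumes "C \<in> ballot n l"
  obtains q where "C = (\<lambda>i. q (2*i+2)) ` {..<l}" "2 * l \<le> n" "q permutes {1..n}"
    "\<And>i. i < l \<Longrightarrow> q (2*i+1) < q (2*i+2)"
  using assms by (auto simp: ballot_def)

lemma ballot_subset: "C \<in> ballot n l \<Longrightarrow> C \<subseteq> {1..n}"
proof (elim ballotE)
  fix q assume C: "C = (\<lambda>i. q (2*i+2)) ` {..<l}" "2 * l \<le> n" "q permutes {1..n}"
  have "q (2*i+2) \<in> {1..n}" if "i < l" for i
    using that C(2) by (subst permutes_in_image[OF C(3)]) auto
  then show "C \<subseteq> {1..n}" using C(1) by blast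
qed

lemma card_in_ballot: "C \<in> ballot n l \<Longrightarrow> card C = l"
proof (elim ballotE)
  fix q assume C: "C = (\<lambda>i. q (2*i+2)) ` {..<l}" "2 * l \<le> n" "q permutes {1..n}"
  have "q x = q y \<longleftrightarrow> x = y" for x y using permutes_inj[OF C(3)] by (auto simp: inj_def)
  then have "inj_on (\<lambda>i. q (2*i+2)) {..<l}" by (simp add: inj_on_def)
  then show "card C = l" using C(1) by (simp add: card_image)
qed

lemma finite_ballot: "finite (ballot n l)"
  by (rule finite_subset[of _ "Pow {1..n}"]) (use ballot_subset in blast, simp)

lemma ballot_mono: "ballot n l \<subseteq> ballot (Suc n) l"
  by (force simp: ballot_def intro: permutes_subset)

text \<open>Since \<open>2 * Suc l \<le> Suc n\<close>, position \<open>2*l+1\<close> carries an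
  element of \<open>{1..n}\<close> outside the first \<open>l\<close> pairs; it becomes the smaller
  partner of \<open>Suc n\<close>, which a transposition brings to position
  \<open>2*l+2\<close>.\<close>

lemma ballot_insert:
  assumes C: "C \<in> ballot n l" and l: "2 * Suc l \<le> Suc n"
  shows "insert (Suc n) C \<in> ballot (Suc n) (Suc l)"
  using C
proof (elim ballotE)
  fix q assume q: "C = (\<lambda>i. q (2*i+2)) ` {..<l}" "2 * l \<le> n" "q permutes {1..n}"
    "\<And>i. i < l \<Longrightarrow> q (2*i+1) < q (2*i+2)"
  define h where "h = q \<circ> Transposition.transpose (2*l+2) (Suc n)"
  have qn: "q permutes {1..Suc n}" using q(3) by (rule permutes_subset) auto
  have h: "h permutes {1..Suc n}"
    unfolding h_def using l by (intro permutes_compose[OF _ qn] permutes_swap_id) auto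
  have qS: "q (Suc n) = Suc n" using permutes_not_in[OF q(3)] by simp
  have hl: "h (2*l+2) = Suc n" by (simp add: h_def qS)
  have hj: "h j = q j" if "j < 2*l+2" for j
    using that l by (auto simp: h_def Transposition.transpose_def)
  have "q (2*l+1) \<in> {1..n}"
    using l by (subst permutes_in_image[OF q(3)]) auto
  then have "h (2*i+1) < h (2*i+2)" if "i < Suc l" for i
    using that q(4)[of i] hj[of "2*i+1"] hj[of "2*i+2"] hl by (cases "i = l") auto
  moreover have "(\<lambda>i. h (2*i+2)) ` {..<Suc l} = insert (Suc n) C"
  proof -
    have "(\<lambda>i. h (2*i+2)) ` {..<l} = C" unfolding q(1) by (intro image_cong refl hj) auto
    then show ?thesis using hl by (simp add: lessThan_Suc)
  qed
  ultimately show ?thesis using h l unfolding ballot_def by (intro CollectI exI[of _ h]) auto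
qed

text \<open>The difference of two consecutive binomials as a lower bound, written as a sum to avoid
  truncated subtraction. Sets without and with the largest element match the two terms of Pascal's
  rule. Admitting \<open>2 * l = Suc n\<close> is what closes the induction.\<close>

lemma card_ballot:
  assumes "2 * l \<le> Suc n"
  shows "n choose l \<le> card (ballot n l) + (if l = 0 then 0 else n choose (l - 1))"
  using assms
proof (induction n arbitrary: l)
  case 0
  have "{} \<in> ballot 0 0" by (auto simp: ballot_def intro!: exI[of _ id] permutes_id)
  then have "card (ballot 0 0) \<ge> 1"
    using finite_ballot[of 0 0] by (metis One_nat_def Suc_leI card_gt_0_iff empty_iff)
  moreover have "l = 0" using 0 by simp
  ultimately show ?case by simp
next
  case (Suc n)
  show ?case
  proof (cases l)
    case 0
    have "{} \<in> ballot (Suc n) 0" by (auto simp: ballot_def intro!: exI[of _ id] permutes_id)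
    then have "card (ballot (Suc n) 0) \<ge> 1"
      using finite_ballot[of "Suc n" 0] by (metis One_nat_def Suc_leI card_gt_0_iff empty_iff)
    then show ?thesis using 0 by simp
  next
    case (Suc k)
    show ?thesis
    proof (cases "2 * l = n + 2")
      \<comment> \<open>At this boundary \<open>l\<close> and \<open>k\<close> add up to
        \<open>Suc n\<close>, so the two binomials agree and no ballot set is needed.\<close>
      case True
      then have "Suc n - l = k" using Suc by simp
      then have "Suc n choose l = Suc n choose k"
        using binomial_symmetric[of l "Suc n"] True Suc by simp
      then show ?thesis using Suc by simp
    next
      case False
      then have le: "2 * l \<le> Suc n" using Suc.prems by simp
      let ?D = "insert (Suc n) ` ballot n k"
      have sub: "ballot n l \<union> ?D \<subseteq> ballot (Suc n) l"
        using ballot_mono ballot_insert[of _ n k] le Suc by auto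
      have nin: "Suc n \<notin> C" if "C \<in> ballot n j" for C j
        using ballot_subset[OF that] by auto
      have "inj_on (insert (Suc n)) (ballot n k)"
        using nin by (intro inj_onI) (metis insert_ident)
      moreover have "ballot n l \<inter> ?D = {}" using nin by auto
      ultimately have "card (ballot n l \<union> ?D) = card (ballot n l) + card (ballot n k)"
        by (subst card_Un_disjoint) (auto simp: finite_ballot card_image)
      then have "card (ballot n l) + card (ballot n k) \<le> card (ballot (Suc n) l)"
        using card_mono[OF finite_ballot sub] by simp
      moreover have "n choose l \<le> card (ballot n l) + (n choose k)"
        using Suc.IH[OF le] Suc by simp
      moreover have "n choose k \<le> card (ballot n k) + (if k = 0 then 0 else n choose (k - 1))"
        using Suc le by (intro Suc.IH) simp
      moreover have "Suc n choose l = (n choose l) + (n choose k)"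
        using Suc by simp
      moreover have "Suc n choose k = (n choose k) + (if k = 0 then 0 else n choose (k - 1))"
        by (cases k) simp_all
      ultimately show ?thesis using Suc by simp
    qed
  qed
qed

text \<open>For \<open>k = l - 1\<close> one has
  \<open>(n - k) * (n choose k) = l * (n choose l)\<close>. So \<open>card_ballot\<close> leaves at
  least the fraction \<open>(n - k - l) / (n - k)\<close> of \<open>n choose l\<close>, and
  \<open>n - k - l = n - 2 * l + 1\<close> is positive.\<close>

lemma binomial_le_card_ballot:
  assumes "2 * l \<le> n"
  shows "n choose l \<le> Suc n * card (ballot n l)"
proof (cases l)
  case 0
  then show ?thesis using card_ballot[of 0 n] by simp
next
  case (Suc k)
  let ?b = "card (ballot n l)"
  have "(n - k) * (n choose k) = l * (n choose l)"
    using binomial_absorb_comp[of n k] binomial_absorption[of k n] Suc by simp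
  moreover have "(n - k) * (n choose l) \<le> (n - k) * (?b + (n choose k))"
    using card_ballot[of l n] assms Suc by (intro mult_le_mono2) simp
  ultimately have "(n - k) * (n choose l) \<le> (n - k) * ?b + l * (n choose l)"
    by (simp add: algebra_simps)
  moreover have "n - k = (n - k - l) + l" using assms Suc by simp
  then have "(n - k) * (n choose l) = (n - k - l) * (n choose l) + l * (n choose l)"
    by (metis add_mult_distrib)
  ultimately have "(n - k - l) * (n choose l) \<le> (n - k) * ?b" by simp
  moreover have "1 * (n choose l) \<le> (n - k - l) * (n choose l)"
    using assms Suc by (intro mult_le_mono1) simp
  moreover have "(n - k) * ?b \<le> Suc n * ?b" by (intro mult_le_mono1) simp
  ultimately show ?thesis by linarith
qed

text \<open>\<open>D\<close> has \<open>l\<close> elements and meets each of \<open>l\<close>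
  disjoint pairs, so it picks one element from every pair; \<open>C\<close> picks the larger one
  each time.\<close>

lemma ballot_maximal:
  assumes q: "q permutes {1..n}" "\<And>i. i < l \<Longrightarrow> q (2*i+1) < q (2*i+2)"
    and D: "finite D" "card D = l" "\<And>i. i < l \<Longrightarrow> q (2*i+1) \<in> D \<or> q (2*i+2) \<in> D"
    and C: "C = (\<lambda>i. q (2*i+2)) ` {..<l}"
  shows "D = C \<or> \<Sum>D < \<Sum>C"
proof -
  define e where "e i = (if q (2*i+2) \<in> D then q (2*i+2) else q (2*i+1))" for i
  have qi: "q x = q y \<longleftrightarrow> x = y" for x y using permutes_inj[OF q(1)] by (auto simp: inj_def)
  have inj: "inj_on e {..<l}"
    by (rule inj_onI) (auto simp: e_def qi split: if_splits; presburger)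
  have injC: "inj_on (\<lambda>i. q (2*i+2)) {..<l}" by (auto simp: inj_on_def qi)
  have eD: "e ` {..<l} = D"
  proof (rule card_subset_eq[OF D(1)])
    show "e ` {..<l} \<subseteq> D" using D(3) by (auto simp: e_def)
    show "card (e ` {..<l}) = card D" using inj D(2) by (simp add: card_image)
  qed
  have sD: "\<Sum>D = (\<Sum>i<l. e i)" using inj by (simp flip: eD add: sum.reindex)
  have sC: "\<Sum>C = (\<Sum>i<l. q (2*i+2))" unfolding C using injC by (subst sum.reindex) (simp_all add: o_def)
  have le: "e i \<le> q (2*i+2)" if "i < l" for i using q(2)[OF that] by (simp add: e_def)
  show ?thesis
  proof (cases "\<forall>i<l. e i = q (2*i+2)")
    case True
    then have "D = C" unfolding eD[symmetric] C by (intro image_cong) auto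
    then show ?thesis ..
  next
    case False
    then obtain i where "i < l" "e i < q (2*i+2)" using le by (metis le_neq_implies_less)
    then have "\<Sum>D < \<Sum>C" unfolding sD sC using le by (intro sum_strict_mono_ex1) auto
    then show ?thesis ..
  qed
qed

section \<open>Test vectors and triangularity\<close>

definition test_col :: "nat set \<Rightarrow> nat \<Rightarrow> 'f::field^2"
  where "test_col R j = axis (if j \<in> R then 2 else 1) 1"

text \<open>The covectors are e1 off \<open>C\<close> and e2 + \<open>p j\<close> e1 on
  \<open>C\<close>, so the second coordinate marks \<open>C\<close>. The parameter
  \<open>p j\<close> drops out of every determinant against e1.\<close>

definition test_row :: "(nat \<Rightarrow> 'f) \<Rightarrow> nat set \<Rightarrow> nat \<Rightarrow> 'f::field^2"
  where "test_row p C j = (\<chi> i. if i = 1 then (if j \<in> C then p j else 1) else (if j \<in> C then 1 else 0))"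

lemma det2_test_col: "det2 (test_col R i) (test_col R j) \<noteq> 0 \<Longrightarrow> i \<in> R \<or> j \<in> R"
  by (auto simp: det2_def test_col_def axis_def split: if_splits)

lemma det2_test_row: "det2 (test_row p C i) (test_row p C j) \<noteq> 0 \<Longrightarrow> i \<in> C \<or> j \<in> C"
  by (auto simp: det2_def test_row_def split: if_splits)

text \<open>In both fillings exactly the second entry of each column of height two is marked, so all
  determinants are 1; the columns of height one carry only unmarked entries.\<close>

lemma pairing_test_eq:
  assumes C: "C = (\<lambda>i. q (2*i+2)) ` {..<l}" and q: "q permutes {1..n}"
    and R: "R = (\<lambda>i. f (2*i+2)) ` {..<l}" and f: "f permutes {1..n}"
  shows "pairing n l q f (test_col R) (test_row p C) = 1"
proof -
  have qi: "q x = q y \<longleftrightarrow> x = y" for x y using permutes_inj[OF q(1)] by (auto simp: inj_def)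
  have fi: "f x = f y \<longleftrightarrow> x = y" for x y using permutes_inj[OF f(1)] by (auto simp: inj_def)
  have C1: "q j \<in> C \<longleftrightarrow> (\<exists>i<l. j = 2*i+2)" for j by (auto simp: C qi)
  have R1: "f j \<in> R \<longleftrightarrow> (\<exists>i<l. j = 2*i+2)" for j by (auto simp: R fi)
  have "(\<Prod>i<l. det2 (test_row p C (q (2*i+1))) (test_row p C (q (2*i+2))) *
      det2 (test_col R (f (2*i+1))) (test_col R (f (2*i+2)) :: 'a^2)) = 1"
  proof (rule prod.neutral, safe)
    fix i assume "i < l"
    then have "q (2*i+2) \<in> C" "f (2*i+2) \<in> R" "q (2*i+1) \<notin> C" "f (2*i+1) \<notin> R"
      unfolding C1 R1 by presburger+
    then show "det2 (test_row p C (q (2*i+1))) (test_row p C (q (2*i+2))) *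
      det2 (test_col R (f (2*i+1))) (test_col R (f (2*i+2)) :: 'a^2) = 1"
      by (simp add: det2_def test_col_def test_row_def axis_def)
  qed
  moreover have "(\<Prod>j\<in>{2*l+1..n}. dot (test_row p C (q j)) (test_col R (f j) :: 'a^2)) = 1"
  proof (rule prod.neutral, safe)
    fix j assume "j \<in> {2*l+1..n}"
    then have "q j \<notin> C" "f j \<notin> R" unfolding C1 R1 by auto
    then show "dot (test_row p C (q j)) (test_col R (f j) :: 'a^2) = 1"
      by (simp add: dot_def test_col_def test_row_def axis_def)
  qed
  ultimately show ?thesis by (simp add: pairing_def)
qed

text \<open>A nonzero determinant forces a marked entry in its column, for the vectors as for the
  covectors; then \<open>ballot_maximal\<close> applies to both.\<close>

lemma pairing_test_nonzero:
  assumes C: "C = (\<lambda>i. q (2*i+2)) ` {..<l}" and q: "q permutes {1..n}"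
      "\<And>i. i < l \<Longrightarrow> q (2*i+1) < q (2*i+2)"
    and R: "R = (\<lambda>i. f (2*i+2)) ` {..<l}" and f: "f permutes {1..n}"
      "\<And>i. i < l \<Longrightarrow> f (2*i+1) < f (2*i+2)"
    and C': "finite C'" "card C' = l" and R': "finite R'" "card R' = l"
    and nz: "pairing n l q f (test_col R') (test_row p C') \<noteq> 0"
  shows "C' = C \<and> R' = R \<or> \<Sum>C' + \<Sum>R' < \<Sum>C + \<Sum>R"
proof -
  have nz1: "det2 (test_row p C' (q (2*i+1))) (test_row p C' (q (2*i+2))) *
      det2 (test_col R' (f (2*i+1))) (test_col R' (f (2*i+2)) :: 'a^2) \<noteq> 0" if "i < l" for i
    using nz that by (auto simp: pairing_def)
  have meet: "q (2*i+1) \<in> C' \<or> q (2*i+2) \<in> C'" "f (2*i+1) \<in> R' \<or> f (2*i+2) \<in> R'" if "i < l" for i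
  proof -
    have "det2 (test_row p C' (q (2*i+1))) (test_row p C' (q (2*i+2))) \<noteq> 0"
      "det2 (test_col R' (f (2*i+1))) (test_col R' (f (2*i+2)) :: 'a^2) \<noteq> 0"
      using nz1[OF that] by (metis mult_zero_left, metis mult_zero_right)
    then show "q (2*i+1) \<in> C' \<or> q (2*i+2) \<in> C'" "f (2*i+1) \<in> R' \<or> f (2*i+2) \<in> R'"
      using det2_test_row det2_test_col by blast+
  qed
  have "C' = C \<or> \<Sum>C' < \<Sum>C" by (rule ballot_maximal[OF q C' meet(1) C])
  moreover have "R' = R \<or> \<Sum>R' < \<Sum>R" by (rule ballot_maximal[OF f R' meet(2) R])
  ultimately show ?thesis by auto
qed

section \<open>The upper bound\<close>

text \<open>Normalized generator of a line of covectors, e1 for column 1 and e2 + \<open>p\<close>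
  e1 for column 2. The entry at place \<open>c\<close> is 1, so that coefficients relative to a
  single frame vector are themselves matrix entries.\<close>

definition frame_row :: "'f::field \<Rightarrow> 2 \<Rightarrow> 'f^2"
  where "frame_row p c = (\<chi> i. if i = 1 then (if c = 2 then p else 1) else (if c = 2 then 1 else 0))"

lemma dot_axis: "dot w (axis r 1) = w $ r"
  using exhaust_2[of r] by (auto simp: dot_def axis_def)

lemma frame_row_nonzero: "frame_row p c $ r \<noteq> 0 \<Longrightarrow> c = 2 \<or> r = 1"
  by (auto simp: frame_row_def split: if_splits)

text \<open>Coordinates for the algebra: \<open>\<psi>\<close> embeds every component \<open>A t\<close> into the matrices as a left
  ideal with basis \<open>e\<^sub>r \<otimes> frame_row (p t) c\<close>, for \<open>c \<in> Col t\<close>.\<close>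

locale m2_graded = graded_algebra scale A
  for scale :: "'f::field \<Rightarrow> 'a::ring \<Rightarrow> 'a"
    and A :: "'t::semigroup_mult \<Rightarrow> 'a set" +
  fixes \<psi> :: "'a \<Rightarrow> 'f^2^2"
    and Col :: "'t \<Rightarrow> 2 set"
    and p :: "'t \<Rightarrow> 'f"
    and b :: "'t \<Rightarrow> 2 \<Rightarrow> 2 \<Rightarrow> 'a"
  assumes right_zero: "(s::'t) * t = t"
    and psi_add: "\<psi> (x + y) = \<psi> x + \<psi> y"
    and psi_scale: "\<psi> (scale a x) $ i $ j = a * \<psi> x $ i $ j"
    and psi_mult: "\<psi> (x * y) = \<psi> x ** \<psi> y"
    and b_in: "c \<in> Col t \<Longrightarrow> b t r c \<in> A t"
    and expand: "x \<in> A t \<Longrightarrow> x = (\<Sum>r\<in>UNIV. \<Sum>c\<in>Col t. scale (\<psi> x $ r $ c) (b t r c))"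
    and psi_b: "c \<in> Col t \<Longrightarrow> \<psi> (b t r c) = outer (axis r 1) (frame_row (p t) c)"
    and finite_support: "finite {t. Col t \<noteq> {}}"
begin

lemma psi_inject: "x \<in> A t \<Longrightarrow> y \<in> A t \<Longrightarrow> \<psi> x = \<psi> y \<Longrightarrow> x = y"
  using expand[of x t] expand[of y t] by simp

lemma mult_in: "y \<in> A t \<Longrightarrow> x \<in> A s \<Longrightarrow> x * y \<in> A t"
  using component_mult[of x s y t] by (simp add: right_zero)

text \<open>Both sides lie in \<open>A t\<close>, where \<psi> is injective, so the identity only
  has to be checked for matrices of rank one.\<close>

lemma b_mult:
  assumes "c \<in> Col t'" "s \<in> Col t"
  shows "b t' r c * b t r' s = scale (frame_row (p t') c $ r') (b t r s)"
proof (rule psi_inject)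
  show "b t' r c * b t r' s \<in> A t" using assms b_in mult_in by blast
  show "scale (frame_row (p t') c $ r') (b t r s) \<in> A t"
    using assms b_in subspace_component subspace_scale by blast
  show "\<psi> (b t' r c * b t r' s) = \<psi> (scale (frame_row (p t') c $ r') (b t r s))"
    using assms by (simp add: psi_mult psi_b outer_mult dot_axis vec_eq_iff psi_scale)
qed

section \<open>Counting weighted coordinate monomials\<close>

definition slots :: "('t \<times> 2 \<times> 2) set"
  where "slots = Sigma {t. Col t \<noteq> {}} (\<lambda>t. UNIV \<times> Col t)"

lemma finite_slots: "finite slots"
  using finite_support by (simp add: slots_def)

lemma slots_iff: "(t, r, c) \<in> slots \<longleftrightarrow> c \<in> Col t"
  by (auto simp: slots_def)

definition coord_prod :: "nat set \<Rightarrow> (nat \<Rightarrow> 't \<times> 2 \<times> 2) \<Rightarrow> (nat \<times> 't \<Rightarrow> 'a) \<Rightarrow> 'f"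
  where "coord_prod J h \<phi> = (\<Prod>j\<in>J. case h j of (t, r, c) \<Rightarrow> \<psi> (\<phi> (j, t)) $ r $ c)"

definition gen :: "nat set \<Rightarrow> (nat \<Rightarrow> 't \<times> 2 \<times> 2) \<Rightarrow> 't \<times> 2 \<times> 2 \<Rightarrow> (nat \<times> 't \<Rightarrow> 'a) \<Rightarrow> 'a"
  where "gen J h k = on_graded (\<lambda>\<phi>. scale (coord_prod J h \<phi>) (case k of (t, r, c) \<Rightarrow> b t r c))"

text \<open>A monomial in the entries gets the weight \<open>z\<close> to the number of row indices
  1 minus the number of column indices 1. A bound on this difference becomes a bound on a product,
  and products factorize under summation.\<close>

definition idx_wt :: "real \<Rightarrow> 2 \<Rightarrow> real"
  where "idx_wt z i = (if i = 1 then z else 1)"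

definition slot_wt :: "real \<Rightarrow> 't \<times> 2 \<times> 2 \<Rightarrow> real"
  where "slot_wt z k = (case k of (t, r, c) \<Rightarrow> idx_wt z r / idx_wt z c)"

text \<open>Along a product of matrix units the row and column indices telescope; as \<open>z \<ge> 1\<close>, passing
  from a matrix unit in column \<open>1\<close> to a frame vector of column \<open>2\<close> can only increase the weight.\<close>

definition gens :: "real \<Rightarrow> nat set \<Rightarrow> ((nat \<times> 't \<Rightarrow> 'a) \<Rightarrow> 'a) set"
  where "gens z J = {gen J h (t, r, s) | h t r s. h \<in> J \<rightarrow> slots \<and> s \<in> Col t \<and>
    idx_wt z r \<le> (\<Prod>j\<in>J. slot_wt z (h j)) * idx_wt z s}"

lemma linear_mult_left: "Vector_Spaces.linear fscale fscale (\<lambda>f. on_graded (\<lambda>\<phi>. \<phi> x * f \<phi>))"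
  by unfold_locales (auto simp: on_graded_def fscale_def fun_eq_iff distrib_left scale_mult_right)

lemma graded_expand:
  "graded_subst \<phi> \<Longrightarrow> \<phi> (j, t) = (\<Sum>r\<in>UNIV. \<Sum>c\<in>Col t. scale (\<psi> (\<phi> (j, t)) $ r $ c) (b t r c))"
  by (rule expand) (simp add: graded_subst_def)

lemma fs_sum_apply: "(\<Sum>i\<in>I. F i) \<phi> = (\<Sum>i\<in>I. F i \<phi>)" for F :: "'i \<Rightarrow> (nat \<times> 't \<Rightarrow> 'a) \<Rightarrow> 'a"
  by (induction I rule: infinite_finite_induct) auto

lemma mult_gen:
  assumes j: "j \<notin> J" "finite J" and s: "s \<in> Col t'"
  shows "on_graded (\<lambda>\<phi>. \<phi> (j, t) * gen J h (t', r', s) \<phi>) =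
    (\<Sum>r\<in>UNIV. \<Sum>c\<in>Col t. fscale (frame_row (p t) c $ r')
      (gen (insert j J) (h(j := (t, r, c))) (t', r, s)))" (is "?L = ?R")
proof
  fix \<phi>
  have cp: "coord_prod (insert j J) (h(j := (t, r, c))) \<phi> = \<psi> (\<phi> (j, t)) $ r $ c * coord_prod J h \<phi>" for r c
  proof -
    have "(\<Prod>i\<in>J. case (h(j := (t, r, c))) i of (t, r, c) \<Rightarrow> \<psi> (\<phi> (i, t)) $ r $ c)
        = (\<Prod>i\<in>J. case h i of (t, r, c) \<Rightarrow> \<psi> (\<phi> (i, t)) $ r $ c)"
      using j(1) by (intro prod.cong) auto
    then show ?thesis using j by (simp add: coord_prod_def)
  qed
  show "?L \<phi> = ?R \<phi>"
  proof (cases "graded_subst \<phi>")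
    case True
    let ?m = "coord_prod J h \<phi>"
    have "?L \<phi> = \<phi> (j, t) * scale ?m (b t' r' s)"
      using True by (simp add: on_graded_def gen_def)
    also have "\<dots> = (\<Sum>r\<in>UNIV. \<Sum>c\<in>Col t. scale (\<psi> (\<phi> (j, t)) $ r $ c) (b t r c)) * scale ?m (b t' r' s)"
      using graded_expand[OF True, of j t] by simp
    also have "\<dots> = (\<Sum>r\<in>UNIV. \<Sum>c\<in>Col t. scale (\<psi> (\<phi> (j, t)) $ r $ c * ?m) (b t r c * b t' r' s))"
      by (simp add: sum_distrib_right scale_mult_left scale_mult_right scale_sum_right mult.commute)
    also have "\<dots> = ?R \<phi>"
      unfolding fs_sum_apply using True s
      by (intro sum.cong refl) (simp add: b_mult fscale_def gen_def on_graded_def cp mult.commute mult.left_commute)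
    finally show ?thesis .
  qed (simp add: fs_sum_apply on_graded_def fscale_def gen_def)
qed

lemma mult_gens:
  assumes j: "j \<notin> J" "finite J" and z: "z \<ge> 1" and f: "f \<in> fs.span (gens z J)"
  shows "on_graded (\<lambda>\<phi>. \<phi> (j, t) * f \<phi>) \<in> fs.span (gens z (insert j J))"
proof -
  let ?L = "\<lambda>f. on_graded (\<lambda>\<phi>. \<phi> (j, t) * f \<phi>)"
  interpret L: Vector_Spaces.linear fscale fscale ?L by (rule linear_mult_left)
  have *: "?L g \<in> fs.span (gens z (insert j J))" if "g \<in> gens z J" for g
  proof -
    from that obtain h t' r' s where g: "g = gen J h (t', r', s)" and h: "h \<in> J \<rightarrow> slots"
      and s: "s \<in> Col t'" and wt: "idx_wt z r' \<le> (\<Prod>j\<in>J. slot_wt z (h j)) * idx_wt z s"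
      unfolding gens_def by blast
    have "fscale (frame_row (p t) c $ r') (gen (insert j J) (h(j := (t, r, c))) (t', r, s))
        \<in> fs.span (gens z (insert j J))" if c: "c \<in> Col t" for r c
    proof (cases "frame_row (p t) c $ r' = 0")
      case True
      show ?thesis unfolding True fs.scale_zero_left by (rule fs.span_zero)
    next
      case False
      let ?h = "h(j := (t, r, c))"
      have "(\<Prod>i\<in>J. slot_wt z (?h i)) = (\<Prod>i\<in>J. slot_wt z (h i))"
        using j(1) by (intro prod.cong) auto
      then have "(\<Prod>i\<in>insert j J. slot_wt z (?h i)) * idx_wt z s
          = idx_wt z r * (((\<Prod>i\<in>J. slot_wt z (h i)) * idx_wt z s) / idx_wt z c)"
        using j by (simp add: slot_wt_def)
      \<comment> \<open>The invariant for the old word bounds this from below by the quotient of the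
        weights of \<open>r'\<close> and \<open>c\<close>. A nonzero entry of the frame vector means
        \<open>c = 2\<close> or \<open>r' = 1\<close>, and as \<open>z \<ge> 1\<close> the quotient
        is then at least 1.\<close>
      moreover have "1 \<le> ((\<Prod>i\<in>J. slot_wt z (h i)) * idx_wt z s) / idx_wt z c"
      proof -
        have "idx_wt z c \<le> idx_wt z r'"
          using frame_row_nonzero[OF False] z by (auto simp: idx_wt_def)
        moreover have "idx_wt z c > 0" using z by (auto simp: idx_wt_def)
        ultimately show ?thesis using wt by (simp add: le_divide_eq)
      qed
      then have "idx_wt z r * 1 \<le> idx_wt z r * (((\<Prod>i\<in>J. slot_wt z (h i)) * idx_wt z s) / idx_wt z c)"
        using z by (intro mult_left_mono) (auto simp: idx_wt_def)
      ultimately have "idx_wt z r \<le> (\<Prod>i\<in>insert j J. slot_wt z (?h i)) * idx_wt z s"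
        by (simp only: mult_1_right)
      moreover have "?h \<in> insert j J \<rightarrow> slots" using h c by (auto simp: slots_iff)
      ultimately show ?thesis
        using s by (intro fs.span_scale fs.span_base) (auto simp: gens_def simp del: fun_upd_apply)
    qed
    then show ?thesis unfolding g mult_gen[OF j s] by (intro fs.span_sum)
  qed
  show ?thesis
    using f
  proof (induction rule: fs.span_induct_alt)
    case base
    show ?case unfolding L.zero by (rule fs.span_zero)
  next
    case (step c x y)
    then show ?case unfolding L.add L.scale using * by (intro fs.span_add fs.span_scale)
  qed
qed

lemma eval_monomial_in_gens:
  assumes "v \<noteq> []" "distinct (map fst v)" and z: "z \<ge> 1"
  shows "on_graded (\<lambda>\<phi>. eval_monomial \<phi> v) \<in> fs.span (gens z (fst ` set v))"
  using assms(1,2)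
proof (induction v)
  case (Cons x v)
  obtain j t where x: "x = (j, t)" by (cases x)
  show ?case
  proof (cases "v = []")
    case True
    have "on_graded (\<lambda>\<phi>. eval_monomial \<phi> [x]) =
        (\<Sum>r\<in>UNIV. \<Sum>c\<in>Col t. gen {j} (\<lambda>_. (t, r, c)) (t, r, c))" (is "?L = ?R")
    proof
      fix \<phi>
      show "?L \<phi> = ?R \<phi>"
        using graded_expand[of \<phi> j t]
        by (simp add: fs_sum_apply on_graded_def gen_def coord_prod_def x)
    qed
    also have "\<dots> \<in> fs.span (gens z {j})"
    proof (intro fs.span_sum fs.span_base)
      fix r c assume "c \<in> Col t"
      moreover have "idx_wt z c > 0" using z by (auto simp: idx_wt_def)
      ultimately show "gen {j} (\<lambda>_. (t, r, c)) (t, r, c) \<in> gens z {j}"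
        unfolding gens_def
        by (intro CollectI exI[of _ "\<lambda>_. (t, r, c)"] exI[of _ t] exI[of _ r] exI[of _ c])
          (auto simp: slots_iff slot_wt_def)
    qed
    finally show ?thesis using True by (simp add: x)
  next
    case False
    then have "on_graded (\<lambda>\<phi>. eval_monomial \<phi> v) \<in> fs.span (gens z (fst ` set v))"
      using Cons by simp
    then have "on_graded (\<lambda>\<phi>. \<phi> (j, t) * on_graded (\<lambda>\<phi>. eval_monomial \<phi> v) \<phi>)
        \<in> fs.span (gens z (insert j (fst ` set v)))"
      using Cons.prems by (intro mult_gens z) (auto simp: x)
    moreover have "on_graded (\<lambda>\<phi>. \<phi> (j, t) * on_graded (\<lambda>\<phi>. eval_monomial \<phi> v) \<phi>)
        = on_graded (\<lambda>\<phi>. eval_monomial \<phi> (x # v))"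
      using False by (simp add: on_graded_def fun_eq_iff eval_monomial_Cons x)
    ultimately show ?thesis by (simp add: x)
  qed
qed simp

lemma eval_fun_subset_gens:
  assumes "n \<ge> 1" "z \<ge> 1"
  shows "eval_fun ` multilinear_ncpolys n \<subseteq> fs.span (gens z {1..n})"
proof (rule eval_fun_multilinear_subset)
  fix v :: "(nat \<times> 't) list"
  assume v: "length v = n" "distinct (map fst v)" "fst ` set v = {1..n}"
  then have "v \<noteq> []" using assms(1) by auto
  then show "on_graded (\<lambda>\<phi>. eval_monomial \<phi> v) \<in> fs.span (gens z {1..n})"
    using eval_monomial_in_gens[OF _ v(2) assms(2)] v(3) by simp
qed

lemma slot_wt_nonneg: "z \<ge> 1 \<Longrightarrow> slot_wt z k \<ge> 0"
  by (auto simp: slot_wt_def idx_wt_def split: prod.splits)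

text \<open>Forgetting the two end indices costs at most the factor \<open>z\<close>. Restricting
  \<open>h\<close> to \<open>{1..n}\<close> places it in a finite set of functions.\<close>

lemma gens_subset:
  assumes z: "z \<ge> 1"
  shows "gens z {1..n} \<subseteq> (\<lambda>(h, k). gen {1..n} h k) `
    ({h \<in> PiE {1..n} (\<lambda>_. slots). 1 \<le> z * (\<Prod>j\<in>{1..n}. slot_wt z (h j))} \<times> slots)"
proof
  let ?w = "\<lambda>h. \<Prod>j\<in>{1..n}. slot_wt z (h j)"
  fix g assume "g \<in> gens z {1..n}"
  then obtain h t r s where g: "g = gen {1..n} h (t, r, s)" and h: "h \<in> {1..n} \<rightarrow> slots"
    and s: "s \<in> Col t" and wt: "idx_wt z r \<le> ?w h * idx_wt z s"
    unfolding gens_def by blast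
  let ?h = "restrict h {1..n}"
  have "g = gen {1..n} ?h (t, r, s)"
    unfolding g gen_def coord_prod_def by simp
  moreover have "1 \<le> z * ?w ?h"
  proof -
    have "?w h \<ge> 0" using slot_wt_nonneg[OF z] by (intro prod_nonneg) auto
    moreover have "1 \<le> idx_wt z r" "idx_wt z s \<le> z" using z by (auto simp: idx_wt_def)
    ultimately have "1 \<le> ?w h * idx_wt z s" "?w h * idx_wt z s \<le> ?w h * z"
      using wt by (auto intro: mult_left_mono)
    then show ?thesis by (simp add: mult.commute)
  qed
  ultimately show "g \<in> (\<lambda>(h, k). gen {1..n} h k) `
      ({h \<in> PiE {1..n} (\<lambda>_. slots). 1 \<le> z * ?w h} \<times> slots)"
    using h s by (intro image_eqI[of _ _ "(?h, (t, r, s))"]) (auto simp: slots_iff PiE_iff)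
qed

lemma finite_gens: "z \<ge> 1 \<Longrightarrow> finite (gens z {1..n})"
  by (rule finite_subset[OF gens_subset])
    (auto intro!: finite_imageI finite_cartesian_product finite_PiE finite_slots)

lemma sum_slots:
  fixes g :: "2 \<Rightarrow> 2 \<Rightarrow> real"
  shows "(\<Sum>(t, r, c)\<in>slots. g r c) =
    real (card {t. 1 \<in> Col t}) * (g 1 1 + g 2 1) + real (card {t. 2 \<in> Col t}) * (g 1 2 + g 2 2)"
proof -
  let ?T = "{t. Col t \<noteq> {}}"
  have col: "(\<Sum>c\<in>Col t. G c) = (if 1 \<in> Col t then G 1 else 0) + (if 2 \<in> Col t then G 2 else 0)"
    for t and G :: "2 \<Rightarrow> real"
  proof -
    have "(\<Sum>c\<in>Col t. G c) = (\<Sum>c\<in>UNIV. if c \<in> Col t then G c else 0)"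
      by (simp add: sum.inter_restrict[symmetric])
    then show ?thesis by (simp add: sum_2)
  qed
  have "(\<Sum>(t, r, c)\<in>slots. g r c) = (\<Sum>t\<in>?T. \<Sum>(r, c)\<in>UNIV \<times> Col t. g r c)"
    unfolding slots_def using finite_support by (subst sum.Sigma[symmetric]) auto
  also have "\<dots> = (\<Sum>t\<in>?T. \<Sum>r\<in>UNIV. \<Sum>c\<in>Col t. g r c)"
    by (intro sum.cong refl) (simp add: sum.cartesian_product)
  also have "\<dots> = (\<Sum>t\<in>?T. (if 1 \<in> Col t then g 1 1 + g 2 1 else 0) + (if 2 \<in> Col t then g 1 2 + g 2 2 else 0))"
    by (intro sum.cong refl) (simp add: col sum_2)
  also have "\<dots> = (\<Sum>t\<in>{t\<in>?T. 1 \<in> Col t}. g 1 1 + g 2 1) + (\<Sum>t\<in>{t\<in>?T. 2 \<in> Col t}. g 1 2 + g 2 2)"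
    by (subst sum.distrib) (simp only: sum.inter_filter[OF finite_support])
  also have "{t\<in>?T. 1 \<in> Col t} = {t. 1 \<in> Col t}" by auto
  also have "{t\<in>?T. 2 \<in> Col t} = {t. 2 \<in> Col t}" by auto
  finally show ?thesis by simp
qed

text \<open>Chernoff's argument: the number of index choices for which \<open>z\<close> times the
  weight is at least 1 is bounded by \<open>z\<close> times the total weight of all choices. The
  total weight is an n-th power, because the factors are chosen independently.\<close>

lemma codim_upper:
  assumes n: "n \<ge> 1" and z: "z \<ge> 1"
  shows "real (graded_codim n) \<le> z * real (card slots) *
    ((1 + z) * (real (card {t. 1 \<in> Col t}) / z + real (card {t. 2 \<in> Col t}))) ^ n"
proof -
  let ?P = "PiE {1..n} (\<lambda>_. slots)"
  let ?w = "\<lambda>h. \<Prod>j\<in>{1..n}. slot_wt z (h j)"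
  let ?Q = "{h \<in> ?P. 1 \<le> z * ?w h}"
  have finP: "finite ?P" using finite_slots by (intro finite_PiE) auto
  have nonneg: "?w h \<ge> 0" for h
    using slot_wt_nonneg[OF z] by (intro prod_nonneg) auto
  have finQ: "finite (?Q \<times> slots)" using finP finite_slots by simp
  have "real (graded_codim n) \<le> real (card (gens z {1..n}))"
    using fs.dim_le_card[OF eval_fun_subset_gens[OF n z] finite_gens[OF z]]
    by (simp add: graded_codim_eq_dim[OF n])
  also have "\<dots> \<le> real (card (?Q \<times> slots))"
    using card_mono[OF finite_imageI[OF finQ] gens_subset[OF z]]
      card_image_le[OF finQ, of "\<lambda>(h, k). gen {1..n} h k"] by linarith
  also have "\<dots> = real (card slots) * (\<Sum>h\<in>?Q. 1)" by (simp add: card_cartesian_product)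
  finally have 1: "real (graded_codim n) \<le> real (card slots) * (\<Sum>h\<in>?Q. 1)" .
  have "(\<Sum>h\<in>?Q. 1) \<le> (\<Sum>h\<in>?Q. z * ?w h)" by (intro sum_mono) simp
  also have "\<dots> \<le> (\<Sum>h\<in>?P. z * ?w h)"
    using finP z nonneg by (intro sum_mono2) auto
  also have "\<dots> = z * (\<Sum>k\<in>slots. slot_wt z k) ^ n"
    using finite_slots prod_sum_PiE[of "{1..n}" "\<lambda>_. slots" "\<lambda>_. slot_wt z"]
    by (simp flip: sum_distrib_left)
  also have "(\<Sum>k\<in>slots. slot_wt z k)
      = (1 + z) * (real (card {t. 1 \<in> Col t}) / z + real (card {t. 2 \<in> Col t}))"
    using sum_slots[of "\<lambda>r c. idx_wt z r / idx_wt z c"] z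
    by (simp add: slot_wt_def idx_wt_def divide_simps) (simp add: algebra_simps)
  finally have 2: "(\<Sum>h\<in>?Q. 1) \<le> z * ((1 + z) *
      (real (card {t. 1 \<in> Col t}) / z + real (card {t. 2 \<in> Col t}))) ^ n" .
  show ?thesis
    using order_trans[OF 1 mult_left_mono[OF 2]] by (simp add: mult.assoc mult.left_commute)
qed

end

section \<open>The lower bound\<close>

lemma pairing_cong:
  assumes "\<And>j. j \<in> {1..n} \<Longrightarrow> u j = u' j" "\<And>j. j \<in> {1..n} \<Longrightarrow> w j = w' j"
    "q permutes {1..n}" "f permutes {1..n}" "2 * l \<le> n"
  shows "pairing n l q f u w = pairing n l q f u' w'"
proof -
  have *: "w (q j) = w' (q j)" "u (f j) = u' (f j)" if "j \<in> {1..n}" for j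
    using that assms(1)[of "f j"] assms(2)[of "q j"]
      permutes_in_image[OF assms(3)] permutes_in_image[OF assms(4)] by simp_all
  have "(\<Prod>i<l. det2 (w (q (2*i+1))) (w (q (2*i+2))) * det2 (u (f (2*i+1))) (u (f (2*i+2))))
      = (\<Prod>i<l. det2 (w' (q (2*i+1))) (w' (q (2*i+2))) * det2 (u' (f (2*i+1))) (u' (f (2*i+2))))"
    using assms(5) by (intro prod.cong refl) (simp add: *)
  moreover have "(\<Prod>j\<in>{2*l+1..n}. dot (w (q j)) (u (f j))) = (\<Prod>j\<in>{2*l+1..n}. dot (w' (q j)) (u' (f j)))"
    by (intro prod.cong refl) (simp add: *)
  ultimately show ?thesis by (simp add: pairing_def)
qed

text \<open>Hides the fillings from the sequel; \<open>P\<close> is their pairing. Its values depend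
  on the test data on \<open>{1..n}\<close> only, so the two auxiliary variables remain
  free.\<close>

lemma ballot_comb:
  fixes C R :: "nat set"
  assumes "C \<in> ballot n l" "R \<in> ballot n l"
  obtains cs :: "('f::field \<times> nat list) list"
    and P :: "(nat \<Rightarrow> 'f^2) \<Rightarrow> (nat \<Rightarrow> 'f^2) \<Rightarrow> 'f"
  where "admissible ({1..n} \<union> {n+1, n+2}) {n+1, n+2} cs"
    and "\<And>u w. w (n+1) = w (n+2) \<Longrightarrow> comb_val u w cs = P u w *s comm_val u w (n+1) (n+2)"
    and "\<And>u w p. (\<And>j. j \<in> {1..n} \<Longrightarrow> u j = test_col R j) \<Longrightarrow>
      (\<And>j. j \<in> {1..n} \<Longrightarrow> w j = test_row p C j) \<Longrightarrow> P u w = 1"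
    and "\<And>u w p C' R'. (\<And>j. j \<in> {1..n} \<Longrightarrow> u j = test_col R' j) \<Longrightarrow>
      (\<And>j. j \<in> {1..n} \<Longrightarrow> w j = test_row p C' j) \<Longrightarrow> C' \<in> ballot n l \<Longrightarrow> R' \<in> ballot n l \<Longrightarrow>
      P u w \<noteq> 0 \<Longrightarrow> C' = C \<and> R' = R \<or> \<Sum>C' + \<Sum>R' < \<Sum>C + \<Sum>R"
proof -
  obtain q where q: "C = (\<lambda>i. q (2*i+2)) ` {..<l}" "2 * l \<le> n" "q permutes {1..n}"
    "\<And>i. i < l \<Longrightarrow> q (2*i+1) < q (2*i+2)" using assms(1) by (rule ballotE) blast
  obtain f where f: "R = (\<lambda>i. f (2*i+2)) ` {..<l}" "2 * l \<le> n" "f permutes {1..n}"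
    "\<And>i. i < l \<Longrightarrow> f (2*i+1) < f (2*i+2)" using assms(2) by (rule ballotE) blast
  obtain cs :: "('f \<times> nat list) list" where cs: "admissible ({1..n} \<union> {n+1, n+2}) {n+1, n+2} cs"
    "\<And>u w. w (n+1) = w (n+2) \<Longrightarrow> comb_val u w cs = pairing n l q f u w *s comm_val u w (n+1) (n+2)"
    using pairing_comb[where ?'f = 'f, of "n+1" "n+2" n l q f] q f by auto
  show ?thesis
  proof (rule that[OF cs])
    fix u w :: "nat \<Rightarrow> 'f^2" and p
    assume "\<And>j. j \<in> {1..n} \<Longrightarrow> u j = test_col R j" "\<And>j. j \<in> {1..n} \<Longrightarrow> w j = test_row p C j"
    then show "pairing n l q f u w = 1"
      using pairing_cong[OF _ _ q(3) f(3) q(2), of u "test_col R" w "test_row p C"]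
        pairing_test_eq[OF q(1,3) f(1,3)] by simp
  next
    fix u w :: "nat \<Rightarrow> 'f^2" and p C' R'
    assume "\<And>j. j \<in> {1..n} \<Longrightarrow> u j = test_col R' j" "\<And>j. j \<in> {1..n} \<Longrightarrow> w j = test_row p C' j"
    then have "pairing n l q f u w = pairing n l q f (test_col R') (test_row p C')"
      by (intro pairing_cong q f)
    moreover assume C': "C' \<in> ballot n l" and R': "R' \<in> ballot n l" and "pairing n l q f u w \<noteq> 0"
    ultimately show "C' = C \<and> R' = R \<or> \<Sum>C' + \<Sum>R' < \<Sum>C + \<Sum>R"
      using finite_subset[OF ballot_subset[OF C']] finite_subset[OF ballot_subset[OF R']]
      by (intro pairing_test_nonzero[OF q(1,3,4) f(1,3,4) _ card_in_ballot[OF C'] _ card_in_ballot[OF R']])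
        auto
  qed
qed

text \<open>Evaluate a relation at \<open>x i\<close>, where \<open>i\<close> has the largest
  \<open>s i\<close> among the indices with nonzero coefficient; every other term vanishes
  there.\<close>

lemma (in graded_algebra) triangular_independent:
  fixes s :: "'i \<Rightarrow> nat" and g :: "'i \<Rightarrow> (nat \<times> 't \<Rightarrow> 'a) \<Rightarrow> 'a"
  assumes diag: "\<And>i. i \<in> I \<Longrightarrow> g i (x i) \<noteq> 0"
    and tri: "\<And>i j. i \<in> I \<Longrightarrow> j \<in> I \<Longrightarrow> g j (x i) \<noteq> 0 \<Longrightarrow> i = j \<or> s i < s j"
  shows "inj_on g I" "fs.independent (g ` I)"
proof -
  have *: "\<forall>i\<in>S. c i = 0"
    if S: "finite S" "S \<subseteq> I" "(\<Sum>i\<in>S. fscale (c i) (g i)) = 0" for S c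
  proof (rule ccontr)
    let ?T = "{i\<in>S. c i \<noteq> 0}"
    assume "\<not> (\<forall>i\<in>S. c i = 0)"
    then have T: "?T \<noteq> {}" "finite ?T" using S(1) by auto
    then have "Max (s ` ?T) \<in> s ` ?T" by (intro Max_in) auto
    then obtain i where i: "i \<in> S" "c i \<noteq> 0" "s i = Max (s ` ?T)" by auto
    have mx: "s j \<le> s i" if "j \<in> S" "c j \<noteq> 0" for j using T that i(3) by simp
    have "(\<Sum>j\<in>S. fscale (c j) (g j)) (x i) = (\<Sum>j\<in>S. scale (c j) (g j (x i)))"
      by (induction S rule: infinite_finite_induct) (auto simp: fscale_def)
    also have "\<dots> = (\<Sum>j\<in>{i}. scale (c j) (g j (x i)))"
    proof (rule sum.mono_neutral_right[OF S(1)])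
      show "\<forall>j\<in>S - {i}. scale (c j) (g j (x i)) = 0"
      proof
        fix j assume j: "j \<in> S - {i}"
        show "scale (c j) (g j (x i)) = 0"
        proof (rule ccontr)
          assume "scale (c j) (g j (x i)) \<noteq> 0"
          then have "c j \<noteq> 0" "g j (x i) \<noteq> 0" by auto
          then show False using tri[of i j] mx[of j] i(1) j S(2) by auto
        qed
      qed
    qed (use i in auto)
    finally show False using S(2,3) i diag[of i] by auto
  qed
  show "inj_on g I" "fs.independent (g ` I)"
    by (rule fs.independent_family; rule *; assumption)+
qed

section \<open>Evaluating combinations of words in the algebra\<close>

context m2_graded
begin

lemma psi_zero [simp]: "\<psi> 0 = 0"
  using psi_add[of 0 0] by simp

lemma eval_monomial_in: "v \<noteq> [] \<Longrightarrow> graded_subst \<phi> \<Longrightarrow> eval_monomial \<phi> v \<in> A (snd (last v))"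
proof (induction v)
  case (Cons x v)
  have x: "\<phi> x \<in> A (snd x)" using Cons.prems(2) by (cases x) (simp add: graded_subst_def)
  show ?case
    using Cons x mult_in by (cases "v = []") (auto simp: eval_monomial_Cons)
qed simp

lemma psi_eval_word:
  assumes "ws \<noteq> []" "\<And>i. i \<in> set ws \<Longrightarrow> \<psi> (\<phi> (i, \<tau> i)) = outer (u i) (w i)"
  shows "\<psi> (eval_monomial \<phi> (map (\<lambda>i. (i, \<tau> i)) ws)) = outer (word_val u w ws) (w (last ws))"
  using assms
proof (induction ws)
  case (Cons i ws)
  then show ?case
    by (cases "ws = []") (simp_all add: eval_monomial_Cons word_val_Cons psi_mult outer_mult)
qed simp

definition comb_poly :: "(nat \<Rightarrow> 't) \<Rightarrow> ('f \<times> nat list) list \<Rightarrow> ('t, 'f) ncpoly"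
  where "comb_poly \<tau> cs = (\<Sum>(c, ws)\<leftarrow>cs. Poly_Mapping.single (map (\<lambda>i. (i, \<tau> i)) ws) c)"

lemma eval_comb_poly:
  "eval_ncpoly \<phi> (comb_poly \<tau> cs) =
    (\<Sum>(c, ws)\<leftarrow>cs. scale c (eval_monomial \<phi> (map (\<lambda>i. (i, \<tau> i)) ws)))"
  by (induction cs) (auto simp: comb_poly_def eval_ncpoly_add, simp add: eval_ncpoly_def)

lemma comb_poly_in_multilinear:
  assumes "admissible {1..n} Y cs"
  shows "comb_poly \<tau> cs \<in> multilinear_ncpolys n"
proof -
  have sub: "ncp.subspace (multilinear_ncpolys n :: ('t, 'f) ncpoly set)"
    unfolding multilinear_ncpolys_def by (rule ncp.subspace_span)
  show ?thesis
    using assms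
  proof (induction cs)
    case Nil
    then show ?case using ncp.subspace_0[OF sub] by (simp add: comb_poly_def)
  next
    case (Cons d cs)
    obtain c ws where d: "d = (c, ws)" by (cases d)
    have "Poly_Mapping.single (map (\<lambda>i. (i, \<tau> i)) ws) c \<in> multilinear_ncpolys n"
      using Cons.prems by (intro single_in_multilinear) (auto simp: admissible_def d)
    moreover have "comb_poly \<tau> cs \<in> multilinear_ncpolys n"
      using Cons by (auto simp: admissible_def)
    ultimately show ?case using ncp.subspace_add[OF sub] by (simp add: comb_poly_def d)
  qed
qed

text \<open>All words end in a variable of degree \<open>t\<close>, so the value stays in one
  component. There \<psi> is injective, and nonvanishing can be tested on matrices.\<close>

lemma eval_comb_poly_in:
  assumes "admissible V Y cs" "V \<noteq> {}" "graded_subst \<phi>" "\<And>y. y \<in> Y \<Longrightarrow> \<tau> y = t"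
  shows "eval_ncpoly \<phi> (comb_poly \<tau> cs) \<in> A t"
  using assms(1) unfolding eval_comb_poly
proof (induction cs)
  case Nil
  then show ?case using subspace_0[OF subspace_component] by simp
next
  case (Cons d cs)
  obtain c ws where d: "d = (c, ws)" by (cases d)
  have ws: "ws \<noteq> []" "last ws \<in> Y" using Cons.prems assms(2) by (auto simp: admissible_def d)
  then have "eval_monomial \<phi> (map (\<lambda>i. (i, \<tau> i)) ws) \<in> A t"
    using eval_monomial_in[of "map (\<lambda>i. (i, \<tau> i)) ws", OF _ assms(3)] assms(4)
    by (simp add: last_map)
  then have "scale c (eval_monomial \<phi> (map (\<lambda>i. (i, \<tau> i)) ws)) \<in> A t"
    by (rule subspace_scale[OF subspace_component])
  moreover have "(\<Sum>(c, ws)\<leftarrow>cs. scale c (eval_monomial \<phi> (map (\<lambda>i. (i, \<tau> i)) ws))) \<in> A t"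
    using Cons by (auto simp: admissible_def)
  ultimately show ?case using subspace_add[OF subspace_component] by (simp add: d)
qed

lemma psi_eval_comb_poly:
  assumes "admissible V Y cs" "V \<noteq> {}"
    and "\<And>i. i \<in> V \<Longrightarrow> \<psi> (\<phi> (i, \<tau> i)) = outer (u i) (w i)" "\<And>y. y \<in> Y \<Longrightarrow> w y = w0"
  shows "\<psi> (eval_ncpoly \<phi> (comb_poly \<tau> cs)) = outer (comb_val u w cs) w0"
  using assms(1) unfolding eval_comb_poly
proof (induction cs)
  case (Cons d cs)
  obtain c ws where d: "d = (c, ws)" by (cases d)
  have ws: "ws \<noteq> []" "last ws \<in> Y" "set ws = V"
    using Cons.prems assms(2) by (auto simp: admissible_def d)
  then have "\<psi> (eval_monomial \<phi> (map (\<lambda>i. (i, \<tau> i)) ws)) = outer (word_val u w ws) w0"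
    using psi_eval_word[of ws \<phi> \<tau> u w] assms(3,4) by simp
  moreover have "\<psi> (\<Sum>(c, ws)\<leftarrow>cs. scale c (eval_monomial \<phi> (map (\<lambda>i. (i, \<tau> i)) ws)))
      = outer (comb_val u w cs) w0"
    using Cons by (auto simp: admissible_def)
  ultimately show ?case by (simp add: d psi_add psi_scale vec_eq_iff algebra_simps)
qed (simp add: vec_eq_iff)

text \<open>Separates different degree functions: every word contains the letter \<open>j\<close>,
  so one vanishing variable suffices.\<close>

lemma eval_comb_poly_zero:
  assumes "admissible V Y cs" "j \<in> V" "\<phi> (j, \<tau> j) = 0"
  shows "eval_ncpoly \<phi> (comb_poly \<tau> cs) = 0"
  using assms(1) unfolding eval_comb_poly
proof (induction cs)
  case (Cons d cs)
  obtain c ws where d: "d = (c, ws)" by (cases d)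
  have "j \<in> set ws" using Cons.prems assms(2) by (auto simp: admissible_def d)
  then have "eval_monomial \<phi> (map (\<lambda>i. (i, \<tau> i)) ws) = 0"
    using assms(3) by (intro eval_monomial_zero[of "(j, \<tau> j)"]) auto
  then show ?case using Cons by (auto simp: admissible_def d)
qed simp

text \<open>The variables of index \<open>j \<le> n\<close> are 0 outside degree
  \<open>\<tau> j\<close>, which lets a substitution detect the degree function. The auxiliary
  variables go to e1 \<otimes> e1 and e2 \<otimes> e1 under \<psi>, whose commutator is not
  zero.\<close>

definition test_subst :: "nat \<Rightarrow> 't \<Rightarrow> (nat \<Rightarrow> 't) \<times> nat set \<times> nat set \<Rightarrow> nat \<times> 't \<Rightarrow> 'a"
  where "test_subst n t0 = (\<lambda>(\<tau>, C, R) (j, t).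
    if j \<in> {1..n} \<and> t = \<tau> j then b t (if j \<in> R then 2 else 1) (if j \<in> C then 2 else 1)
    else if j = n+1 \<and> t = t0 then b t 1 1 else if j = n+2 \<and> t = t0 then b t 2 1 else 0)"

text \<open>The polynomials are indexed by a degree function and two ballot sets \<open>C\<close>
  and \<open>R\<close>, prescribing the columns and the rows of the test matrices; a degree on
  \<open>C\<close> has to admit column 2, a degree off \<open>C\<close> column 1. Ordered by
  \<open>\<Sum>C + \<Sum>R\<close>, they are triangular with respect to
  \<open>test_subst\<close>.\<close>

lemma codim_lower:
  assumes t0: "1 \<in> Col t0" and l: "2 * l \<le> n"
  shows "(card (ballot n l))\<^sup>2 * (card {t. 2 \<in> Col t} ^ l * card {t. 1 \<in> Col t} ^ (n - l))
    \<le> graded_codim (n + 2)"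
proof -
  let ?D = "\<lambda>C j. if j \<in> C then {t. 2 \<in> Col t} else {t. 1 \<in> Col t}"
  let ?B = "ballot n l"
  define I where "I = (\<lambda>((C, R), \<tau>). (\<tau>, C, R)) ` Sigma (?B \<times> ?B) (\<lambda>(C, R). PiE {1..n} (?D C))"
  define ext where "ext \<tau> i = (if i \<in> {1..n} then \<tau> i else t0)" for \<tau> :: "nat \<Rightarrow> 't" and i
  let ?s = "\<lambda>(\<tau> :: nat \<Rightarrow> 't, C, R). \<Sum>C + \<Sum>R"
  let ?Y = "{n+1, n+2}"
  have V: "{1..n} \<union> ?Y = {1..n+2}" by auto
  have finD: "finite {t. c \<in> Col t}" for c
    by (rule finite_subset[OF _ finite_support]) auto
  define good where "good k cs \<longleftrightarrow> admissible {1..n+2} ?Y cs \<and> (case k of (\<tau>, C, R) \<Rightarrow>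
    eval_ncpoly (test_subst n t0 k) (comb_poly (ext \<tau>) cs) \<noteq> 0 \<and>
    (\<forall>k'\<in>I. eval_ncpoly (test_subst n t0 k') (comb_poly (ext \<tau>) cs) \<noteq> 0 \<longrightarrow> k' = k \<or> ?s k' < ?s k))"
    for k :: "(nat \<Rightarrow> 't) \<times> nat set \<times> nat set" and cs :: "('f \<times> nat list) list"
  have graded: "graded_subst (test_subst n t0 k)" if kI: "k \<in> I" for k
  proof -
    obtain \<tau> C R where k: "k = (\<tau>, C, R)" "\<tau> \<in> PiE {1..n} (?D C)" using kI by (auto simp: I_def)
    have *: "b (\<tau> j) r (if j \<in> C then 2 else 1) \<in> A (\<tau> j)" if "j \<in> {1..n}" for j r
      using PiE_mem[OF k(2) that] by (intro b_in) (auto split: if_splits)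
    have "test_subst n t0 k (i, t) \<in> A t" for i t
    proof (cases "i \<in> {1..n} \<and> t = \<tau> i")
      case True
      then show ?thesis
        using *[of i "if i \<in> R then 2 else 1"]
        by (simp add: test_subst_def k(1) split del: if_split)
    next
      case False
      then show ?thesis
        using t0 subspace_0[OF subspace_component] by (auto simp: test_subst_def k(1) b_in)
    qed
    then show ?thesis by (simp add: graded_subst_def)
  qed
  have ex: "\<exists>cs. good k cs" if kI: "k \<in> I" for k
  proof -
    obtain \<tau> C R where k: "k = (\<tau>, C, R)" and CR: "C \<in> ?B" "R \<in> ?B" and \<tau>: "\<tau> \<in> PiE {1..n} (?D C)"
      using kI by (auto simp: I_def)
    obtain cs :: "('f \<times> nat list) list" and P where adm: "admissible ({1..n} \<union> ?Y) ?Y cs"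
      and val: "\<And>u w. w (n+1) = w (n+2) \<Longrightarrow> comb_val u w cs = P u w *s comm_val u w (n+1) (n+2)"
      and one: "\<And>u w p. (\<And>j. j \<in> {1..n} \<Longrightarrow> u j = test_col R j) \<Longrightarrow>
        (\<And>j. j \<in> {1..n} \<Longrightarrow> w j = test_row p C j) \<Longrightarrow> P u w = 1"
      and tri: "\<And>u w p C' R'. (\<And>j. j \<in> {1..n} \<Longrightarrow> u j = test_col R' j) \<Longrightarrow>
        (\<And>j. j \<in> {1..n} \<Longrightarrow> w j = test_row p C' j) \<Longrightarrow> C' \<in> ?B \<Longrightarrow> R' \<in> ?B \<Longrightarrow>
        P u w \<noteq> 0 \<Longrightarrow> C' = C \<and> R' = R \<or> \<Sum>C' + \<Sum>R' < \<Sum>C + \<Sum>R"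
      using ballot_comb[OF CR, where ?'f = 'f] by blast
    \<comment> \<open>Indices with the same degree function as \<open>k\<close> realize the test
      vectors, and the commutator of the auxiliary variables is the negative of e2 \<otimes> e1; the
      value is this matrix times \<open>P u w\<close>.\<close>
    have ev: "\<exists>u w. (\<forall>j\<in>{1..n}. u j = test_col R' j) \<and> (\<forall>j\<in>{1..n}. w j = test_row (p \<circ> \<tau>) C' j) \<and>
        \<psi> (eval_ncpoly (test_subst n t0 (\<tau>, C', R')) (comb_poly (ext \<tau>) cs))
          = outer (P u w *s axis 2 (- 1)) (axis 1 1)"
      if k': "(\<tau>, C', R') \<in> I" for C' R'
    proof -
      define u :: "nat \<Rightarrow> 'f^2"
        where "u j = (if j = n+1 then axis 1 1 else if j = n+2 then axis 2 1 else test_col R' j)" for j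
      define w :: "nat \<Rightarrow> 'f^2"
        where "w j = (if j \<in> {1..n} then test_row (p \<circ> \<tau>) C' j else axis 1 1)" for j
      let ?\<phi> = "test_subst n t0 (\<tau>, C', R')"
      have \<tau>': "\<tau> \<in> PiE {1..n} (?D C')" using k' by (auto simp: I_def)
      have fr: "frame_row (p (\<tau> j)) (if j \<in> C' then 2 else 1) = test_row (p \<circ> \<tau>) C' j" for j
        by (auto simp: frame_row_def test_row_def vec_eq_iff)
      have f1: "frame_row a 1 = (axis 1 1 :: 'f^2)" for a
        by (auto simp: frame_row_def axis_def vec_eq_iff)
      have "\<psi> (?\<phi> (i, ext \<tau> i)) = outer (u i) (w i)" if i: "i \<in> {1..n} \<union> ?Y" for i
      proof (cases "i \<in> {1..n}")
        case True
        have "(if i \<in> C' then 2 else 1) \<in> Col (\<tau> i)"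
          using PiE_mem[OF \<tau>' True] by (auto split: if_splits)
        then have "\<psi> (?\<phi> (i, ext \<tau> i)) = outer (axis (if i \<in> R' then 2 else 1) 1) (test_row (p \<circ> \<tau>) C' i)"
          using True by (simp add: test_subst_def ext_def psi_b fr[symmetric])
        then show ?thesis using True by (simp add: u_def w_def test_col_def)
      next
        case False
        then show ?thesis using i t0 by (auto simp: test_subst_def ext_def psi_b f1 u_def w_def)
      qed
      then have "\<psi> (eval_ncpoly ?\<phi> (comb_poly (ext \<tau>) cs)) = outer (comb_val u w cs) (axis 1 1)"
        using adm by (intro psi_eval_comb_poly[of "{1..n} \<union> ?Y" ?Y]) (auto simp: w_def)
      moreover have "comb_val u w cs = P u w *s axis 2 (- 1)"
      proof -
        have "comm_val u w (n+1) (n+2) = axis 2 (- 1)"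
          by (auto simp: comm_val_def u_def w_def dot_def axis_def vec_eq_iff forall_2)
        then show ?thesis using val[of w u] by (simp add: w_def)
      qed
      ultimately have "\<psi> (eval_ncpoly ?\<phi> (comb_poly (ext \<tau>) cs)) = outer (P u w *s axis 2 (- 1)) (axis 1 1)"
        by simp
      then show ?thesis
        by (intro exI[of _ u] exI[of _ w]) (auto simp: u_def w_def)
    qed
    have "eval_ncpoly (test_subst n t0 k) (comb_poly (ext \<tau>) cs) \<noteq> 0"
    proof
      assume 0: "eval_ncpoly (test_subst n t0 k) (comb_poly (ext \<tau>) cs) = 0"
      obtain u w where u: "\<forall>j\<in>{1..n}. u j = test_col R j" "\<forall>j\<in>{1..n}. w j = test_row (p \<circ> \<tau>) C j"
        and "\<psi> 0 = outer (P u w *s axis 2 (- 1)) (axis 1 1)"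
        using ev[of C R] kI 0 unfolding k by auto
      moreover have "P u w = 1" using u by (intro one[of u w "p \<circ> \<tau>"]) auto
      ultimately have "(0 :: 'f^2^2) $ 2 $ 1 = outer (axis 2 (- 1)) (axis 1 1) $ 2 $ 1" by simp
      then show False by (simp add: axis_def)
    qed
    moreover have "k' = k \<or> ?s k' < ?s k"
      if k': "k' \<in> I" and nz: "eval_ncpoly (test_subst n t0 k') (comb_poly (ext \<tau>) cs) \<noteq> 0" for k'
    proof -
      obtain \<tau>' C' R' where k'_eq: "k' = (\<tau>', C', R')" and CR': "C' \<in> ?B" "R' \<in> ?B"
        and \<tau>': "\<tau>' \<in> PiE {1..n} (?D C')"
        using k' by (auto simp: I_def)
      \<comment> \<open>At an index where they differed, the variable would be replaced by 0 and the
        whole polynomial would vanish.\<close>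
      have "\<tau>' = \<tau>"
      proof (rule extensionalityI[of \<tau>' "{1..n}" \<tau>], goal_cases)
        case (3 j)
        show ?case
        proof (rule ccontr)
          assume "\<tau>' j \<noteq> \<tau> j"
          then have "test_subst n t0 k' (j, ext \<tau> j) = 0"
            using 3 by (auto simp: test_subst_def k'_eq ext_def)
          then show False using eval_comb_poly_zero[OF adm, of j] nz 3 by simp
        qed
      qed (use \<tau> \<tau>' in \<open>auto simp: PiE_def\<close>)
      then obtain u w where u: "\<forall>j\<in>{1..n}. u j = test_col R' j" "\<forall>j\<in>{1..n}. w j = test_row (p \<circ> \<tau>) C' j"
        and ps: "\<psi> (eval_ncpoly (test_subst n t0 k') (comb_poly (ext \<tau>) cs))
          = outer (P u w *s axis 2 (- 1)) (axis 1 1)"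
        using ev[of C' R'] k' unfolding k'_eq by auto
      have "eval_ncpoly (test_subst n t0 k') (comb_poly (ext \<tau>) cs) \<in> A t0"
        using graded[OF k'] by (intro eval_comb_poly_in[OF adm]) (auto simp: ext_def)
      then have "P u w \<noteq> 0"
        using nz ps psi_inject[of _ t0 0] subspace_0[OF subspace_component]
        by (fastforce simp: vec_eq_iff)
      then have "C' = C \<and> R' = R \<or> \<Sum>C' + \<Sum>R' < \<Sum>C + \<Sum>R"
        using u CR' by (intro tri[of u R' w "p \<circ> \<tau>" C']) auto
      then show ?thesis using \<open>\<tau>' = \<tau>\<close> by (auto simp: k k'_eq)
    qed
    ultimately have "good k cs" using adm[unfolded V] by (simp add: good_def k)
    then show ?thesis ..
  qed
  then obtain cs where cs: "\<And>k. k \<in> I \<Longrightarrow> good k (cs k)" by metis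
  define g where "g k = eval_fun (comb_poly (ext (fst k)) (cs k))" for k
  have gv: "g k (test_subst n t0 k') = eval_ncpoly (test_subst n t0 k') (comb_poly (ext (fst k)) (cs k))"
    if "k' \<in> I" for k k'
    using graded[OF that] by (simp add: g_def eval_fun_def on_graded_def)
  have diag: "g k (test_subst n t0 k) \<noteq> 0" if "k \<in> I" for k
    using cs[OF that] gv[OF that] by (auto simp: good_def split: prod.splits)
  have tri: "k = k' \<or> ?s k < ?s k'" if "k \<in> I" "k' \<in> I" "g k' (test_subst n t0 k) \<noteq> 0" for k k'
    using cs[OF that(2)] gv[OF that(1), of k'] that(1,3) by (auto simp: good_def split: prod.splits)
  have "g ` I \<subseteq> eval_fun ` multilinear_ncpolys (n + 2)"
  proof
    fix f assume "f \<in> g ` I"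
    then obtain k where k: "k \<in> I" "f = g k" by blast
    then have "admissible {1..n+2} ?Y (cs k)" using cs by (simp add: good_def)
    then show "f \<in> eval_fun ` multilinear_ncpolys (n + 2)"
      unfolding k(2) g_def by (intro imageI comb_poly_in_multilinear)
  qed
  \<comment> \<open>Any \<open>z \<ge> 1\<close> would do here: only a finite spanning set is
    wanted, so that \<open>card_le_dim\<close> applies.\<close>
  moreover have "finite (gens 1 {1..n+2})" by (rule finite_gens) simp
  moreover have "eval_fun ` multilinear_ncpolys (n + 2) \<subseteq> fs.span (gens 1 {1..n+2})"
    by (rule eval_fun_subset_gens) simp_all
  ultimately have "card (g ` I) \<le> fs.dim (eval_fun ` multilinear_ncpolys (n + 2))"
    using triangular_independent(2)[of I g, OF diag tri] by (intro fs.card_le_dim) auto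
  then have "card (g ` I) \<le> graded_codim (n + 2)" by (simp add: graded_codim_eq_dim)
  moreover have "card (g ` I) = card I"
    using triangular_independent(1)[of I g, OF diag tri] by (rule card_image)
  moreover have "card I = (card ?B)\<^sup>2 * (card {t. 2 \<in> Col t} ^ l * card {t. 1 \<in> Col t} ^ (n - l))"
  proof -
    have "card (PiE {1..n} (?D C)) = card {t. 2 \<in> Col t} ^ l * card {t. 1 \<in> Col t} ^ (n - l)"
      if C: "C \<in> ?B" for C
    proof -
      have Cn: "C \<subseteq> {1..n}" "finite C" "card C = l"
        using ballot_subset[OF C] card_in_ballot[OF C] by (auto intro: finite_subset)
      have "card (PiE {1..n} (?D C)) = (\<Prod>j\<in>{1..n}. card (?D C j))" by (rule card_PiE) simp
      also have "\<dots> = (\<Prod>j\<in>C. card (?D C j)) * (\<Prod>j\<in>{1..n} - C. card (?D C j))"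
        using Cn by (subst prod.subset_diff[of C]) (auto simp: mult.commute)
      also have "(\<Prod>j\<in>C. card (?D C j)) = card {t. 2 \<in> Col t} ^ l" using Cn by simp
      also have "(\<Prod>j\<in>{1..n} - C. card (?D C j)) = card {t. 1 \<in> Col t} ^ (n - l)"
        using Cn by (simp add: card_Diff_subset)
      finally show ?thesis .
    qed
    moreover have "card I = card (Sigma (?B \<times> ?B) (\<lambda>(C, R). PiE {1..n} (?D C)))"
      unfolding I_def by (rule card_image) (auto simp: inj_on_def)
    moreover have "\<dots> = (\<Sum>x\<in>?B \<times> ?B. card (case x of (C, R) \<Rightarrow> PiE {1..n} (?D C)))"
      using finite_ballot finD by (intro card_SigmaI) (auto intro!: finite_PiE)
    moreover have "\<dots> = (\<Sum>x\<in>?B \<times> ?B. card {t. 2 \<in> Col t} ^ l * card {t. 1 \<in> Col t} ^ (n - l))"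
      using calculation(1) by (intro sum.cong refl) auto
    ultimately show ?thesis
      by (simp add: card_cartesian_product power2_eq_square)
  qed
  ultimately show ?thesis by simp
qed

end

section \<open>Structure of the algebra\<close>

lemma det2_eq_0D:
  assumes "det2 w v = 0" "w \<noteq> 0"
  obtains k where "v = k *s w"
proof (cases "w $ 1 = 0")
  case True
  then have "w $ 2 \<noteq> 0" using assms(2) by (auto simp: vec_eq_iff forall_2)
  then have "v = (v $ 2 / w $ 2) *s w"
    using assms(1) True by (simp add: vec_eq_iff forall_2 det2_def)
  then show ?thesis by (rule that)
next
  case False
  then have "v = (v $ 1 / w $ 1) *s w"
    using assms(1) by (simp add: vec_eq_iff forall_2 det2_def field_simps)
  then show ?thesis by (rule that)
qed

lemma outer_axis_mult: "outer u (axis i 1) ** y = outer u (y $ i)"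
  using exhaust_2[of i]
  by (auto simp: vec_eq_iff matrix_matrix_mult_def sum_2 axis_def)

text \<open>Multiplying by \<open>outer u (axis i 1)\<close> extracts row \<open>i\<close> of a
  member. So the ideal is determined by the space spanned by all rows, which has dimension 0, 1 or
  2.\<close>

lemma left_ideal_cases:
  fixes Y :: "('f::field^2^2) set"
  assumes ne: "Y \<noteq> {}" and add: "\<And>x y. x \<in> Y \<Longrightarrow> y \<in> Y \<Longrightarrow> x + y \<in> Y"
    and mult: "\<And>m y. y \<in> Y \<Longrightarrow> m ** y \<in> Y"
  obtains "Y = {0}" | w where "w \<noteq> 0" "Y = range (\<lambda>u. outer u w)" | "Y = UNIV"
proof -
  have row: "outer u (y $ i) \<in> Y" if "y \<in> Y" for y u i
    using mult[OF that, of "outer u (axis i 1)"] by (simp add: outer_axis_mult)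
  consider (indep) y i y' i' where "y \<in> Y" "y' \<in> Y" "det2 (y $ i) (y' $ i') \<noteq> 0"
    | (line) y i where "y \<in> Y" "y $ i \<noteq> 0" "\<And>y' i'. y' \<in> Y \<Longrightarrow> det2 (y $ i) (y' $ i') = 0"
    | (zero) "\<And>y i. y \<in> Y \<Longrightarrow> y $ i = 0"
    by blast
  then show ?thesis
  proof cases
    case indep
    let ?v = "y $ i" and ?w = "y' $ i'"
    let ?d = "det2 ?v ?w"
    have "m \<in> Y" for m
    proof -
      \<comment> \<open>Cramer's rule, expressing each row of \<open>m\<close> in the two
        independent rows.\<close>
      let ?a = "\<chi> r. det2 (m $ r) ?w / ?d" and ?b = "\<chi> r. det2 ?v (m $ r) / ?d"
      have "m = outer ?a ?v + outer ?b ?w"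
        using indep(3) by (simp add: vec_eq_iff forall_2 divide_simps) (simp add: det2_def algebra_simps)
      then show ?thesis using add[OF row[OF indep(1), of ?a i] row[OF indep(2), of ?b i']] by simp
    qed
    then show ?thesis using that(3) by blast
  next
    case line
    have "y' \<in> range (\<lambda>u. outer u (y $ i))" if y': "y' \<in> Y" for y'
    proof -
      have "\<exists>k. y' $ r = k *s (y $ i)" for r
        using det2_eq_0D[OF line(3)[OF y'] line(2)] by metis
      then obtain k where k: "\<And>r. y' $ r = k r *s (y $ i)" by metis
      then have "y' = outer (\<chi> r. k r) (y $ i)" by (simp add: vec_eq_iff)
      then show ?thesis by blast
    qed
    then have "Y = range (\<lambda>u. outer u (y $ i))" using row[OF line(1)] by auto
    then show ?thesis using that(2) line(2) by blast
  next
    case zero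
    then have "y = 0" if "y \<in> Y" for y using that by (simp add: vec_eq_iff)
    then have "Y = {0}" using ne by blast
    then show ?thesis by (rule that(1))
  qed
qed

text \<open>Complete \<open>w\<close> by some \<open>v\<close> to a basis of determinant 1 and take
  \<open>w\<close>, \<open>v\<close> as the rows of \<open>Q\<close>. Then \<open>w\<close> times
  the inverse \<open>Q'\<close> is e1, while \<open>Q\<close> from the left only changes the
  vector.\<close>

lemma conjugate_to_axis:
  fixes w :: "'f::field^2"
  assumes "w \<noteq> 0"
  obtains Q Q' :: "'f^2^2" where "Q ** Q' = mat 1" "Q' ** Q = mat 1"
    and "\<And>u. \<exists>u'. Q ** outer u w ** Q' = outer u' (axis 1 1)"
proof -
  obtain v where v: "det2 w v = 1"
  proof (cases "w $ 1 = 0")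
    case True
    then have "w $ 2 \<noteq> 0" using assms by (auto simp: vec_eq_iff forall_2)
    then have "det2 w (\<chi> i. if i = 1 then - 1 / w $ 2 else 0) = 1" by (simp add: det2_def)
    then show ?thesis by (rule that)
  next
    case False
    then have "det2 w (\<chi> i. if i = 1 then 0 else 1 / w $ 1) = 1" by (simp add: det2_def)
    then show ?thesis by (rule that)
  qed
  define Q :: "'f^2^2" where "Q = (\<chi> i. if i = 1 then w else v)"
  define Q' :: "'f^2^2" where "Q' = (\<chi> i j. if i = 1 then if j = 1 then v $ 2 else - w $ 2
    else if j = 1 then - v $ 1 else w $ 1)"
  show ?thesis
  proof (rule that)
    show "Q ** Q' = mat 1" "Q' ** Q = mat 1"
      using v by (simp_all add: vec_eq_iff forall_2 matrix_matrix_mult_def sum_2 mat_def Q_def Q'_def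
        det2_def algebra_simps)
    fix u
    have "outer u w ** Q' = outer u (axis 1 1)"
    proof -
      have "u $ r * (w $ 1 * v $ 2) - u $ r * (w $ 2 * v $ 1) = u $ r" for r
        using arg_cong[OF v, of "\<lambda>x. u $ r * x"] by (simp add: det2_def right_diff_distrib)
      then show ?thesis
        by (simp add: vec_eq_iff forall_2 matrix_matrix_mult_def sum_2 Q'_def axis_def algebra_simps)
    qed
    moreover have "Q ** outer u (axis 1 1) = outer (Q *v u) (axis 1 1)"
      by (simp add: vec_eq_iff forall_2 matrix_matrix_mult_def matrix_vector_mult_def sum_2 axis_def)
    ultimately have "Q ** outer u w ** Q' = outer (Q *v u) (axis 1 1)"
      by (simp flip: matrix_mul_assoc)
    then show "\<exists>u'. Q ** outer u w ** Q' = outer u' (axis 1 1)" ..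
  qed
qed

section \<open>Homomorphisms onto the matrices\<close>

locale M2_hom = assoc_algebra scale for scale :: "'f::field \<Rightarrow> 'a::ring \<Rightarrow> 'a" +
  fixes \<psi> :: "'a \<Rightarrow> 'f^2^2"
  assumes hom_add: "\<psi> (x + y) = \<psi> x + \<psi> y"
    and hom_scale: "\<psi> (scale c x) $ i $ j = c * \<psi> x $ i $ j"
    and hom_mult: "\<psi> (x * y) = \<psi> x ** \<psi> y"
    and hom_surj: "surj \<psi>"
begin

lemma hom_zero [simp]: "\<psi> 0 = 0"
  using hom_add[of 0 0] by simp

lemma hom_minus: "\<psi> (- x) = - \<psi> x"
  using hom_add[of x "- x"] by (simp add: eq_neg_iff_add_eq_0 add.commute)

lemma hom_diff: "\<psi> (x - y) = \<psi> x - \<psi> y"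
  using hom_add[of x "- y"] by (simp add: hom_minus)

lemma conjugate:
  assumes "Q ** Q' = mat 1" "Q' ** Q = mat 1"
  shows "M2_hom scale (\<lambda>x. Q ** \<psi> x ** Q')"
proof
  show "Q ** \<psi> (x + y) ** Q' = Q ** \<psi> x ** Q' + Q ** \<psi> y ** Q'" for x y
    by (simp add: vec_eq_iff matrix_matrix_mult_def sum_2 hom_add algebra_simps)
  show "(Q ** \<psi> (scale c x) ** Q') $ i $ j = c * (Q ** \<psi> x ** Q') $ i $ j" for c x i j
    by (simp add: matrix_matrix_mult_def sum_2 hom_scale algebra_simps)
  show "Q ** \<psi> (x * y) ** Q' = Q ** \<psi> x ** Q' ** (Q ** \<psi> y ** Q')" for x y
  proof -
    have "Q ** \<psi> x ** Q' ** (Q ** \<psi> y ** Q') = Q ** \<psi> x ** (Q' ** Q) ** \<psi> y ** Q'"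
      by (simp only: matrix_mul_assoc)
    then show ?thesis by (simp add: assms(2) hom_mult matrix_mul_assoc)
  qed
  show "surj (\<lambda>x. Q ** \<psi> x ** Q')"
  proof (rule surjI)
    fix m
    have "\<psi> (inv \<psi> (Q' ** m ** Q)) = Q' ** m ** Q" by (rule surj_f_inv_f[OF hom_surj])
    moreover have "Q ** (Q' ** m ** Q) ** Q' = (Q ** Q') ** m ** (Q ** Q')"
      by (simp only: matrix_mul_assoc)
    ultimately show "Q ** \<psi> (inv \<psi> (Q' ** m ** Q)) ** Q' = m" using assms(1) by simp
  qed
qed

end

context assoc_algebra
begin

lemma subspace_jacobson_radical: "subspace jacobson_radical"
  unfolding jacobson_radical_def
  by (rule subspace_Inter) (auto simp: maximal_right_ideal_def right_ideal_def)

lemma quotient_iso_M2_hom: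
  assumes J: "subspace J" and iso: "quotient_iso_M2 J"
  obtains \<psi> where "M2_hom scale \<psi>" "\<And>x. \<psi> x = 0 \<longleftrightarrow> x \<in> J"
proof -
  obtain F :: "'a set \<Rightarrow> 'f^2^2" where bij: "bij_betw F (cosets UNIV J) UNIV"
    and F: "\<And>x y. F ((x + y) +o J) = F (x +o J) + F (y +o J)"
      "\<And>x y. F ((x * y) +o J) = F (x +o J) ** F (y +o J)"
      "\<And>c x. F (scale c x +o J) = (\<chi> i j. c * F (x +o J) $ i $ j)"
    using iso unfolding quotient_iso_M2_def by blast
  let ?\<psi> = "\<lambda>x. F (x +o J)"
  have surj: "surj ?\<psi>"
    using bij by (force simp: bij_betw_def cosets_def)
  have hom: "M2_hom scale ?\<psi>"
    by unfold_locales (simp_all add: F surj)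
  then interpret M2_hom scale ?\<psi> .
  have "F (x +o J) = 0 \<longleftrightarrow> x \<in> J" for x
  proof -
    have "F (x +o J) = F (0 +o J) \<longleftrightarrow> x +o J = 0 +o J"
    proof (rule inj_on_eq_iff)
      show "inj_on F (cosets UNIV J)" using bij by (simp add: bij_betw_def)
      show "x +o J \<in> cosets UNIV J" "0 +o J \<in> cosets UNIV J" unfolding cosets_def by blast+
    qed
    then show ?thesis using coset_eq_iff[OF J, of x 0] hom_zero by simp
  qed
  then show ?thesis by (rule that[OF hom])
qed

end

section \<open>The components as left ideals of matrices\<close>

context graded_algebra
begin

lemma mult_in_component:
  assumes rz: "\<And>s t :: 't. s * t = t" and x: "x \<in> A t"
  shows "y * x \<in> A t"
proof -
  have "y \<in> span (\<Union>s. A s)" using span_components by simp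
  then show ?thesis
  proof (induction rule: span_induct_alt)
    case base
    then show ?case using subspace_0[OF subspace_component] by simp
  next
    case (step c z y)
    then obtain s where "z \<in> A s" by blast
    then have "z * x \<in> A t" using component_mult[OF _ x, of z s] by (simp add: rz)
    then show ?case
      using step subspace_component[of t]
      by (simp add: distrib_right scale_mult_left subspace_add subspace_scale)
  qed
qed

text \<open>The components being left ideals, their intersections with an ideal span a homogeneous
  ideal; graded simplicity then makes every component meet the radical trivially.\<close>

lemma component_meets_kernel:
  assumes rz: "\<And>s t :: 't. s * t = t" and simple: graded_simple and hom: "M2_hom scale \<psi>"
    and x: "x \<in> A t" "\<psi> x = 0"
  shows "x = 0"
proof -
  interpret M2_hom scale \<psi> by fact
  define K where "K = span (\<Union>t. {x \<in> A t. \<psi> x = 0})"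
  have ker: "\<psi> x = 0" if "x \<in> K" for x
    using that unfolding K_def
    by (induction rule: span_induct_alt) (auto simp: hom_add vec_eq_iff hom_scale)
  note comp = mult_in_component[OF rz]
  have left: "y * x \<in> K" if "x \<in> K" for x y
    using that unfolding K_def
  proof (induction rule: span_induct_alt)
    case (step c z w)
    then obtain t where "z \<in> A t" "\<psi> z = 0" by blast
    then have "y * z \<in> {x \<in> A t. \<psi> x = 0}" using comp by (simp add: hom_mult)
    then have "y * z \<in> span (\<Union>t. {x \<in> A t. \<psi> x = 0})" by (intro span_base) blast
    then show ?case using step by (simp add: distrib_left scale_mult_right span_add span_scale)
  qed (simp add: span_zero)
  \<comment> \<open>For \<open>z\<close> in \<open>A s\<close> the product \<open>x * z\<close> lies
    in \<open>A s\<close> again and is killed by \<psi>, hence is one of the generators of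
    \<open>K\<close>.\<close>
  have right: "x * y \<in> K" if "x \<in> K" for x y
  proof -
    have "y \<in> span (\<Union>s. A s)" using span_components by simp
    then show ?thesis
    proof (induction rule: span_induct_alt)
      case base
      then show ?case by (simp add: K_def span_zero)
    next
      case (step c z y)
      then obtain s where "z \<in> A s" by blast
      then have "x * z \<in> {x \<in> A s. \<psi> x = 0}" using comp ker[OF that] by (simp add: hom_mult)
      then have "x * z \<in> K" unfolding K_def by (intro span_base) blast
      then show ?case
        using step by (simp add: K_def distrib_left scale_mult_right span_add span_scale)
    qed
  qed
  have "K = span (\<Union>t. K \<inter> A t)"
  proof
    have "(\<Union>t. {x \<in> A t. \<psi> x = 0}) \<subseteq> (\<Union>t. K \<inter> A t)"
      unfolding K_def by (auto intro: span_base)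
    then show "K \<subseteq> span (\<Union>t. K \<inter> A t)" unfolding K_def by (rule span_mono)
    show "span (\<Union>t. K \<inter> A t) \<subseteq> K"
      by (rule span_minimal) (auto simp: K_def)
  qed
  moreover have "two_sided_ideal K"
    using left right by (auto simp: two_sided_ideal_def K_def)
  ultimately have "K = {0} \<or> K = UNIV"
    using simple by (simp add: graded_simple_def homogeneous_ideal_def)
  moreover have "K \<noteq> UNIV"
  proof
    assume "K = UNIV"
    obtain y where "\<psi> y = mat 1" using hom_surj by (metis surjD)
    then have "(mat 1 :: 'f^2^2) = 0" using ker[of y] \<open>K = UNIV\<close> by simp
    then have "(mat 1 :: 'f^2^2) $ 1 $ 1 = 0" by simp
    then show False by (simp add: mat_def)
  qed
  moreover have "x \<in> K" unfolding K_def using x by (intro span_base) auto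
  ultimately show ?thesis by blast
qed

lemma components_independent:
  assumes "finite S" "\<And>t. t \<in> S \<Longrightarrow> y t \<in> A t" "(\<Sum>t\<in>S. y t) = 0" "t \<in> S"
  shows "y t = 0"
proof -
  have "y t = - (\<Sum>s\<in>S - {t}. y s)"
    using assms(1,3,4) by (simp add: sum.remove eq_neg_iff_add_eq_0)
  also have "\<dots> \<in> span (\<Union>s\<in>UNIV - {t}. A s)"
    using assms(2) by (intro span_neg span_sum span_base) auto
  finally show ?thesis using components_direct[of t] assms(2,4) by blast
qed

text \<open>The band may be infinite, but nonzero vectors chosen from different components form an
  independent family.\<close>

lemma finite_nonzero_components:
  assumes finite_dim "\<And>t. t \<in> S \<Longrightarrow> A t \<noteq> {0}"
  shows "finite S"
proof -
  have "\<exists>x. x \<in> A t \<and> x \<noteq> 0" if "t \<in> S" for t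
    using assms(2)[OF that] subspace_0[OF subspace_component[of t]] by blast
  note ex = this
  define x where "x t = (SOME x. x \<in> A t \<and> x \<noteq> 0)" for t
  have x: "x t \<in> A t \<and> x t \<noteq> 0" if "t \<in> S" for t
    unfolding x_def by (rule someI_ex[OF ex[OF that]])
  have *: "\<forall>t\<in>R. c t = 0" if "finite R" "R \<subseteq> S" "(\<Sum>t\<in>R. scale (c t) (x t)) = 0" for R c
  proof
    fix t assume t: "t \<in> R"
    have "scale (c t) (x t) = 0"
    proof (rule components_independent[of R "\<lambda>t. scale (c t) (x t)" t])
      show "scale (c t) (x t) \<in> A t" if "t \<in> R" for t
        using x that \<open>R \<subseteq> S\<close> by (intro subspace_scale[OF subspace_component]) blast
    qed (use that t in auto)
    then show "c t = 0" using x t that(2) by auto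
  qed
  obtain B where "finite B" "span B = UNIV" using assms(1) by (auto simp: finite_dim_def)
  moreover have "inj_on x S" "independent (x ` S)"
    by (rule independent_family; rule *; assumption)+
  ultimately have "finite (x ` S)"
    using independent_span_bound[of B "x ` S"] by simp
  then show ?thesis using \<open>inj_on x S\<close> by (rule finite_imageD)
qed

text \<open>\<psi> is injective on every component, so each \<open>A t\<close> is a copy of its
  image, a left ideal. The classification of left ideals yields the frame: no column for the zero
  ideal, one for a line of covectors, both columns with parameter 0 for all matrices.\<close>

lemma m2_graded_exists:
  assumes rz: "\<And>s t :: 't. s * t = t" and fd: finite_dim and simple: graded_simple
    and hom: "M2_hom scale \<psi>"
  obtains Col p b where "m2_graded scale A \<psi> Col p b"
proof -
  interpret M2_hom scale \<psi> by fact
  have inj: "x = y" if "x \<in> A t" "y \<in> A t" "\<psi> x = \<psi> y" for x y t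
    using component_meets_kernel[OF rz simple hom, of "x - y" t] that
      subspace_diff[OF subspace_component] by (simp add: hom_diff)
  \<comment> \<open>The last clause lets the matrix entries in the columns \<open>C\<close> serve as
    coefficients of the frame vectors, which is what \<open>expand\<close> requires.\<close>
  define good where "good t C q \<beta> \<longleftrightarrow>
    (\<forall>r. \<forall>c\<in>C. \<beta> r c \<in> A t \<and> \<psi> (\<beta> r c) = outer (axis r 1) (frame_row q c)) \<and>
    (\<forall>x\<in>A t. \<forall>r j. \<psi> x $ r $ j = (\<Sum>c\<in>C. \<psi> x $ r $ c * frame_row q c $ j))"
    for t C q and \<beta> :: "2 \<Rightarrow> 2 \<Rightarrow> 'a"
  have good_intro: "\<exists>C q \<beta>. good t C q \<beta>"
    if basis: "\<And>r c. c \<in> C \<Longrightarrow> outer (axis r 1) (frame_row q c) \<in> \<psi> ` A t"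
      and coord: "\<And>x r j. x \<in> A t \<Longrightarrow> \<psi> x $ r $ j = (\<Sum>c\<in>C. \<psi> x $ r $ c * frame_row q c $ j)" for t C q
  proof -
    have ex: "\<exists>y. y \<in> A t \<and> \<psi> y = outer (axis r 1) (frame_row q c)" if "c \<in> C" for r c
      using basis[OF that, of r] by force
    define \<beta> where "\<beta> r c = (SOME y. y \<in> A t \<and> \<psi> y = outer (axis r 1) (frame_row q c))" for r c
    have "\<beta> r c \<in> A t \<and> \<psi> (\<beta> r c) = outer (axis r 1) (frame_row q c)" if "c \<in> C" for r c
      unfolding \<beta>_def by (rule someI_ex[OF ex[OF that]])
    then have "good t C q \<beta>" unfolding good_def by (intro conjI allI ballI coord) auto
    then show ?thesis by blast
  qed
  have "\<exists>C q \<beta>. good t C q \<beta>" for t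
  proof -
    have ne: "\<psi> ` A t \<noteq> {}" using subspace_0[OF subspace_component] by blast
    have add: "x + y \<in> \<psi> ` A t" if "x \<in> \<psi> ` A t" "y \<in> \<psi> ` A t" for x y
      using that subspace_add[OF subspace_component] by (auto simp flip: hom_add)
    have mult: "m ** y \<in> \<psi> ` A t" if y: "y \<in> \<psi> ` A t" for m y
    proof -
      obtain x where x: "y = \<psi> x" "x \<in> A t" using y by blast
      obtain z where z: "m = \<psi> z" using hom_surj by (rule surjE)
      have "m ** y = \<psi> (z * x)" by (simp add: x z hom_mult)
      then show ?thesis using mult_in_component[OF rz x(2), of z] by blast
    qed
    show ?thesis
    proof (rule left_ideal_cases[OF ne add mult])
      assume Y: "\<psi> ` A t = {0}"
      have "\<psi> x = 0" if "x \<in> A t" for x using Y that by blast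
      then show ?thesis by (intro good_intro[of "{}"]) auto
    next
      fix w assume w: "w \<noteq> 0" and Y: "\<psi> ` A t = range (\<lambda>u. outer u w)"
      have psi: "\<exists>u. \<psi> x = outer u w" if "x \<in> A t" for x using Y that by blast
      show ?thesis
      proof (cases "w $ 2 = 0")
        case True
        then have w1: "w $ 1 \<noteq> 0" using w by (auto simp: vec_eq_iff forall_2)
        have eq: "outer (axis r 1) (frame_row 0 1) = outer ((1 / w $ 1) *s axis r 1) w" for r
          using True w1 by (simp add: vec_eq_iff forall_2 frame_row_def)
        show ?thesis
        proof (rule good_intro[of "{1}" 0])
          show "outer (axis r 1) (frame_row 0 c) \<in> \<psi> ` A t" if "c \<in> {1}" for r c
            unfolding Y using that eq[of r] by (intro image_eqI[OF _ UNIV_I]) simp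
          fix x r j assume "x \<in> A t"
          then obtain u where "\<psi> x = outer u w" using psi by blast
          then show "\<psi> x $ r $ j = (\<Sum>c\<in>{1}. \<psi> x $ r $ c * frame_row 0 c $ j)"
            using True exhaust_2[of j] by (auto simp: frame_row_def)
        qed
      next
        case False
        \<comment> \<open>Scaling \<open>w\<close> to second coordinate 1 gives the
          parameter.\<close>
        have eq: "outer (axis r 1) (frame_row (w $ 1 / w $ 2) 2) = outer ((1 / w $ 2) *s axis r 1) w" for r
          using False by (simp add: vec_eq_iff forall_2 frame_row_def)
        show ?thesis
        proof (rule good_intro[of "{2}" "w $ 1 / w $ 2"])
          show "outer (axis r 1) (frame_row (w $ 1 / w $ 2) c) \<in> \<psi> ` A t" if "c \<in> {2}" for r c
            unfolding Y using that eq[of r] by (intro image_eqI[OF _ UNIV_I]) simp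
          fix x r j assume "x \<in> A t"
          then obtain u where "\<psi> x = outer u w" using psi by blast
          then show "\<psi> x $ r $ j = (\<Sum>c\<in>{2}. \<psi> x $ r $ c * frame_row (w $ 1 / w $ 2) c $ j)"
            using False exhaust_2[of j] by (auto simp: frame_row_def)
        qed
      qed
    next
      assume Y: "\<psi> ` A t = UNIV"
      show ?thesis
      proof (rule good_intro[of UNIV 0])
        show "outer (axis r 1) (frame_row 0 c) \<in> \<psi> ` A t" for r c using Y by simp
        show "\<psi> x $ r $ j = (\<Sum>c\<in>UNIV. \<psi> x $ r $ c * frame_row 0 c $ j)" for x r j
          using exhaust_2[of j] by (auto simp: sum_2 frame_row_def)
      qed
    qed
  qed
  then obtain Col p b where g: "\<And>t. good t (Col t) (p t) (b t)" by metis
  have b: "b t r c \<in> A t" "\<psi> (b t r c) = outer (axis r 1) (frame_row (p t) c)" if "c \<in> Col t" for t r c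
    using g that by (auto simp: good_def)
  have ent: "\<psi> x $ r $ j = (\<Sum>c\<in>Col t. \<psi> x $ r $ c * frame_row (p t) c $ j)" if "x \<in> A t" for x t r j
    using that by (rule conjunct2[OF g[of t, unfolded good_def], rule_format])
  have psi_sum: "\<psi> (\<Sum>i\<in>I. F i) = (\<Sum>i\<in>I. \<psi> (F i))" for I and F :: "2 \<Rightarrow> 'a"
    by (induction I rule: infinite_finite_induct) (auto simp: hom_add)
  have "m2_graded scale A \<psi> Col p b"
  proof
    fix t x assume x: "x \<in> A t"
    let ?y = "\<Sum>r\<in>UNIV. \<Sum>c\<in>Col t. scale (\<psi> x $ r $ c) (b t r c)"
    have "?y \<in> A t"
      using b by (intro subspace_sum[OF subspace_component] subspace_scale[OF subspace_component])
    moreover have "\<psi> x = \<psi> ?y"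
    proof -
      have "\<psi> ?y $ i $ j = (\<Sum>r\<in>UNIV. \<Sum>c\<in>Col t. \<psi> x $ r $ c * (axis r 1 $ i * frame_row (p t) c $ j))" for i j
        by (simp add: psi_sum hom_scale b)
      also have "\<dots> i j = \<psi> x $ i $ j" for i j
        using ent[OF x, of i j] exhaust_2[of i] by (auto simp: sum_2 axis_def)
      finally show ?thesis by (simp add: vec_eq_iff)
    qed
    ultimately show "x = ?y" using inj x by blast
  next
    have "A t \<noteq> {0}" if t: "t \<in> {t. Col t \<noteq> {}}" for t
    proof
      assume A0: "A t = {0}"
      obtain c where c: "c \<in> Col t" using t by blast
      have "outer (axis 1 1) (frame_row (p t) c) = (0 :: 'f^2^2)"
        using b[OF c, of 1] A0 by simp
      then have "outer (axis 1 1) (frame_row (p t) c) $ 1 $ c = (0 :: 'f)" by simp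
      then show False using exhaust_2[of c] by (auto simp: frame_row_def axis_def)
    qed
    then show "finite {t. Col t \<noteq> {}}" by (rule finite_nonzero_components[OF fd])
  qed (use b rz hom_add hom_scale hom_mult in auto)
  then show ?thesis by (rule that)
qed

end

section \<open>Growth of the codimensions\<close>

lemma sum_subset_2:
  fixes G :: "2 \<Rightarrow> 'b::comm_monoid_add"
  shows "(\<Sum>c\<in>C. G c) = (if 1 \<in> C then G 1 else 0) + (if 2 \<in> C then G 2 else 0)"
proof -
  have "(\<Sum>c\<in>C. G c) = (\<Sum>c\<in>UNIV. if c \<in> C then G c else 0)"
    by (simp add: sum.inter_restrict[symmetric])
  then show ?thesis by (simp add: sum_2)
qed

lemma subset_2_cases:
  fixes C :: "2 set"
  obtains "C = {}" | "C = {1}" | "C = {2}" | "C = UNIV"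
proof -
  have C: "x \<in> C \<longleftrightarrow> x = 1 \<and> 1 \<in> C \<or> x = 2 \<and> 2 \<in> C" for x
    using exhaust_2[of x] by auto
  show ?thesis
  proof (cases "1 \<in> C"; cases "2 \<in> C")
    assume "1 \<in> C" "2 \<in> C"
    then have "C = UNIV" using exhaust_2 C by blast
    then show ?thesis by (rule that(4))
  next
    assume "1 \<in> C" "2 \<notin> C"
    then have "C = {1}" using C by blast
    then show ?thesis by (rule that(2))
  next
    assume "1 \<notin> C" "2 \<in> C"
    then have "C = {2}" using C by blast
    then show ?thesis by (rule that(3))
  next
    assume "1 \<notin> C" "2 \<notin> C"
    then have "C = {}" using C by blast
    then show ?thesis by (rule that(1))
  qed
qed

lemma UNIV_2_neq_singleton: "UNIV \<noteq> {c}" for c :: 2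
proof
  assume "UNIV = {c}"
  then have "CARD(2) = card {c}" by simp
  then show False by simp
qed

lemma mem_2_iff:
  fixes C :: "2 set"
  shows "1 \<in> C \<longleftrightarrow> C = {1} \<or> C = UNIV"
    and "2 \<in> C \<longleftrightarrow> card C = 1 \<and> C \<noteq> {1} \<or> C = UNIV"
  using UNIV_2_neq_singleton by (cases rule: subset_2_cases[of C]; force)+

lemma frame_row_independent:
  assumes "\<And>j. (\<Sum>c\<in>C. k c * frame_row q c $ j) = 0" "c \<in> C"
  shows "k c = 0"
  using assms(1)[of 1] assms(1)[of 2] assms(2) exhaust_2[of c]
  by (auto simp: sum_subset_2 frame_row_def split: if_splits)

section \<open>Images and dimensions in coordinates\<close>

context m2_graded
begin

lemma psi_sum: "\<psi> (\<Sum>i\<in>I. F i) = (\<Sum>i\<in>I. \<psi> (F i))"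
  by (induction I rule: infinite_finite_induct) (auto simp: psi_add)

lemma psi_comb:
  "\<psi> (\<Sum>r\<in>UNIV. \<Sum>c\<in>Col t. scale (k r c) (b t r c)) $ i $ j
    = (\<Sum>c\<in>Col t. k i c * frame_row (p t) c $ j)"
proof -
  have "\<psi> (\<Sum>r\<in>UNIV. \<Sum>c\<in>Col t. scale (k r c) (b t r c)) $ i $ j
      = (\<Sum>r\<in>UNIV. \<Sum>c\<in>Col t. k r c * (axis r 1 $ i * frame_row (p t) c $ j))"
    by (simp add: psi_sum psi_scale psi_b)
  then show ?thesis using exhaust_2[of i] by (auto simp: sum_2 axis_def)
qed

lemma psi_entry: "x \<in> A t \<Longrightarrow> \<psi> x $ i $ j = (\<Sum>c\<in>Col t. \<psi> x $ i $ c * frame_row (p t) c $ j)"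
  using psi_comb[where k = "\<lambda>r c. \<psi> x $ r $ c" and t = t and i = i and j = j] expand[of x t] by simp

lemma comb_in: "(\<Sum>r\<in>UNIV. \<Sum>c\<in>Col t. scale (k r c) (b t r c)) \<in> A t"
  by (intro subspace_sum subspace_scale subspace_component b_in)

text \<open>Describes the image by equations in \<open>Col t\<close> and \<open>p t\<close> alone,
  so that images of different components become comparable.\<close>

lemma psi_image:
  "\<psi> ` A t = {m. \<forall>i j. m $ i $ j = (\<Sum>c\<in>Col t. m $ i $ c * frame_row (p t) c $ j)}"
proof (intro set_eqI iffI)
  fix m :: "'f^2^2"
  assume "m \<in> {m. \<forall>i j. m $ i $ j = (\<Sum>c\<in>Col t. m $ i $ c * frame_row (p t) c $ j)}"
  then have m: "m $ i $ j = (\<Sum>c\<in>Col t. m $ i $ c * frame_row (p t) c $ j)" for i j by blast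
  let ?x = "\<Sum>r\<in>UNIV. \<Sum>c\<in>Col t. scale (m $ r $ c) (b t r c)"
  have "\<psi> ?x = m"
  proof -
    have "\<psi> ?x $ i $ j = m $ i $ j" for i j
      unfolding psi_comb by (rule m[symmetric])
    then show ?thesis by (simp add: vec_eq_iff)
  qed
  then show "m \<in> \<psi> ` A t" by (intro image_eqI[OF _ comb_in]) (rule sym)
next
  fix m assume "m \<in> \<psi> ` A t"
  then show "m \<in> {m. \<forall>i j. m $ i $ j = (\<Sum>c\<in>Col t. m $ i $ c * frame_row (p t) c $ j)}"
    using psi_entry by blast
qed

text \<open>Independence even modulo the kernel of \<psi>, which serves both the quotients of the
  components and the whole algebra. Extending the coefficients by 0 reduces to the full double
  sum.\<close>

lemma b_family:
  assumes S: "S \<subseteq> UNIV \<times> Col t" "\<psi> (\<Sum>(r, c)\<in>S. scale (k (r, c)) (b t r c)) = 0" and i: "i \<in> S"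
  shows "k i = 0"
proof -
  define k' where "k' r c = (if (r, c) \<in> S then k (r, c) else 0)" for r c
  have "(\<Sum>(r, c)\<in>S. scale (k (r, c)) (b t r c)) = (\<Sum>(r, c)\<in>UNIV \<times> Col t. scale (k' r c) (b t r c))"
    using S(1) by (intro sum.mono_neutral_cong_left) (auto simp: k'_def)
  also have "\<dots> = (\<Sum>r\<in>UNIV. \<Sum>c\<in>Col t. scale (k' r c) (b t r c))"
    by (simp add: sum.cartesian_product)
  finally have *: "\<psi> (\<Sum>r\<in>UNIV. \<Sum>c\<in>Col t. scale (k' r c) (b t r c)) = 0" using S(2) by simp
  obtain r c where rc: "i = (r, c)" by (cases i)
  have "(\<Sum>c\<in>Col t. k' r c * frame_row (p t) c $ j) = 0" for j
    using * psi_comb[where k = k' and t = t and i = r and j = j] by simp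
  then have "k' r c = 0" using S(1) i rc by (intro frame_row_independent[where C = "Col t" and k = "k' r" and q = "p t"]) auto
  then show ?thesis using i by (simp add: k'_def rc)
qed

text \<open>The basis of \<open>A t\<close> is at the same time a coset basis, since
  \<open>A t\<close> meets the kernel only in 0.\<close>

lemma quot_dim_component: "quot_dim scale (A t) {x. \<psi> x = 0} = 2 * card (Col t)"
proof -
  let ?J = "{x. \<psi> x = 0}" and ?D = "UNIV \<times> Col t" and ?g = "\<lambda>(r, c). b t r c"
  have J: "subspace ?J"
    by (auto simp: subspace_def psi_add vec_eq_iff psi_scale)
  have fam: "\<forall>i\<in>S. k i = 0" if "finite S" "S \<subseteq> ?D" "(\<Sum>i\<in>S. scale (k i) (?g i)) = 0" for S k
    using b_family[OF that(2), where k = k] that(3) by (auto simp: case_prod_unfold)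
  have inj: "inj_on ?g ?D" and ind: "independent (?g ` ?D)"
    by (rule independent_family; rule fam; assumption)+
  have gA: "?g ` ?D \<subseteq> A t" using b_in by auto
  have fin: "finite (?g ` ?D)" by simp
  have "coset_basis scale (?g ` ?D) (A t) ?J"
    unfolding coset_basis_def
  proof (intro conjI allI impI ballI gA)
    fix S c v assume S: "finite S" "S \<subseteq> ?g ` ?D" "(\<Sum>v\<in>S. scale (c v) v) \<in> ?J" and v: "v \<in> S"
    have "(\<Sum>v\<in>S. scale (c v) v) \<in> A t"
      using S(2) gA by (intro subspace_sum subspace_scale subspace_component) auto
    then have "(\<Sum>v\<in>S. scale (c v) v) = 0"
      using S(3) subspace_0[OF subspace_component] by (intro psi_inject[of _ t 0]) auto
    then show "c v = 0" using independentD[OF ind S(1,2)] v by blast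
  next
    fix u assume u: "u \<in> A t"
    have "u = (\<Sum>i\<in>?D. scale (case i of (r, c) \<Rightarrow> \<psi> u $ r $ c) (?g i))"
      using expand[OF u] by (simp add: sum.cartesian_product case_prod_unfold)
    also have "\<dots> \<in> span (?g ` ?D)" by (intro span_sum span_scale span_base imageI)
    finally have "u \<in> span (?g ` ?D)" .
    then obtain c where "u = (\<Sum>v\<in>?g ` ?D. scale (c v) v)"
      using span_finite[OF fin] by auto
    then show "\<exists>S c. finite S \<and> S \<subseteq> ?g ` ?D \<and> u +o ?J = (\<Sum>v\<in>S. scale (c v) v) +o ?J"
      using fin by blast
  qed
  then have "quot_dim scale (A t) ?J = card (?g ` ?D)"
    by (rule quot_dim_eq_card[OF J _ fin])
  then show ?thesis using inj by (simp add: card_image card_cartesian_product)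
qed

text \<open>A relation among the basis vectors splits along the direct sum of the components, and in
  each of them \<open>b_family\<close> applies.\<close>

lemma dim_eq_card_slots: "dim UNIV = card slots"
proof -
  let ?g = "\<lambda>(t, r, c). b t r c"
  have fam: "\<forall>i\<in>S. k i = 0" if S: "finite S" "S \<subseteq> slots" "(\<Sum>i\<in>S. scale (k i) (?g i)) = 0" for S k
  proof
    let ?R = "\<lambda>t. {i. (t, i) \<in> S}"
    let ?y = "\<lambda>t. \<Sum>(r, c)\<in>?R t. scale (k (t, r, c)) (b t r c)"
    fix i assume i: "i \<in> S"
    obtain t r c where trc: "i = (t, r, c)" by (cases i)
    have finR: "finite (?R t)" for t
      using S(1) by (rule finite_surj[of _ _ snd]) force
    have R: "?R t \<subseteq> UNIV \<times> Col t" for t using S(2) by (auto simp: slots_iff)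
    have "S = Sigma (fst ` S) ?R" by force
    then have "(\<Sum>i\<in>S. scale (k i) (?g i)) = (\<Sum>i\<in>Sigma (fst ` S) ?R. scale (k i) (?g i))" by simp
    also have "\<dots> = (\<Sum>t\<in>fst ` S. ?y t)"
      using S(1) finR by (subst sum.Sigma) (auto simp: case_prod_unfold)
    finally have "(\<Sum>t\<in>fst ` S. ?y t) = 0" using S(3) by simp
    moreover have "?y t \<in> A t" for t
      using R[of t] b_in by (intro subspace_sum subspace_component)
        (auto intro!: subspace_scale[OF subspace_component])
    ultimately have "?y t = 0"
      using S(1) i trc by (intro components_independent[of "fst ` S" ?y t]) force+
    then have "(\<lambda>i. k (t, i)) (r, c) = 0"
      using i trc by (intro b_family[OF R, where k = "\<lambda>i. k (t, i)" and i = "(r, c)"]) (auto simp: case_prod_unfold)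
    then show "k i = 0" by (simp add: trc)
  qed
  have inj: "inj_on ?g slots" and ind: "independent (?g ` slots)"
    by (rule independent_family; rule fam; assumption)+
  have "A t \<subseteq> span (?g ` slots)" for t
  proof
    fix x assume "x \<in> A t"
    moreover have "b t r c \<in> span (?g ` slots)" if "c \<in> Col t" for r c
      using that by (intro span_base image_eqI[of _ _ "(t, r, c)"]) (auto simp: slots_iff)
    then have "(\<Sum>r\<in>UNIV. \<Sum>c\<in>Col t. scale (\<psi> x $ r $ c) (b t r c)) \<in> span (?g ` slots)"
      by (intro span_sum span_scale)
    ultimately show "x \<in> span (?g ` slots)" using expand[of x t] by simp
  qed
  then have "span (\<Union>t. A t) \<subseteq> span (?g ` slots)" by (intro span_minimal) auto
  then have "UNIV \<subseteq> span (?g ` slots)" using span_components by simp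
  then have "dim UNIV = card (?g ` slots)" by (intro dim_unique[OF _ _ ind refl]) auto
  then show ?thesis using inj by (simp add: card_image)
qed

lemma card_slots: "card slots = 2 * (card {t. 1 \<in> Col t} + card {t. 2 \<in> Col t})"
proof -
  have "real (card slots) = real (2 * (card {t. 1 \<in> Col t} + card {t. 2 \<in> Col t}))"
    using sum_slots[of "\<lambda>_ _. 1"] by (simp add: case_prod_unfold)
  then show ?thesis by (simp only: of_nat_eq_iff)
qed

lemma finite_Col: "finite {t. c \<in> Col t}"
  by (rule finite_subset[OF _ finite_support]) auto

text \<open>Without column 2 the entry (1,2) of \<psi> would vanish on all components, hence
  everywhere. This provides the positivity of \<open>N\<close>, by whose root
  \<open>codim_growth\<close> divides.\<close>

lemma card_Col_2_pos:
  assumes "surj \<psi>"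
  shows "card {t. 2 \<in> Col t} > 0"
proof (rule ccontr)
  assume "\<not> ?thesis"
  then have "{t. 2 \<in> Col t} = {}" using finite_Col by simp
  then have no2: "2 \<notin> Col t" for t by blast
  have "\<psi> x $ 1 $ 2 = 0" for x
  proof -
    have "x \<in> span (\<Union>t. A t)" using span_components by simp
    then show ?thesis
    proof (induction rule: span_induct_alt)
      case (step c x y)
      then obtain t where "x \<in> A t" by blast
      then have "\<psi> x $ 1 $ 2 = 0"
        using psi_entry[of x t 1 2] no2[of t] by (simp add: sum_subset_2 frame_row_def)
      then show ?case using step by (simp add: psi_add psi_scale)
    qed simp
  qed
  moreover obtain x where "\<psi> x = outer (axis 1 1) (axis 2 1)" using assms by (metis surjD)
  moreover have "outer (axis 1 1) (axis 2 1) $ 1 $ 2 = (1 :: 'f)" by (simp add: axis_def)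
  ultimately show False by (metis zero_neq_one)
qed

lemma psi_image_UNIV_iff: "\<psi> ` A t = UNIV \<longleftrightarrow> Col t = UNIV"
proof
  assume U: "\<psi> ` A t = UNIV"
  have "c \<in> Col t" for c
  proof (rule ccontr)
    assume c: "c \<notin> Col t"
    have "outer (axis 1 1) (axis c 1) \<in> \<psi> ` A t" using U by simp
    then have "outer (axis 1 1) (axis c 1) $ 1 $ c =
        (\<Sum>c'\<in>Col t. outer (axis 1 1) (axis c 1) $ 1 $ c' * frame_row (p t) c' $ c)"
      unfolding psi_image by blast
    also have "\<dots> = 0" using c by (intro sum.neutral) (auto simp: axis_def)
    finally show False by (simp add: axis_def)
  qed
  then show "Col t = UNIV" by blast
next
  assume U: "Col t = UNIV"
  \<comment> \<open>The entry (1,1) of the image of \<open>b t 1 2\<close> is \<open>p t\<close>,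
    and by \<open>psi_entry\<close> it is also \<open>2 * p t\<close>.\<close>
  have "(2 :: 'f) \<noteq> 1" by (metis add_cancel_right_left one_add_one zero_neq_one)
  then have "p t = 0"
    using psi_entry[OF b_in[of 2 t 1], of 1 1] U by (simp add: psi_b sum_2 frame_row_def axis_def)
  then have "m \<in> \<psi> ` A t" for m
    unfolding psi_image using U exhaust_2 by (auto simp: sum_2 frame_row_def)
  then show "\<psi> ` A t = UNIV" by blast
qed

text \<open>If 1 is the only column, the frame vector is e1 whatever \<open>p\<close> is, so all
  these components share one image. A component with column 2 contains an element with entry 1 at
  (1,2).\<close>

lemma psi_image_eq_iff:
  assumes "Col s = {1}" "card (Col t) = 1"
  shows "\<psi> ` A t = \<psi> ` A s \<longleftrightarrow> Col t = {1}"
proof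
  assume eq: "\<psi> ` A t = \<psi> ` A s"
  show "Col t = {1}"
  proof (cases rule: subset_2_cases[of "Col t"])
    case 3
    then obtain x where "x \<in> A s" "\<psi> (b t 1 2) = \<psi> x" using b_in[of 2 t 1] eq by blast
    then have "\<psi> (b t 1 2) $ 1 $ 2 = 0"
      using psi_entry[of x s 1 2] assms(1) by (simp add: frame_row_def)
    then show ?thesis using 3 by (simp add: psi_b frame_row_def axis_def)
  qed (use assms(2) in auto)
next
  assume "Col t = {1}"
  then show "\<psi> ` A t = \<psi> ` A s"
    unfolding psi_image using assms(1) by (simp add: frame_row_def)
qed

text \<open>For the lower bound, \<open>codim_lower\<close> controls the squares of the summands in the binomial
  expansion of \<open>(sqrt M + sqrt N) ^ n\<close>; as \<open>N \<le> M\<close>, those with \<open>2 l > n\<close> are dominated by the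
  symmetric ones.\<close>

lemma codim_growth:
  fixes M N :: nat
  assumes M: "M = card {t. 1 \<in> Col t}" and N: "N = card {t. 2 \<in> Col t}" and MN: "N \<le> M" "N > 0"
  defines "L \<equiv> (sqrt M + sqrt N)\<^sup>2"
  shows "(\<lambda>n. root n (real (graded_codim n))) \<longlonglongrightarrow> L"
proof -
  define s r where "s = sqrt M" and "r = sqrt N"
  have s: "s \<ge> 1" "s\<^sup>2 = M" and r: "r \<ge> 1" "r\<^sup>2 = N" and rs: "r \<le> s"
    using MN by (simp_all add: s_def r_def)
  have L: "L = (s + r)\<^sup>2" "L \<ge> 1"
  proof -
    show "L = (s + r)\<^sup>2" by (simp add: L_def s_def r_def)
    have "1 \<le> s + r" using s r by linarith
    then show "L \<ge> 1" unfolding \<open>L = (s + r)\<^sup>2\<close> by (rule one_le_power)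
  qed
  define K where "K = s / r * real (card slots)"
  have upper: "real (graded_codim n) \<le> K * L ^ n" if "n \<ge> 1" for n
  proof -
    have "s / r \<ge> 1" using rs r by simp
    \<comment> \<open>For \<open>z = s / r\<close> the second factor is
      \<open>s * r + r\<^sup>2\<close>, so the base of the power becomes
      \<open>(s + r)\<^sup>2\<close>; the condition \<open>z \<ge> 1\<close> amounts to
      \<open>N \<le> M\<close>.\<close>
    moreover have "(1 + s / r) * (M / (s / r) + N) = L"
    proof -
      have "s \<noteq> 0" "r \<noteq> 0" using s(1) r(1) by auto
      then show ?thesis
        unfolding L(1) s(2)[symmetric] r(2)[symmetric] by (simp add: field_simps power2_eq_square)
    qed
    ultimately show ?thesis
      using codim_upper[OF that, of "s / r"] unfolding M[symmetric] N[symmetric] K_def by simp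
  qed
  have K: "K \<ge> 1"
  proof -
    have "card slots \<ge> 1" unfolding card_slots using N MN(2) by simp
    then show ?thesis using mult_mono[of 1 "s / r" 1 "real (card slots)"] rs r unfolding K_def by simp
  qed
  obtain t0 where t0: "1 \<in> Col t0"
    using M MN by (metis (mono_tags, lifting) card_eq_0_iff empty_Collect_eq le_zero_eq less_numeral_extra(3))
  \<comment> \<open>One factor \<open>n + 1\<close> comes from
    \<open>binomial_le_card_ballot\<close>, another from the number of terms of the binomial
    expansion; squaring makes the fourth power.\<close>
  have lower: "L ^ n \<le> real (n + 1) ^ 4 * real (graded_codim (n + 2))" for n
  proof -
    let ?c = "real (graded_codim (n + 2))"
    let ?a = "\<lambda>l. real (n choose l) * r ^ l * s ^ (n - l)"
    have half: "?a l \<le> real (n + 1) * sqrt ?c" if l: "2 * l \<le> n" for l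
    proof -
      let ?B = "real (card (ballot n l))"
      have "real (n choose l) \<le> real (n + 1) * ?B"
        using binomial_le_card_ballot[OF l] by (metis Suc_eq_plus1 of_nat_le_iff of_nat_mult)
      then have "?a l \<le> real (n + 1) * ?B * r ^ l * s ^ (n - l)"
        using r s by (intro mult_right_mono) auto
      also have "\<dots> = real (n + 1) * (?B * r ^ l * s ^ (n - l))" by simp
      also have "?B * r ^ l * s ^ (n - l) \<le> sqrt ?c"
      proof (rule real_le_rsqrt)
        have "(?B * r ^ l * s ^ (n - l))\<^sup>2 = ?B\<^sup>2 * ((r\<^sup>2) ^ l * (s\<^sup>2) ^ (n - l))"
          by (simp add: power_mult_distrib power_mult[symmetric] mult.commute)
        also have "\<dots> = real ((card (ballot n l))\<^sup>2 * (N ^ l * M ^ (n - l)))"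
          by (simp add: s(2) r(2))
        also have "\<dots> \<le> ?c"
          using codim_lower[OF t0 l] unfolding M[symmetric] N[symmetric] by (simp only: of_nat_le_iff)
        finally show "(?B * r ^ l * s ^ (n - l))\<^sup>2 \<le> ?c" .
      qed
      finally show ?thesis by simp
    qed
    have all: "?a l \<le> real (n + 1) * sqrt ?c" if l: "l \<le> n" for l
    proof (cases "2 * l \<le> n")
      case False
      define d where "d = l - (n - l)"
      have d: "l = (n - l) + d" using False l by (simp add: d_def)
      have "r ^ l * s ^ (n - l) = (r * s) ^ (n - l) * r ^ d"
        by (subst d) (simp add: power_add power_mult_distrib)
      also have "\<dots> \<le> (r * s) ^ (n - l) * s ^ d"
        using r s rs by (intro mult_left_mono power_mono) auto
      also have "\<dots> = r ^ (n - l) * s ^ l"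
        by (subst (3) d) (simp add: power_add power_mult_distrib)
      finally have "?a l \<le> ?a (n - l)"
        using l by (simp add: binomial_symmetric[symmetric] mult.assoc mult_left_mono)
      also have "\<dots> \<le> real (n + 1) * sqrt ?c" using False by (intro half) simp
      finally show ?thesis .
    qed (rule half)
    have "(s + r) ^ n = (\<Sum>l\<le>n. ?a l)"
      using binomial_ring[of r s n] by (simp add: add.commute)
    also have "\<dots> \<le> (\<Sum>l\<le>n. real (n + 1) * sqrt ?c)" using all by (intro sum_mono) simp
    also have "\<dots> = real (n + 1) ^ 2 * sqrt ?c" by (simp add: power2_eq_square)
    finally have "((s + r) ^ n)\<^sup>2 \<le> (real (n + 1) ^ 2 * sqrt ?c)\<^sup>2"
      using s r by (intro power_mono) auto
    moreover have "((s + r) ^ n)\<^sup>2 = L ^ n" by (simp add: L(1) power_mult[symmetric] mult.commute)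
    ultimately show ?thesis by (simp add: power_mult_distrib)
  qed
  \<comment> \<open>Passing from \<open>n + 2\<close> variables back to \<open>n\<close> costs the
    constant \<open>L\<^sup>2\<close>, whose roots tend to 1.\<close>
  have lower': "L ^ n / (L\<^sup>2 * real n ^ 4) \<le> real (graded_codim n)" if n: "n \<ge> 2" for n
  proof -
    obtain m where m: "n = m + 2" using n by (metis le_add_diff_inverse2)
    have "L ^ n = L\<^sup>2 * L ^ m" by (simp add: m power_add power2_eq_square)
    also have "\<dots> \<le> L\<^sup>2 * (real (m + 1) ^ 4 * real (graded_codim n))"
      using lower[of m] L(2) by (intro mult_left_mono) (simp_all add: m)
    also have "\<dots> \<le> L\<^sup>2 * (real n ^ 4 * real (graded_codim n))"
      by (intro mult_left_mono mult_right_mono power_mono) (simp_all add: m)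
    finally show ?thesis using L(2) n by (simp add: divide_le_eq algebra_simps)
  qed
  have root_pow: "root n (L ^ n) = L" if "n \<ge> 2" for n
    using that L(2) by (simp add: real_root_power_cancel)
  show ?thesis
  proof (rule tendsto_sandwich)
    have "(\<lambda>n. L / (root n (L\<^sup>2) * root n n ^ 4)) \<longlonglongrightarrow> L / (1 * 1 ^ 4)"
      using L(2) by (intro tendsto_intros LIMSEQ_root LIMSEQ_root_const) auto
    then show "(\<lambda>n. L / (root n (L\<^sup>2) * root n n ^ 4)) \<longlonglongrightarrow> L" by simp
    have "(\<lambda>n. root n K * L) \<longlonglongrightarrow> 1 * L"
      using K by (intro tendsto_intros LIMSEQ_root_const) auto
    then show "(\<lambda>n. root n K * L) \<longlonglongrightarrow> L" by simp
    show "\<forall>\<^sub>F n in sequentially. L / (root n (L\<^sup>2) * root n n ^ 4) \<le> root n (real (graded_codim n))"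
      using eventually_ge_at_top[of 2]
    proof eventually_elim
      case (elim n)
      have "root n (L ^ n / (L\<^sup>2 * real n ^ 4)) \<le> root n (real (graded_codim n))"
        using elim by (intro real_root_le_mono lower') auto
      then show ?case
        using elim root_pow[OF elim]
        by (simp add: real_root_divide real_root_mult real_root_power)
    qed
    show "\<forall>\<^sub>F n in sequentially. root n (real (graded_codim n)) \<le> root n K * L"
      using eventually_ge_at_top[of 2]
    proof eventually_elim
      case (elim n)
      have "root n (real (graded_codim n)) \<le> root n (K * L ^ n)"
        using elim by (intro real_root_le_mono upper) auto
      then show ?case using elim root_pow[OF elim] by (simp add: real_root_mult)
    qed
  qed
qed

end

section \<open>Identification of the classes and conclusion\<close>

lemma (in M2_hom) coset_kernel: "x +o {x. \<psi> x = 0} = \<psi> -` {\<psi> x}"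
proof (intro set_eqI iffI)
  fix y assume "y \<in> \<psi> -` {\<psi> x}"
  then have "y - x \<in> {x. \<psi> x = 0}" by (simp add: hom_diff)
  moreover have "y = x + (y - x)" by simp
  ultimately show "y \<in> x +o {x. \<psi> x = 0}" unfolding elt_set_plus_def by blast
qed (auto simp: elt_set_plus_def hom_add)

text \<open>Cosets of the kernel are fibres of \<psi>, and fibres over distinct matrices are
  distinct because \<psi> is onto. So images in the quotient may be compared as sets of
  matrices.\<close>

lemma (in M2_hom) coset_image_eq_iff:
  "(\<lambda>x. x +o {x. \<psi> x = 0}) ` U = (\<lambda>x. x +o {x. \<psi> x = 0}) ` V \<longleftrightarrow> \<psi> ` U = \<psi> ` V"
proof -
  have "inj (\<lambda>m. \<psi> -` {m})"
  proof (rule injI)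
    fix m m' assume eq: "\<psi> -` {m} = \<psi> -` {m'}"
    obtain x where "m = \<psi> x" using hom_surj by (rule surjE)
    then have "x \<in> \<psi> -` {m'}" using eq by blast
    then show "m = m'" using \<open>m = \<psi> x\<close> by simp
  qed
  moreover have "(\<lambda>x. x +o {x. \<psi> x = 0}) ` W = (\<lambda>m. \<psi> -` {m}) ` \<psi> ` W" for W
    by (simp add: image_image coset_kernel)
  ultimately show ?thesis by (simp add: inj_image_eq_iff)
qed

text \<open>Conjugating the quotient map, we may assume that a given two-dimensional component maps onto
  the matrices supported in the first column.\<close>

lemma (in graded_algebra) adapted_frame:
  assumes rz: "\<And>s t :: 't. s * t = t" and fd: finite_dim and simple: graded_simple
    and J: "subspace J" "quotient_iso_M2 J" and t0: "quot_dim scale (A t0) J = 2"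
  obtains \<psi> Col p b where "M2_hom scale \<psi>" "m2_graded scale A \<psi> Col p b"
    "J = {x. \<psi> x = 0}" "Col t0 = {1}"
proof -
  obtain \<psi> where hom: "M2_hom scale \<psi>" and ker: "\<And>x. \<psi> x = 0 \<longleftrightarrow> x \<in> J"
    using quotient_iso_M2_hom[OF J] by blast
  interpret h: M2_hom scale \<psi> by fact
  obtain Col p b where "m2_graded scale A \<psi> Col p b"
    using m2_graded_exists[OF rz fd simple hom] by blast
  then interpret g: m2_graded scale A \<psi> Col p b .
  have J_eq: "J = {x. \<psi> x = 0}" using ker by blast
  \<comment> \<open>The first choice of coordinates only serves to find the covector of
    \<open>A t0\<close>. Conjugation moves it to e1, and new coordinates are then chosen for the
    conjugated map.\<close>
  have "card (Col t0) = 1" using g.quot_dim_component[of t0] t0 by (simp add: J_eq)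
  then obtain c where c: "Col t0 = {c}" by (rule card_1_singletonE)
  let ?w = "frame_row (p t0) c"
  have "?w $ c \<noteq> 0" using exhaust_2[of c] by (auto simp: frame_row_def)
  then have "?w \<noteq> 0" by auto
  then obtain Q Q' :: "'f^2^2" where Q: "Q ** Q' = mat 1" "Q' ** Q = mat 1"
    and conj: "\<And>u. \<exists>u'. Q ** outer u ?w ** Q' = outer u' (axis 1 1)"
    by (rule conjugate_to_axis) blast
  let ?\<psi> = "\<lambda>x. Q ** \<psi> x ** Q'"
  have hom': "M2_hom scale ?\<psi>" using Q by (rule h.conjugate)
  obtain Col' p' b' where "m2_graded scale A ?\<psi> Col' p' b'"
    using m2_graded_exists[OF rz fd simple hom'] by blast
  then interpret g': m2_graded scale A ?\<psi> Col' p' b' .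
  have J_eq': "J = {x. ?\<psi> x = 0}"
  proof -
    have "\<psi> x = Q' ** ?\<psi> x ** Q" for x
    proof -
      have "Q' ** ?\<psi> x ** Q = (Q' ** Q) ** \<psi> x ** (Q' ** Q)" by (simp only: matrix_mul_assoc)
      then show ?thesis using Q(2) by simp
    qed
    moreover have "(0 :: 'f^2^2) = Q' ** 0 ** Q" "(0 :: 'f^2^2) = Q ** 0 ** Q'"
      by (simp_all add: vec_eq_iff matrix_matrix_mult_def)
    ultimately have "\<psi> x = 0 \<longleftrightarrow> ?\<psi> x = 0" for x by metis
    then show ?thesis unfolding J_eq by blast
  qed
  have "card (Col' t0) = 1" using g'.quot_dim_component[of t0] t0 by (simp add: J_eq')
  \<comment> \<open>A basis vector of column 2 would have entry 1 at (1,2), where the conjugated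
    image of \<open>A t0\<close> is 0.\<close>
  moreover have "2 \<notin> Col' t0"
  proof
    assume 2: "2 \<in> Col' t0"
    let ?x = "b' t0 1 2"
    have entry: "\<psi> ?x $ i $ j = \<psi> ?x $ i $ c * ?w $ j" for i j
      using g.psi_entry[OF g'.b_in[OF 2, of 1], of i j] c by simp
    have "\<psi> ?x = outer (\<chi> i. \<psi> ?x $ i $ c) ?w"
      unfolding vec_eq_iff outer_nth vec_lambda_beta by (intro allI entry)
    then obtain u where "?\<psi> ?x = outer u (axis 1 1)" using conj by metis
    then have "?\<psi> ?x $ 1 $ 2 = 0" by (simp add: axis_def)
    then show False using g'.psi_b[OF 2, of 1] by (simp add: axis_def frame_row_def)
  qed
  ultimately have "Col' t0 = {1}"
    by (cases rule: subset_2_cases[of "Col' t0"]) auto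
  then show ?thesis
    using that hom' g'.m2_graded_axioms J_eq' by blast
qed

theorem theorem11p5:
  fixes scale :: "'f::field_char_0 \<Rightarrow> 'a::ring \<Rightarrow> 'a"
    and A :: "'t::semigroup_mult \<Rightarrow> 'a set"
    and J :: "'a set"
    and \<pi> :: "'a \<Rightarrow> 'a set"
    and I :: "'t \<Rightarrow> 'a set set"
    and T0 T1 t0_class :: "'t set"
    and sim :: "('t \<times> 't) set"
  assumes right_zero_band: "\<forall>s t :: 't. s * t = t"
    and "graded_algebra scale A"
    and "assoc_algebra.finite_dim scale"
    and "graded_algebra.graded_simple scale A"
    and "J = assoc_algebra.jacobson_radical scale"
    and "assoc_algebra.quotient_iso_M2 scale J"
    and "\<pi> = (\<lambda>a. a +o J)"
    and "I = (\<lambda>t. \<pi> ` A t)"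
    and "T0 = {t. quot_dim scale (A t) J = 2}"
    and "T1 = {t. I t = cosets UNIV J}"
    and "sim = {(t1, t2). t1 \<in> T0 \<and> t2 \<in> T0 \<and> I t1 = I t2}"
    and "t0_class \<in> T0 // sim"
    and "real (card t0_class) > real (card T0) / 2"
  shows "((\<lambda>n. root n (real (graded_algebra.graded_codim scale A n)))
           \<longlonglongrightarrow> real (card T0) + 2 * real (card T1)
             + 2 * sqrt ((real (card T1) + real (card t0_class))
                  * (real (card T0) + real (card T1) - real (card t0_class))))
         \<and> real (card T0) + 2 * real (card T1)
           + 2 * sqrt ((real (card T1) + real (card t0_class))
                * (real (card T0) + real (card T1) - real (card t0_class)))
         < 2 * real (card T0) + 4 * real (card T1)
         \<and> 2 * card T0 + 4 * card T1 = vector_space.dim scale (UNIV :: 'a set)"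
proof -
  interpret graded_algebra scale A by fact
  obtain t0 where t0: "t0 \<in> T0" and cls: "t0_class = sim `` {t0}"
    using assms(12) by (rule quotientE)
  have "subspace J" using assms(5) subspace_jacobson_radical by simp
  moreover have "quot_dim scale (A t0) J = 2" using t0 assms(9) by simp
  ultimately obtain \<psi> Col p b where hom: "M2_hom scale \<psi>" and gr: "m2_graded scale A \<psi> Col p b"
    and J: "J = {x. \<psi> x = 0}" and Col0: "Col t0 = {1}"
    using adapted_frame[OF _ assms(3,4) _ assms(6)] right_zero_band by blast
  interpret h: M2_hom scale \<psi> by (rule hom)
  interpret g: m2_graded scale A \<psi> Col p b by (rule gr)
  have T0: "T0 = {t. card (Col t) = 1}"
    using g.quot_dim_component by (simp add: assms(9) J)
  have I_eq: "I s = I t \<longleftrightarrow> \<psi> ` A s = \<psi> ` A t" for s t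
    unfolding assms(7,8) J by (rule h.coset_image_eq_iff)
  have "I t = cosets UNIV J \<longleftrightarrow> \<psi> ` A t = UNIV" for t
    using h.coset_image_eq_iff[of "A t" UNIV] h.hom_surj unfolding assms(7,8) J cosets_def by simp
  then have T1: "T1 = {t. Col t = UNIV}" by (simp add: assms(10) g.psi_image_UNIV_iff)
  have "t \<in> t0_class \<longleftrightarrow> t \<in> T0 \<and> \<psi> ` A t = \<psi> ` A t0" for t
    using t0 by (auto simp: cls assms(11) I_eq)
  then have T00: "t0_class = {t. Col t = {1}}"
    using g.psi_image_eq_iff[OF Col0] by (auto simp: T0)
  have c1: "card {t. 1 \<in> Col t} = card t0_class + card T1"
    and c2: "card {t. 2 \<in> Col t} = card (T0 - t0_class) + card T1"
  proof -
    have u1: "{t. 1 \<in> Col t} = t0_class \<union> T1" and u2: "{t. 2 \<in> Col t} = (T0 - t0_class) \<union> T1"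
      unfolding T0 T1 T00 by (auto simp: mem_2_iff)
    have "finite (t0_class \<union> T1)" "finite ((T0 - t0_class) \<union> T1)"
      using g.finite_Col[of 1] g.finite_Col[of 2] by (simp_all add: u1 u2)
    moreover have "t0_class \<inter> T1 = {}" "(T0 - t0_class) \<inter> T1 = {}"
      using UNIV_2_neq_singleton by (auto simp: T0 T1 T00)
    ultimately show "card {t. 1 \<in> Col t} = card t0_class + card T1"
      "card {t. 2 \<in> Col t} = card (T0 - t0_class) + card T1"
      unfolding u1 u2 by (simp_all add: card_Un_disjoint)
  qed
  let ?m = "real (card t0_class)"
  let ?M = "real (card T1) + ?m" and ?N = "real (card T0) + real (card T1) - ?m"
  have sub: "t0_class \<subseteq> T0" by (auto simp: T0 T00)
  have finT0: "finite T0"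
  proof (rule finite_subset)
    show "T0 \<subseteq> {t. 1 \<in> Col t} \<union> {t. 2 \<in> Col t}"
      unfolding T0 by (auto simp: mem_2_iff)
  qed (simp add: g.finite_Col)
  have cd: "card (T0 - t0_class) = card T0 - card t0_class" "card t0_class \<le> card T0"
    using sub finT0 by (auto intro: card_Diff_subset card_mono finite_subset)
  have M: "real (card {t. 1 \<in> Col t}) = ?M" and N: "real (card {t. 2 \<in> Col t}) = ?N"
    using cd by (simp_all add: c1 c2)
  \<comment> \<open>The majority assumption enters here: it gives the order of \<open>M\<close> and
    \<open>N\<close> required by \<open>codim_growth\<close>.\<close>
  have lt: "?N < ?M" using assms(13) by simp
  have Npos: "?N > 0" using g.card_Col_2_pos[OF h.hom_surj] N by linarith
  have "(sqrt ?M + sqrt ?N)\<^sup>2 = real (card T0) + 2 * real (card T1) + 2 * sqrt (?M * ?N)"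
    using lt Npos by (simp add: power2_sum real_sqrt_mult)
  moreover have "(\<lambda>n. root n (real (graded_codim n))) \<longlonglongrightarrow> (sqrt ?M + sqrt ?N)\<^sup>2"
    using g.codim_growth[OF refl refl] lt Npos unfolding M[symmetric] N[symmetric] by simp
  \<comment> \<open>The inequality of arithmetic and geometric means, strict because
    \<open>?M\<close> and \<open>?N\<close> differ.\<close>
  moreover have "2 * sqrt (?M * ?N) < ?M + ?N"
  proof -
    have "0 < (sqrt ?M - sqrt ?N)\<^sup>2" using lt by simp
    then show ?thesis using lt Npos by (simp add: power2_diff real_sqrt_mult)
  qed
  moreover have "2 * card T0 + 4 * card T1 = dim UNIV"
    using cd by (simp add: g.dim_eq_card_slots g.card_slots c1 c2)
  ultimately show ?thesis by auto
qed

end
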